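(* Let $q\ge1$, let $A=(a_1,\ldots,a_q)$, $B=(b_1,\ldots,b_q)$ be real vectors with $B\prec^W A$ and $\psi=\sum_{i=1}^{q}(b_i-a_i)>0$, let $0<\sigma\le1$, and let $j\ge-1$ be an integer. Then the Padé approximants $[m+j/m]$ (numerator degree $m+j$, denominator degree $m$) at $z=0$ to the function $z\mapsto{}_{q+1}F_q(\sigma,A;B;-z)$ have the form $$ \frac{P^{[m+j/m]}(z)}{Q^{[m+j/m]}(z)}=\frac{P^{[m+j/m]}(z)}{(-z)^m\pi^j_m(-1/z)}, $$ where $\pi_m^j(s)$ are the polynomials (of degree $m$) orthogonal with respect to the following inner product: $$ \int_{0}^{1}\pi_m^j(s)\pi_n^j(s)\,s^j\,G^{q+1,0}_{q+1,q+1}\left(s\,\Big|\begin{array}{c}1,B\\ \sigma,A\end{array}\right)ds=\mathrm{const}\times\delta_{mn} $$ (where the constant may depend on $m$). The numerator polynomials $P^{[m+j/m]}(z)$ (of degree at most $m+j$) are found from $$ {}_{q+1}F_q(\sigma,A;B;-z)\,Q^{[m+j/m]}(z)-P^{[m+j/m]}(z)=O(z^{2m+j+1}),\qquad z\to0. $$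
   Context: $B\prec^W A$ means: $0<a_1\le\cdots\le a_q$, $0<b_1\le\cdots\le b_q$, and $\sum_{i=1}^{k}a_i\le\sum_{i=1}^{k}b_i$ for $k=1,\ldots,q$. The generalized hypergeometric function is ${}_{q+1}F_q(\sigma,A;B;z)=\sum_{n=0}^{\infty}\frac{(\sigma)_n(a_1)_n\cdots(a_q)_n}{(b_1)_n\cdots(b_q)_n\,n!}z^n$ for $|z|<1$, extended by analytic continuation to $\mathbb{C}\setminus[1,\infty)$; $(a)_0=1$, $(a)_n=a(a+1)\cdots(a+n-1)$. The Padé approximant $[k/n]$ at $z=0$ to $f$ is the rational function $P/Q$ determined by polynomials $P$, $Q\not\equiv0$ with $\deg P\le k$, $\deg Q\le n$ and $f(z)Q(z)-P(z)=O(z^{k+n+1})$ as $z\to0$. For real vectors $C=(c_1,\ldots,c_p)$, $D=(d_1,\ldots,d_p)$ and $x>0$, Meijer's function is $$G^{p,0}_{p,p}\left(x\,\Big|\begin{array}{c}D\\C\end{array}\right)=\frac{1}{2\pi i}\int_{\gamma-i\infty}^{\gamma+i\infty}\frac{\Gamma(c_1+s)\cdots\Gamma(c_p+s)}{\Gamma(d_1+s)\cdots\Gamma(d_p+s)}x^{-s}\,ds,\qquad \gamma>-\min(c_1,\ldots,c_p),$$ the integral being understood as $\lim_{R\to\infty}\int_{\gamma-iR}^{\gamma+iR}$. Here $p=q+1$, $D=(1,b_1,\ldots,b_q)$ and $C=(\sigma,a_1,\ldots,a_q)$. $\delta_{mn}$ is the Kronecker delta. *)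

theory Defs
  imports
    "HOL-Complex_Analysis.Complex_Analysis"
    "HOL-Computational_Algebra.Computational_Algebra"
    "HOL-Library.Landau_Symbols"
begin

text \<open>
  Parameter vectors are lists, so \<open>a\<^sub>k\<close> is \<open>A ! (k - 1)\<close>.
\<close>

definition weak_supermajorized :: "real list \<Rightarrow> real list \<Rightarrow> bool"  (infix "\<prec>\<^sup>W" 50) where
  "B \<prec>\<^sup>W A \<longleftrightarrow>
     length B = length A \<and>
     sorted A \<and> (\<forall>a\<in>set A. 0 < a) \<and>
     sorted B \<and> (\<forall>b\<in>set B. 0 < b) \<and>
     (\<forall>k\<in>{1..length A}. sum_list (take k A) \<le> sum_list (take k B))"

definition hypergeometric_coeff :: "real list \<Rightarrow> real list \<Rightarrow> nat \<Rightarrow> real" where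
  "hypergeometric_coeff as bs n =
     (\<Prod>a\<leftarrow>as. pochhammer a n) / ((\<Prod>b\<leftarrow>bs. pochhammer b n) * fact n)"

definition hypergeometric_series :: "real list \<Rightarrow> real list \<Rightarrow> complex \<Rightarrow> complex" where
  "hypergeometric_series as bs z = (\<Sum>n. of_real (hypergeometric_coeff as bs n) * z ^ n)"

text \<open>
  The value on the cut \<open>[1, \<infinity>)\<close> is unspecified.
\<close>

definition hypergeometric :: "real list \<Rightarrow> real list \<Rightarrow> complex \<Rightarrow> complex" where
  "hypergeometric as bs z =
     (if norm z < 1 then hypergeometric_series as bs z
      else (SOME F. F holomorphic_on (- (complex_of_real ` {1..})) \<and>
                    (\<forall>u\<in>ball 0 1. F u = hypergeometric_series as bs u)) z)"

text \<open>
  The upper row \<open>D\<close> of Meijer's function comes first, the lower row \<open>C\<close> second.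
  The value of the function is the common limit, over all admissible abscissae \<open>\<gamma>\<close>, of the
  integrals over the segments from \<open>\<gamma> - \<i>R\<close> to \<open>\<gamma> + \<i>R\<close>.
\<close>

definition meijer_G_truncated ::
    "real list \<Rightarrow> real list \<Rightarrow> real \<Rightarrow> real \<Rightarrow> real \<Rightarrow> complex" where
  "meijer_G_truncated D C x \<gamma> R =
     1 / (2 * of_real pi * \<i>) *
     contour_integral (linepath (Complex \<gamma> (- R)) (Complex \<gamma> R))
       (\<lambda>s. (\<Prod>c\<leftarrow>C. Gamma (of_real c + s)) / (\<Prod>d\<leftarrow>D. Gamma (of_real d + s))
              * of_real x powr (- s))"

definition has_meijer_G :: "real list \<Rightarrow> real list \<Rightarrow> real \<Rightarrow> complex \<Rightarrow> bool" where
  "has_meijer_G D C x v \<longleftrightarrow>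
     (\<forall>\<gamma>. \<gamma> > - Min (set C) \<longrightarrow> (meijer_G_truncated D C x \<gamma> \<longlongrightarrow> v) at_top)"

definition meijer_G :: "real list \<Rightarrow> real list \<Rightarrow> real \<Rightarrow> complex" where
  "meijer_G D C x = (THE v. has_meijer_G D C x v)"

text \<open>
  The weight is complex-valued because Meijer's function is defined as a complex integral.
  The second predicate says that the bilinear form is well defined on real polynomials and is
  an inner product there.
\<close>

definition weighted_product :: "(real \<Rightarrow> complex) \<Rightarrow> real poly \<Rightarrow> real poly \<Rightarrow> complex" where
  "weighted_product w p r = (LINT s:{0<..<1}|lborel. of_real (poly p s * poly r s) * w s)"

definition is_inner_product_weight :: "(real \<Rightarrow> complex) \<Rightarrow> bool" where
  "is_inner_product_weight w \<longleftrightarrow>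
     (\<forall>p. set_integrable lborel {0<..<1} (\<lambda>s. of_real (poly p s) * w s)) \<and>
     (\<forall>p r. weighted_product w p r \<in> \<real>) \<and>
     (\<forall>p. p \<noteq> 0 \<longrightarrow> Re (weighted_product w p p) > 0)"

definition orthogonal_polys :: "(real \<Rightarrow> complex) \<Rightarrow> (nat \<Rightarrow> real poly) \<Rightarrow> bool" where
  "orthogonal_polys w \<pi> \<longleftrightarrow>
     (\<forall>m. \<pi> m \<noteq> 0 \<and> degree (\<pi> m) = m) \<and>
     (\<exists>h. \<forall>m n. weighted_product w (\<pi> m) (\<pi> n) = (if m = n then h m else 0))"

text \<open>
  The numerator degree bound is an integer so that the bound \<open>-1\<close> can occur;
  it forces the numerator to vanish.
\<close>

definition pade_pair ::
    "(complex \<Rightarrow> complex) \<Rightarrow> int \<Rightarrow> nat \<Rightarrow> complex poly \<Rightarrow> complex poly \<Rightarrow> bool" where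
  "pade_pair f k n P Q \<longleftrightarrow>
     Q \<noteq> 0 \<and> (P = 0 \<or> int (degree P) \<le> k) \<and> degree Q \<le> n \<and>
     (\<lambda>z. f z * poly Q z - poly P z) \<in> O[at 0](\<lambda>z. z ^ nat (k + int n + 1))"

definition is_pade_approximant ::
    "(complex \<Rightarrow> complex) \<Rightarrow> int \<Rightarrow> nat \<Rightarrow> complex poly fract \<Rightarrow> bool" where
  "is_pade_approximant f k n R \<longleftrightarrow> (\<exists>P Q. pade_pair f k n P Q \<and> R = Fract P Q)"

end

theory Submission
  imports Defs "HOL-Probability.Sinc_Integral" "HOL-Real_Asymp.Real_Asymp"
begin

text \<open>
  The coefficients of the hypergeometric series are, up to a constant, values of a quotient of Gamma
  functions \<open>\<Prod>\<^sub>i \<Gamma>(c\<^sub>i + z) / \<Gamma>(d\<^sub>i + z)\<close> at integers, and \<open>G\<close> is the inverse Mellin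
  transform of this quotient. So the series is the Stieltjes function of the measure \<open>G(s) ds / s\<close>,
  and orthogonality with respect to \<open>s\<^sup>j G(s) ds\<close> says exactly that the Taylor coefficients in the
  Pade gap vanish.

  Positivity and integrability of \<open>G\<close> come from a construction of \<open>G\<close>. The logarithmic derivative of
  the quotient is minus the Laplace transform of
  \<open>k(t) = (\<Sum>\<^sub>i exp(-c\<^sub>i t) - exp(-d\<^sub>i t)) / (1 - exp(-t))\<close>, and \<open>k \<ge> 0\<close> by majorization and
  \<open>\<sigma> \<le> 1\<close>. If \<open>h\<close> solves \<open>t h(t) = \<integral>\<^sub>0\<^sup>t k(t - u) h(u) du\<close>, then the Laplace transform of \<open>h\<close>
  satisfies the same first-order differential equation as the quotient, hence is a multiple of it. The
  integral equation makes \<open>h\<close> positive and locally Lipschitz, which is enough for Fourier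
  inversion to converge pointwise on every vertical line, and \<open>G(x) = h(-ln x)\<close> up to normalization.
\<close>

subsection \<open>The Volterra equation\<close>

text \<open>The excess, the sum of all \<open>d\<^sub>i - c\<^sub>i\<close>, equals \<psi> + 1 -
  \<sigma> and may be arbitrarily small. On vertical lines the Gamma quotient decays only like
  \<open>|Im s|\<close> to minus this power, so the integral defining \<open>G\<close> is in general
  conditionally convergent, and neither the sign nor the moments of \<open>G\<close> can be read off
  from it. Therefore a density with known sign and moments is built on the real line, and the
  contour integral is evaluated afterwards. The excess is also \<open>k(0)\<close>, and
  \<open>h(t)\<close> behaves like \<open>t powr (k(0) - 1)\<close> near 0. So \<open>h\<close> may
  be unbounded there, and the regularity required for inversion is available only locally, at points
  \<open>t > 0\<close>; these are the points \<open>0 < x < 1\<close> of \<open>G\<close>. All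
  parameters are shifted by the smallest one, so that Laplace transforms are needed on
  \<open>Re z > 0\<close> only. Since the smallest parameter is positive, \<open>G(s) / s\<close> is
  still integrable on (0,1), which is what admits \<open>j = -1\<close>.\<close>

lemma mult_exp_minus_le: "0 < \<mu> \<Longrightarrow> 0 \<le> (x::real) \<Longrightarrow> x * exp (- \<mu> * x) \<le> 1 / \<mu>"
proof -
  assume "0 < \<mu>" "0 \<le> x"
  have "1 + \<mu> * x \<le> exp (\<mu> * x)" by (rule exp_ge_add_one_self)
  then have "\<mu> * x \<le> exp (\<mu> * x)" by linarith
  then show ?thesis using \<open>0 < \<mu>\<close> by (simp add: field_simps exp_minus)
qed

text \<open>\<open>K\<close> controls the growth of the solution, \<open>P\<close> the contraction
  constant. The one-sided derivative \<open>D\<close> is there so that \<open>(k t - a) / t\<close>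
  extends continuously to 0.\<close>

locale volterra_kernel =
  fixes k :: "real \<Rightarrow> real" and a K P D :: real
  assumes k_0: "k 0 = a" and a_pos: "0 < a"
    and k_nonneg: "\<And>t. 0 \<le> t \<Longrightarrow> 0 \<le> k t"
    and k_le: "\<And>t. 0 \<le> t \<Longrightarrow> k t \<le> K"
    and k_lipschitz: "\<And>t u. 0 \<le> t \<Longrightarrow> 0 \<le> u \<Longrightarrow> \<bar>k t - k u\<bar> \<le> P * \<bar>t - u\<bar>"
    and k_deriv_0: "(k has_real_derivative D) (at 0 within {0..})"
begin

text \<open>
  The solution is sought as \<open>h(t) = t\<^sup>a\<^sup>-\<^sup>1 \<phi>(t)\<close> with \<open>a = k(0)\<close>. Putting \<open>u = t w\<^sup>1\<^sup>/\<^sup>a\<close> absorbs the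
  singular factor and turns the equation into
  \<open>a \<phi>(t) = \<integral>\<^sub>0\<^sup>1 k(t(1 - w\<^sup>1\<^sup>/\<^sup>a)) \<phi>(t w\<^sup>1\<^sup>/\<^sup>a) dw\<close>.
  The right-hand side is not a contraction. Splitting \<open>k = a + (k - a)\<close> and inverting the part coming
  from the constant \<open>a\<close> gives the equivalent fixed point equation \<open>\<phi> = S \<phi>\<close>, which is contractive in
  a norm with weight \<open>exp(-\<mu> t)\<close>.
\<close>

definition v :: "real \<Rightarrow> real" where "v w = w powr (1 / a)"

definition \<rho> :: "real \<Rightarrow> real" where "\<rho> t = (if t = 0 then D else (k t - a) / t)"

definition Z :: "(real \<Rightarrow> real) \<Rightarrow> real \<Rightarrow> real" where
  "Z \<phi> t = (1 / a) * integral {0..1} (\<lambda>w. \<rho> (t * (1 - v w)) * (1 - v w) * \<phi> (t * v w))"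

text \<open>Let \<open>W t\<close> be the mean of \<open>\<phi> (t * v w)\<close> over
  \<open>w\<close> in [0,1]. The equation reads \<open>\<phi> = W + t * Z \<phi>\<close>. On the
  other hand \<open>W t\<close> is \<open>a / t powr a\<close> times the integral of
  \<open>u powr (a - 1) * \<phi> u\<close> over [0,t], and differentiation gives
  \<open>\<phi> = W + t * W' / a\<close>. Comparing the two yields \<open>W' = a * Z \<phi>\<close>;
  the initial value \<open>W 0 = 1\<close> is the normalization \<open>\<phi> 0 = 1\<close>.\<close>

definition S :: "(real \<Rightarrow> real) \<Rightarrow> real \<Rightarrow> real" where
  "S \<phi> t = 1 + t * Z \<phi> t + a * integral {0..t} (Z \<phi>)"

lemma v_simps [simp]: "v 0 = 0" "v 1 = 1"
  by (auto simp: v_def)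

lemma v_bounds: "0 \<le> w \<Longrightarrow> w \<le> 1 \<Longrightarrow> 0 \<le> v w \<and> v w \<le> 1"
  using a_pos by (auto simp: v_def intro: powr_le1)

lemma v_less_1: "0 \<le> w \<Longrightarrow> w < 1 \<Longrightarrow> v w < 1"
  using a_pos powr_less_mono2[of "1/a" w 1] by (auto simp: v_def)

lemma continuous_on_v: "continuous_on {0..} v"
  unfolding v_def using a_pos
  by (intro continuous_on_powr') (auto intro: continuous_intros)

lemma v_deriv: "0 < w \<Longrightarrow> (v has_real_derivative (1 / a) * w powr (1 / a - 1)) (at w)"
  unfolding v_def by (rule has_real_derivative_powr)

lemma P_nonneg: "0 \<le> P"
  using k_lipschitz[of 1 0] by (auto simp: abs_if split: if_splits)

lemma continuous_on_k: "continuous_on {0..} k"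
proof (rule continuous_onI)
  fix x e :: real assume xe: "x \<in> {0..}" "0 < e"
  show "\<exists>d>0. \<forall>x'\<in>{0..}. dist x' x < d \<longrightarrow> dist (k x') (k x) \<le> e"
  proof (intro exI[of _ "e / (P + 1)"] conjI ballI impI)
    show "0 < e / (P + 1)" using xe P_nonneg by simp
    fix x' :: real assume x': "x' \<in> {0..}" "dist x' x < e / (P + 1)"
    have "\<bar>k x' - k x\<bar> \<le> P * \<bar>x' - x\<bar>" using k_lipschitz x' xe by auto
    also have "\<dots> \<le> P * (e / (P + 1))" using x' P_nonneg by (intro mult_left_mono) (auto simp: dist_real_def)
    also have "\<dots> \<le> e" using P_nonneg xe by (simp add: field_simps)
    finally show "dist (k x') (k x) \<le> e" by (simp add: dist_real_def)
  qed
qed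

lemma \<rho>_bound: "0 < t \<Longrightarrow> \<bar>\<rho> t\<bar> \<le> P"
  using k_lipschitz[of t 0] k_0 by (auto simp: \<rho>_def field_simps abs_if split: if_splits)

lemma mult_\<rho>: "t * \<rho> t = k t - a"
  using k_0 by (simp add: \<rho>_def)

lemma continuous_on_\<rho>: "continuous_on {0..} \<rho>"
proof -
  have 1: "isCont \<rho> x" if "x > 0" for x
  proof -
    have "continuous_on {0<..} (\<lambda>t. (k t - a) / t)"
      by (intro continuous_intros continuous_on_subset[OF continuous_on_k]) auto
    then have "continuous_on {0<..} \<rho>"
      by (rule continuous_on_eq) (auto simp: \<rho>_def)
    then show ?thesis using that by (simp add: continuous_on_eq_continuous_at)
  qed
  have 2: "continuous (at 0 within {0..}) \<rho>"
  proof -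
    have "((\<lambda>t. (k t - k 0) / (t - 0)) \<longlongrightarrow> D) (at 0 within {0..})"
      using k_deriv_0 unfolding has_field_derivative_iff .
    then have "(\<rho> \<longlongrightarrow> D) (at 0 within {0..})"
      by (rule Lim_transform_eventually) (auto simp: \<rho>_def k_0 eventually_at_filter)
    then show ?thesis by (simp add: continuous_within \<rho>_def)
  qed
  show ?thesis unfolding continuous_on_eq_continuous_within
  proof
    fix x :: real assume "x \<in> {0..}"
    then show "continuous (at x within {0..}) \<rho>"
      using 1[of x] 2 by (cases "x = 0") (auto intro: continuous_at_imp_continuous_at_within)
  qed
qed

lemma continuous_on_integrand:
  assumes "continuous_on {0..} \<phi>" "continuous_on {0..} f"
  shows "continuous_on ({0..} \<times> {0..1}) (\<lambda>(t, w). f (t * (1 - v w)) * (1 - v w) * \<phi> (t * v w))"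
proof -
  have cv: "continuous_on ({0..} \<times> {0..1}) (\<lambda>p::real\<times>real. v (snd p))"
    by (rule continuous_on_compose2[OF continuous_on_v]) (auto intro: continuous_intros)
  have "continuous_on ({0..} \<times> {0..1}) (\<lambda>p. \<phi> (fst p * v (snd p)))"
    by (rule continuous_on_compose2[OF assms(1)]) (auto intro!: continuous_intros cv mult_nonneg_nonneg simp: v_bounds)
  moreover have "continuous_on ({0..} \<times> {0..1}) (\<lambda>p. f (fst p * (1 - v (snd p))))"
    by (rule continuous_on_compose2[OF assms(2)]) (auto intro!: continuous_intros cv mult_nonneg_nonneg simp: v_bounds)
  ultimately show ?thesis
    unfolding case_prod_unfold by (intro continuous_intros cv)
qed

lemma continuous_on_slice:
  assumes "continuous_on {0..} \<phi>" "continuous_on {0..} f" "0 \<le> t"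
  shows "continuous_on {0..1} (\<lambda>w. f (t * (1 - v w)) * (1 - v w) * \<phi> (t * v w))"
proof -
  have "continuous_on {0..1} (\<lambda>w. (\<lambda>(t, w). f (t * (1 - v w)) * (1 - v w) * \<phi> (t * v w)) (t, w))"
    by (rule continuous_on_compose2[OF continuous_on_integrand[OF assms(1,2)]])
       (use assms in \<open>auto intro!: continuous_intros\<close>)
  then show ?thesis by simp
qed

lemma continuous_on_Z:
  assumes "continuous_on {0..} \<phi>"
  shows "continuous_on {0..} (Z \<phi>)"
proof -
  have "continuous_on {0..} (\<lambda>t. integral (cbox 0 1) (\<lambda>w. \<rho> (t * (1 - v w)) * (1 - v w) * \<phi> (t * v w)))"
    by (rule integral_continuous_on_param)
       (use continuous_on_integrand[OF assms continuous_on_\<rho>] in simp)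
  then show ?thesis
    unfolding Z_def[abs_def] by (intro continuous_on_mult_left) simp
qed

lemma Z_integral_deriv:
  assumes "continuous_on {0..} \<phi>" "0 \<le> t"
  shows "((\<lambda>x. integral {0..x} (Z \<phi>)) has_real_derivative Z \<phi> t) (at t within {0..})"
proof -
  have "((\<lambda>x. integral {0..x} (Z \<phi>)) has_real_derivative Z \<phi> t) (at t within {0..t+1})"
    by (rule integral_has_real_derivative)
       (use assms in \<open>auto intro: continuous_on_subset[OF continuous_on_Z]\<close>)
  moreover have "at t within {0..t+1} = at t within {0..}"
    by (rule at_within_nhd[of t "{..<t+1}"]) (use assms in auto)
  ultimately show ?thesis by simp
qed

lemma continuous_on_S:
  assumes "continuous_on {0..} \<phi>"
  shows "continuous_on {0..} (S \<phi>)"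
proof -
  have "continuous_on {0..} (\<lambda>x. integral {0..x} (Z \<phi>))"
    by (rule DERIV_continuous_on[OF Z_integral_deriv[OF assms]]) auto
  then show ?thesis unfolding S_def[abs_def]
    by (intro continuous_intros continuous_on_Z assms)
qed

lemma Z_diff:
  assumes "continuous_on {0..} \<phi>" "continuous_on {0..} \<psi>" "0 \<le> t"
  shows "Z \<phi> t - Z \<psi> t = Z (\<lambda>x. \<phi> x - \<psi> x) t"
proof -
  have *: "(\<lambda>w. \<rho> (t * (1 - v w)) * (1 - v w) * g (t * v w)) integrable_on {0..1}"
    if "continuous_on {0..} g" for g
    by (intro integrable_continuous_real continuous_on_slice that assms continuous_on_\<rho>)
  show ?thesis
    unfolding Z_def right_diff_distrib[of "_ * _"]
    by (subst Henstock_Kurzweil_Integration.integral_diff[OF * *]) (use assms in \<open>simp_all add: right_diff_distrib\<close>)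
qed

text \<open>Each bound serves one term of \<open>S\<close>. The first gains a factor 1/\<mu> when it
  is integrated over [0,t]. The second gains it at once, because
  \<open>x * exp (- \<mu> * x) \<le> 1 / \<mu>\<close> applies to \<open>x = t * (1 - v w)\<close>,
  the factor that accompanies \<rho>.\<close>

lemma Z_bounds:
  assumes "continuous_on {0..} \<phi>" "0 \<le> t" "0 < \<mu>" "0 \<le> N"
    and le: "\<And>x. 0 \<le> x \<Longrightarrow> \<bar>\<phi> x\<bar> \<le> N * exp (\<mu> * x)"
  shows "\<bar>Z \<phi> t\<bar> \<le> N * P / a * exp (\<mu> * t)" "\<bar>t * Z \<phi> t\<bar> \<le> N * P / (a * \<mu>) * exp (\<mu> * t)"
proof -
  let ?f = "\<lambda>w. \<rho> (t * (1 - v w)) * (1 - v w) * \<phi> (t * v w)"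
  have int: "?f integrable_on {0..1}"
    by (auto intro!: integrable_continuous_real continuous_on_slice assms continuous_on_\<rho>)
  have key: "\<bar>?f w\<bar> \<le> P * (1 - v w) * (N * exp (\<mu> * (t * v w)))" if w: "w \<in> {0..1}" for w
  proof (cases "t * (1 - v w) = 0")
    case False
    then have "0 < t * (1 - v w)" using v_bounds[of w] w assms by (auto simp: zero_less_mult_iff)
    then have "\<bar>\<rho> (t * (1 - v w))\<bar> \<le> P" by (rule \<rho>_bound)
    then show ?thesis unfolding abs_mult using v_bounds[of w] w assms
      by (intro mult_mono le) auto
  next
    case True
    show ?thesis
    proof (cases "t = 0")
      case True
      \<comment> \<open>\<open>\<rho>_bound\<close> covers positive arguments; the value at 0
        inherits the bound as a limit from the right.\<close>
      have "((\<lambda>x. \<bar>\<rho> x\<bar>) \<longlongrightarrow> \<bar>\<rho> 0\<bar>) (at 0 within {0<..})"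
        using continuous_on_\<rho> by (auto simp: continuous_on_def intro!: tendsto_rabs intro: tendsto_within_subset)
      moreover have "\<forall>\<^sub>F x in at_right 0. \<bar>\<rho> x\<bar> \<le> P"
        unfolding eventually_at_filter by (rule always_eventually) (auto intro: \<rho>_bound)
      ultimately have "\<bar>\<rho> 0\<bar> \<le> P"
        by (rule tendsto_upperbound) simp
      then have "\<bar>\<rho> (t * (1 - v w))\<bar> \<le> P" using True by simp
      then show ?thesis unfolding abs_mult using v_bounds[of w] w assms
        by (intro mult_mono le) auto
    next
      case False
      then have "v w = 1" using \<open>t * (1 - v w) = 0\<close> by simp
      then show ?thesis by simp
    qed
  qed
  have key1: "\<bar>?f w\<bar> \<le> N * P * exp (\<mu> * t)" if w: "w \<in> {0..1}" for w
  proof -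
    have "P * (1 - v w) * (N * exp (\<mu> * (t * v w))) \<le> P * 1 * (N * exp (\<mu> * (t * 1)))"
      using v_bounds[of w] w assms P_nonneg
      by (intro mult_mono mult_nonneg_nonneg) (auto intro!: mult_left_mono mult_left_le)
    with key[OF w] show ?thesis by (simp add: mult_ac)
  qed
  have key2: "\<bar>t * ?f w\<bar> \<le> N * P / \<mu> * exp (\<mu> * t)" if w: "w \<in> {0..1}" for w
  proof -
    have "\<bar>t * ?f w\<bar> \<le> t * (P * (1 - v w) * (N * exp (\<mu> * (t * v w))))"
      using key[OF w] assms(2) by (simp add: abs_mult mult_left_mono)
    also have "\<dots> = P * N * ((t * (1 - v w)) * exp (- \<mu> * (t * (1 - v w)))) * exp (\<mu> * t)"
      by (simp add: exp_diff exp_add exp_minus field_simps flip: exp_add)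
    also have "\<dots> \<le> P * N * (1 / \<mu>) * exp (\<mu> * t)"
      using v_bounds[of w] w assms P_nonneg
      by (intro mult_right_mono mult_left_mono mult_exp_minus_le) auto
    finally show ?thesis by (simp add: mult_ac)
  qed
  have "\<bar>integral {0..1} ?f\<bar> \<le> N * P * exp (\<mu> * t) * (1 - 0)"
    using integral_bound[of 0 1 ?f "N * P * exp (\<mu> * t)"] key1 
      continuous_on_slice[OF assms(1) continuous_on_\<rho> assms(2)] by (auto simp: mult_ac)
  then show "\<bar>Z \<phi> t\<bar> \<le> N * P / a * exp (\<mu> * t)"
    using a_pos unfolding Z_def by (simp add: abs_mult field_simps)
  have "norm (integral {0..1} (\<lambda>w. t * ?f w)) \<le> N * P / \<mu> * exp (\<mu> * t) * (1 - 0)"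
    by (rule integral_bound)
       (use key2 in \<open>auto intro!: continuous_on_mult_left continuous_on_slice assms continuous_on_\<rho> simp del: mult.assoc\<close>)
  then have "\<bar>t * integral {0..1} ?f\<bar> \<le> N * P / \<mu> * exp (\<mu> * t)"
    by simp
  then have "\<bar>t * integral {0..1} ?f\<bar> / a \<le> N * P / \<mu> * exp (\<mu> * t) / a"
    using a_pos by (intro divide_right_mono) auto
  moreover have "\<bar>t * Z \<phi> t\<bar> = \<bar>t * integral {0..1} ?f\<bar> / a"
    using a_pos unfolding Z_def by (simp add: abs_mult)
  ultimately show "\<bar>t * Z \<phi> t\<bar> \<le> N * P / (a * \<mu>) * exp (\<mu> * t)"
    using a_pos by (simp add: mult_ac)
qed

text \<open>The two terms of \<open>S\<close> together have norm at most
  \<open>P * (1 + 1 / a) / \<mu>\<close> in the weighted norm; the lower bound on \<mu> makes this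
  at most 1/2.\<close>

lemma S_contraction:
  assumes "continuous_on {0..} \<phi>" "continuous_on {0..} \<psi>" "0 \<le> t" "0 \<le> N"
    and \<mu>: "2 * P * (1 + 1 / a) < \<mu>"
    and le: "\<And>x. 0 \<le> x \<Longrightarrow> \<bar>\<phi> x - \<psi> x\<bar> \<le> N * exp (\<mu> * x)"
  shows "\<bar>S \<phi> t - S \<psi> t\<bar> \<le> N / 2 * exp (\<mu> * t)"
proof -
  define \<delta> where "\<delta> = (\<lambda>x. \<phi> x - \<psi> x)"
  have \<delta>: "continuous_on {0..} \<delta>" unfolding \<delta>_def by (intro continuous_intros assms)
  have \<mu>0: "0 < \<mu>" using P_nonneg a_pos by (intro le_less_trans[OF _ \<mu>]) auto
  have Zb: "\<bar>Z \<delta> x\<bar> \<le> N * P / a * exp (\<mu> * x)" "\<bar>x * Z \<delta> x\<bar> \<le> N * P / (a * \<mu>) * exp (\<mu> * x)" if "0 \<le> x" for x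
    using Z_bounds[OF \<delta> that \<mu>0 \<open>0 \<le> N\<close>] le by (auto simp: \<delta>_def)
  have cont: "continuous_on {0..t} (Z f)" if "continuous_on {0..} f" for f
    by (rule continuous_on_subset[OF continuous_on_Z[OF that]]) auto
  have "((\<lambda>x. N * P / a * exp (\<mu> * x)) has_integral
          N * P / a * exp (\<mu> * t) / \<mu> - N * P / a * exp (\<mu> * 0) / \<mu>) {0..t}"
    by (rule fundamental_theorem_of_calculus)
       (use \<mu>0 a_pos assms(3) in \<open>auto intro!: derivative_eq_intros simp flip: has_real_derivative_iff_has_vector_derivative\<close>)
  then have "norm (integral {0..t} (Z \<delta>)) \<le> N * P / a * exp (\<mu> * t) / \<mu> - N * P / a * exp (\<mu> * 0) / \<mu>"
    using integral_norm_bound_integral[OF integrable_continuous_real[OF cont[OF \<delta>]], of "\<lambda>x. N * P / a * exp (\<mu> * x)"] Zb(1)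
    by (auto simp: has_integral_iff)
  also have "\<dots> \<le> N * P / a * exp (\<mu> * t) / \<mu>"
    using assms(4) P_nonneg a_pos \<mu>0 by simp
  finally have I: "\<bar>integral {0..t} (Z \<delta>)\<bar> \<le> N * P / (a * \<mu>) * exp (\<mu> * t)" by simp
  have "integral {0..t} (Z \<phi>) - integral {0..t} (Z \<psi>) = integral {0..t} (\<lambda>x. Z \<phi> x - Z \<psi> x)"
    by (rule Henstock_Kurzweil_Integration.integral_diff[symmetric])
       (intro integrable_continuous_real cont assms)+
  also have "\<dots> = integral {0..t} (Z \<delta>)"
    by (rule Henstock_Kurzweil_Integration.integral_cong)
       (auto simp: Z_diff[OF assms(1,2)] \<delta>_def)
  finally have "S \<phi> t - S \<psi> t = t * Z \<delta> t + a * integral {0..t} (Z \<delta>)"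
    using Z_diff[OF assms(1,2,3)] by (simp add: S_def \<delta>_def algebra_simps flip: right_diff_distrib)
  also have "\<bar>\<dots>\<bar> \<le> N * P / (a * \<mu>) * exp (\<mu> * t) + a * (N * P / (a * \<mu>) * exp (\<mu> * t))"
    by (intro order.trans[OF abs_triangle_ineq] add_mono Zb(2) assms(3))
       (use mult_left_mono[OF I, of a] a_pos in \<open>simp add: abs_mult\<close>)
  also have "\<dots> = N * exp (\<mu> * t) * (P * (1 + 1 / a) / \<mu>)"
    using a_pos \<mu>0 by (simp add: field_simps)
  also have "\<dots> \<le> N * exp (\<mu> * t) * (1 / 2)"
    using \<mu> \<mu>0 \<open>0 \<le> N\<close> by (intro mult_left_mono) (auto simp: field_simps)
  finally show ?thesis by simp
qed

text \<open>Dividing by \<open>exp (\<mu> * t)\<close> turns the weighted norm into the supremum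
  norm, so Banach's theorem applies to bounded continuous functions. These live on the whole line;
  \<open>max 0 t\<close> continues values from the half-line constantly to the left. Boundedness of
  \<open>F \<psi>\<close> follows from the contraction estimate against \<open>F 0\<close>.\<close>

lemma S_fixpoint: "\<exists>\<phi>. continuous_on {0..} \<phi> \<and> (\<forall>t\<ge>0. \<phi> t = S \<phi> t)"
proof -
  define \<mu> where "\<mu> = 2 * P * (1 + 1 / a) + 1"
  define lift where "lift \<psi> = (\<lambda>t. exp (\<mu> * t) * apply_bcontfun \<psi> t)" for \<psi> :: "real \<Rightarrow>\<^sub>C real"
  define F where "F \<psi> = (\<lambda>t. exp (- \<mu> * max 0 t) * S (lift \<psi>) (max 0 t))" for \<psi> :: "real \<Rightarrow>\<^sub>C real"
  have \<mu>: "2 * P * (1 + 1 / a) < \<mu>" "0 < \<mu>"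
    using P_nonneg a_pos by (auto simp: \<mu>_def intro!: add_nonneg_pos)
  have cl: "continuous_on {0..} (lift \<psi>)" for \<psi>
    unfolding lift_def by (intro continuous_intros continuous_on_apply_bcontfun)
  have diff: "\<bar>F \<psi> t - F \<xi> t\<bar> \<le> 1 / 2 * dist \<psi> \<xi>" for \<psi> \<xi> t
  proof -
    have "\<bar>S (lift \<psi>) (max 0 t) - S (lift \<xi>) (max 0 t)\<bar> \<le> dist \<psi> \<xi> / 2 * exp (\<mu> * max 0 t)"
    proof (rule S_contraction[OF cl cl _ _ \<mu>(1)])
      fix x :: real
      have "\<bar>\<psi> x - \<xi> x\<bar> \<le> dist \<psi> \<xi>" using dist_bounded[of \<psi> x \<xi>] by (simp add: dist_real_def)
      then show "\<bar>lift \<psi> x - lift \<xi> x\<bar> \<le> dist \<psi> \<xi> * exp (\<mu> * x)"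
        by (simp add: lift_def abs_mult flip: right_diff_distrib)
    qed auto
    then have "exp (- \<mu> * max 0 t) * \<bar>S (lift \<psi>) (max 0 t) - S (lift \<xi>) (max 0 t)\<bar>
        \<le> exp (- \<mu> * max 0 t) * (dist \<psi> \<xi> / 2 * exp (\<mu> * max 0 t))"
      by (intro mult_left_mono) auto
    also have "\<dots> = dist \<psi> \<xi> / 2" by (simp add: exp_minus)
    finally show ?thesis by (simp add: F_def abs_mult flip: right_diff_distrib)
  qed
  have F0: "\<bar>F 0 t\<bar> \<le> 1" for t
  proof -
    have "lift 0 = (\<lambda>t. 0)" by (simp add: lift_def)
    moreover have "Z (\<lambda>t. 0) = (\<lambda>t. 0)" by (simp add: Z_def[abs_def])
    ultimately have "S (lift 0) x = 1" for x by (simp add: S_def)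
    then show ?thesis using \<mu> by (simp add: F_def)
  qed
  have F: "F \<psi> \<in> bcontfun" for \<psi>
    unfolding bcontfun_def
  proof (safe)
    show "continuous_on UNIV (F \<psi>)"
      unfolding F_def
      by (intro continuous_intros continuous_on_compose2[OF continuous_on_S[OF cl]]) auto
    have "\<bar>F \<psi> t\<bar> \<le> 1 + 1 / 2 * dist \<psi> 0" for t
      using diff[of \<psi> t 0] F0[of t] by linarith
    then show "bounded (range (F \<psi>))" by (auto simp: bounded_iff)
  qed
  have "\<exists>!\<psi>. Bcontfun (F \<psi>) = \<psi>"
  proof (rule banach_fix_type[of "1/2"])
    show "\<forall>\<psi> \<xi>. dist (Bcontfun (F \<psi>)) (Bcontfun (F \<xi>)) \<le> 1 / 2 * dist \<psi> \<xi>"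
    proof (intro allI dist_bound)
      fix \<psi> \<xi> t
      show "dist (Bcontfun (F \<psi>) t) (Bcontfun (F \<xi>) t) \<le> 1 / 2 * dist \<psi> \<xi>"
        using diff[of \<psi> t \<xi>] by (simp only: Bcontfun_inverse[OF F] dist_real_def)
    qed
  qed auto
  then obtain \<psi> where "Bcontfun (F \<psi>) = \<psi>" by auto
  then have \<psi>: "apply_bcontfun \<psi> = F \<psi>" using Bcontfun_inverse[OF F, of \<psi>] by simp
  have "lift \<psi> t = S (lift \<psi>) t" if "0 \<le> t" for t
    using that by (subst lift_def) (simp add: \<psi> F_def exp_minus)
  with cl show ?thesis by blast
qed

section \<open>Positivity and growth of the solution\<close>

definition \<phi> :: "real \<Rightarrow> real" where
  "\<phi> = (SOME \<phi>. continuous_on {0..} \<phi> \<and> (\<forall>t\<ge>0. \<phi> t = S \<phi> t))"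

lemma continuous_on_\<phi>: "continuous_on {0..} \<phi>"
  and \<phi>_fixpoint: "0 \<le> t \<Longrightarrow> \<phi> t = S \<phi> t"
  using someI_ex[OF S_fixpoint] unfolding \<phi>_def by blast+

definition W :: "real \<Rightarrow> real" where "W t = 1 + a * integral {0..t} (Z \<phi>)"

lemma W_deriv: "0 \<le> t \<Longrightarrow> (W has_real_derivative a * Z \<phi> t) (at t within {0..})"
  unfolding W_def[abs_def]
  by (auto intro!: derivative_eq_intros Z_integral_deriv continuous_on_\<phi>)

lemma \<phi>_W: "0 \<le> t \<Longrightarrow> \<phi> t = W t + t * Z \<phi> t"
  by (subst \<phi>_fixpoint) (auto simp: S_def W_def)

lemma \<phi>_0: "\<phi> 0 = 1"
  by (simp add: \<phi>_W W_def)

text \<open>The function \<open>w * W (t * v w)\<close> is a primitive: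
  \<open>w * v' w = v w / a\<close> and \<open>W' = a * Z \<phi>\<close> make its derivative
  \<open>W + x * Z \<phi>\<close> at \<open>x = t * v w\<close>, which is
  \<open>\<phi> x\<close>.\<close>

lemma has_integral_\<phi>_v:
  assumes "0 \<le> t"
  shows "((\<lambda>w. \<phi> (t * v w)) has_integral W t) {0..1}"
proof -
  have "((\<lambda>w. \<phi> (t * v w)) has_integral 1 * W (t * v 1) - 0 * W (t * v 0)) {0..1}"
  proof (rule fundamental_theorem_of_calculus_interior)
    have "continuous_on {0..} W"
      by (rule DERIV_continuous_on[OF W_deriv]) auto
    then show "continuous_on {0..1} (\<lambda>w. w * W (t * v w))"
      using assms
      by (intro continuous_on_mult continuous_on_id continuous_on_const continuous_on_subset[OF continuous_on_v]
            continuous_on_compose2[of "{0..}" W "{0..1}" "\<lambda>w. t * v w"])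
         (auto intro!: mult_nonneg_nonneg simp: v_bounds)
    fix w :: real assume w: "w \<in> {0<..<1}"
    show "((\<lambda>w. w * W (t * v w)) has_vector_derivative \<phi> (t * v w)) (at w)"
    proof (cases "t = 0")
      case True
      have "((\<lambda>w. w) has_vector_derivative 1) (at w)" by (rule has_vector_derivative_id)
      then show ?thesis using True by (simp add: \<phi>_0 W_def)
    next
      case False
      have v0: "0 < v w" using w by (simp add: v_def)
      then have tv: "0 < t * v w" using False assms by simp
      have "(W has_real_derivative a * Z \<phi> (t * v w)) (at (t * v w))"
        using W_deriv[of "t * v w"] tv at_within_interior[of "t * v w" "{0..}"] by simp
      from DERIV_chain2[OF this DERIV_cmult[OF v_deriv]] have "((\<lambda>w. W (t * v w)) has_real_derivative
          a * Z \<phi> (t * v w) * (t * ((1 / a) * w powr (1 / a - 1)))) (at w)"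
        using w by simp
      from DERIV_mult'[OF DERIV_ident this] have "((\<lambda>w. w * W (t * v w)) has_real_derivative
          w * (a * Z \<phi> (t * v w) * (t * ((1 / a) * w powr (1 / a - 1)))) + 1 * W (t * v w)) (at w)"
        .
      also have "w * (a * Z \<phi> (t * v w) * (t * ((1 / a) * w powr (1 / a - 1)))) + 1 * W (t * v w) = \<phi> (t * v w)"
      proof -
        have "w * w powr (1 / a - 1) = v w" using w by (simp add: v_def powr_diff)
        then have "w * (a * Z \<phi> (t * v w) * (t * ((1 / a) * w powr (1 / a - 1)))) = t * v w * Z \<phi> (t * v w)"
          using a_pos by (simp add: field_simps)
        then show ?thesis using \<phi>_W[of "t * v w"] tv by simp
      qed
      finally show ?thesis by (simp add: has_real_derivative_iff_has_vector_derivative)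
    qed
  qed auto
  then show ?thesis by simp
qed

lemma continuous_on_\<phi>_v: "0 \<le> t \<Longrightarrow> continuous_on {0..1} (\<lambda>w. \<phi> (t * v w))"
  by (intro continuous_intros continuous_on_compose2[OF continuous_on_\<phi>] continuous_on_subset[OF continuous_on_v])
     (auto intro!: mult_nonneg_nonneg simp: v_bounds)

lemma continuous_on_k_v: "0 \<le> t \<Longrightarrow> continuous_on {0..1} (\<lambda>w. k (t * (1 - v w)))"
  by (intro continuous_intros continuous_on_compose2[OF continuous_on_k] continuous_on_subset[OF continuous_on_v])
     (auto intro!: mult_nonneg_nonneg simp: v_bounds)

text \<open>This undoes the splitting of \<open>k\<close>: the constant part contributes
  \<open>a * W t\<close>, the remainder \<open>a * t * Z \<phi> t\<close>, and together they give
  \<open>a * \<phi> t\<close>.\<close>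

lemma \<phi>_equation:
  assumes "0 \<le> t"
  shows "((\<lambda>w. k (t * (1 - v w)) * \<phi> (t * v w)) has_integral a * \<phi> t) {0..1}"
proof -
  have 1: "((\<lambda>w. \<rho> (t * (1 - v w)) * (1 - v w) * \<phi> (t * v w)) has_integral a * Z \<phi> t) {0..1}"
    using a_pos integrable_integral[OF integrable_continuous_real[OF continuous_on_slice[OF continuous_on_\<phi> continuous_on_\<rho> assms]]]
    by (simp add: Z_def)
  have "((\<lambda>w. a * \<phi> (t * v w) + t * (\<rho> (t * (1 - v w)) * (1 - v w) * \<phi> (t * v w)))
      has_integral a * W t + t * (a * Z \<phi> t)) {0..1}"
    by (intro has_integral_add has_integral_mult_right has_integral_\<phi>_v assms 1)
  also have "a * W t + t * (a * Z \<phi> t) = a * \<phi> t"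
    using \<phi>_W[OF assms] by (simp add: algebra_simps)
  also have "(\<lambda>w. a * \<phi> (t * v w) + t * (\<rho> (t * (1 - v w)) * (1 - v w) * \<phi> (t * v w))) =
      (\<lambda>w. k (t * (1 - v w)) * \<phi> (t * v w))"
  proof
    fix w
    have "t * (\<rho> (t * (1 - v w)) * (1 - v w) * \<phi> (t * v w)) = (t * (1 - v w) * \<rho> (t * (1 - v w))) * \<phi> (t * v w)"
      by (simp add: mult_ac)
    then show "a * \<phi> (t * v w) + t * (\<rho> (t * (1 - v w)) * (1 - v w) * \<phi> (t * v w)) = k (t * (1 - v w)) * \<phi> (t * v w)"
      unfolding mult_\<rho> by (simp add: algebra_simps)
  qed
  finally show ?thesis .
qed

text \<open>At a first zero \<open>t0\<close> the integrand of the equation is nonnegative and has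
  integral \<open>a * \<phi> t0 = 0\<close>, so it vanishes identically. As \<phi> is positive
  before \<open>t0\<close>, the kernel must vanish on (0,\<open>t0\<close>] and, by continuity, at
  0. This contradicts \<open>k 0 = a > 0\<close>.\<close>

lemma \<phi>_pos:
  assumes "0 \<le> t"
  shows "0 < \<phi> t"
proof (rule ccontr)
  assume neg: "\<not> 0 < \<phi> t"
  define t0 where "t0 = Inf {x \<in> {0..t}. \<phi> x \<le> 0}"
  let ?A = "{x \<in> {0..t}. \<phi> x \<le> 0}"
  have ct: "continuous_on {0..t} \<phi>" by (rule continuous_on_subset[OF continuous_on_\<phi>]) auto
  have "closed ?A"
    by (intro continuous_on_closed_Collect_le ct continuous_intros)
  moreover have "t \<in> ?A" using neg assms by auto
  moreover have bdd: "bdd_below ?A" by (rule bdd_belowI[of _ 0]) auto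
  ultimately have t0A: "t0 \<in> ?A" unfolding t0_def by (intro closed_contains_Inf) auto
  have before: "0 < \<phi> x" if "0 \<le> x" "x < t0" for x
  proof (rule ccontr)
    assume "\<not> 0 < \<phi> x"
    then have "x \<in> ?A" using that t0A by auto
    from cInf_lower[OF this bdd] show False using that by (simp add: t0_def)
  qed
  have t0: "0 < t0" using t0A \<phi>_0 by (cases "t0 = 0") auto
  have nonneg: "0 \<le> k (t0 * (1 - v w)) * \<phi> (t0 * v w)" if "w \<in> {0..<1}" for w
    using that t0 v_bounds[of w] v_less_1[of w] by (intro mult_nonneg_nonneg k_nonneg less_imp_le[OF before]) auto
  have cont: "continuous_on {0..1} (\<lambda>w. k (t0 * (1 - v w)) * \<phi> (t0 * v w))"
    using t0 by (intro continuous_intros continuous_on_\<phi>_v continuous_on_k_v) auto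
  have nonneg': "0 \<le> k (t0 * (1 - v w)) * \<phi> (t0 * v w)" if "w \<in> {0..1}" for w
    by (rule continuous_ge_on_closure[of "{0..<1}" _ w 0]) (use cont nonneg that in auto)
  have "0 \<le> a * \<phi> t0"
    by (rule has_integral_nonneg[OF \<phi>_equation nonneg']) (use t0 in auto)
  then have "\<phi> t0 = 0" using t0A a_pos by (auto simp: zero_le_mult_iff)
  then have "((\<lambda>w. k (t0 * (1 - v w)) * \<phi> (t0 * v w)) has_integral 0) (cbox 0 1)"
    using \<phi>_equation[of t0] t0 by simp
  then have zero: "k (t0 * (1 - v w)) * \<phi> (t0 * v w) = 0" if "w \<in> {0..1}" for w
    using has_integral_0_cbox_imp_0[of 0 1 "\<lambda>w. k (t0 * (1 - v w)) * \<phi> (t0 * v w)" w] cont nonneg' that by auto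
  have "k (t0 * (1 - v w)) = 0" if "w \<in> {0..<1}" for w
    using zero[of w] before[of "t0 * v w"] that t0 v_bounds[of w] v_less_1[of w] by auto
  then have "k (t0 * (1 - v 1)) = 0"
    by (intro continuous_constant_on_closure[of "{0..<1}" "\<lambda>w. k (t0 * (1 - v w))" 0 1])
       (use continuous_on_k_v t0 in auto)
  then show False using k_0 a_pos by simp
qed


lemma has_integral_substitution_v:
  assumes "0 < t" and F: "continuous_on {0..t} F"
  shows "((\<lambda>u. u powr (a - 1) * F u) has_integral t powr a / a * integral {0..1} (\<lambda>w. F (t * v w))) {0..t}"
proof -
  let ?f = "\<lambda>w. F (t * v w)" and ?g = "\<lambda>u. (u / t) powr a"
  have vg: "v (?g u) = u / t" if "0 \<le> u" for u
    using that assms a_pos by (simp add: v_def powr_powr)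
  have "((\<lambda>u. (a * (u / t) powr (a - 1) / t) *\<^sub>R ?f (?g u)) has_integral (integral {?g 0..?g t} ?f)) {0..t}"
  \<comment> \<open>The point 0 is exempted because \<open>(u / t) powr a\<close> has no finite
    derivative there when \<open>a < 1\<close>.\<close>
  proof (rule has_integral_substitution_strong[of "{0}"])
    show "continuous_on {0..1} ?f"
      using assms by (intro continuous_on_compose2[OF F] continuous_intros continuous_on_subset[OF continuous_on_v])
        (auto intro!: mult_nonneg_nonneg mult_left_le simp: v_bounds)
    show "continuous_on {0..t} ?g"
      using assms a_pos by (intro continuous_on_powr') (auto intro!: continuous_intros)
    show "?g ` {0..t} \<subseteq> {0..1}" using assms a_pos by (auto intro!: powr_le1)
    fix u assume u: "u \<in> {0..t} - {0}"
    have "(?g has_real_derivative a * (u / t) powr (a - 1) * (1 / t)) (at u)"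
      using u assms by (intro DERIV_chain2[OF has_real_derivative_powr]) (auto intro!: derivative_eq_intros)
    then show "(?g has_real_derivative a * (u / t) powr (a - 1) / t) (at u within {0..t})"
      by (auto intro: has_field_derivative_at_within)
  qed (use assms in auto)
  from has_integral_mult_right[OF this, of "t powr a / a"]
  have "((\<lambda>u. (t powr a / a) * ((a * (u / t) powr (a - 1) / t) *\<^sub>R ?f (?g u))) has_integral
      t powr a / a * integral {0..1} ?f) {0..t}"
    using assms by simp
  then show ?thesis
  proof (rule has_integral_eq[rotated])
    fix u assume u: "u \<in> {0..t}"
    have "(u / t) powr (a - 1) = u powr (a - 1) / t powr (a - 1)"
      using u assms by (simp add: powr_divide)
    moreover have "t * (u / t) = u"
      using assms by simp
    moreover have "t powr a = t * t powr (a - 1)" using assms by (simp add: powr_diff)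
    ultimately show "(t powr a / a) * ((a * (u / t) powr (a - 1) / t) *\<^sub>R ?f (?g u)) = u powr (a - 1) * F u"
      using assms a_pos u by (simp add: vg)
  qed
qed

lemma K_pos: "0 < K"
  using k_le[of 0] k_0 a_pos by simp

lemma W_bounds:
  assumes "0 \<le> t"
  shows "0 \<le> W t" "a * \<phi> t \<le> K * W t"
proof -
  show "0 \<le> W t"
    by (rule has_integral_nonneg[OF has_integral_\<phi>_v[OF assms]])
       (use assms in \<open>auto intro!: less_imp_le[OF \<phi>_pos] mult_nonneg_nonneg simp: v_bounds\<close>)
  show "a * \<phi> t \<le> K * W t"
  proof (rule has_integral_le[OF \<phi>_equation[OF assms] has_integral_mult_right[OF has_integral_\<phi>_v[OF assms]]])
    fix w :: real assume "w \<in> {0..1}"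
    then show "k (t * (1 - v w)) * \<phi> (t * v w) \<le> K * \<phi> (t * v w)"
      using assms by (intro mult_right_mono k_le less_imp_le[OF \<phi>_pos] mult_nonneg_nonneg) (auto simp: v_bounds)
  qed
qed

text \<open>Since \<open>a * Z \<phi>\<close> is \<open>W'\<close>, the bound
  \<open>a * \<phi> \<le> K * W\<close> says \<open>t * W' \<le> (K - a) * W\<close>. This is a
  Gronwall inequality: \<open>W t * t powr (a - K)\<close> does not increase.\<close>

lemma W_growth:
  assumes "1 \<le> t"
  shows "W t \<le> W 1 * t powr (K - a)"
proof -
  let ?V = "\<lambda>t. W t * t powr (a - K)"
  have "?V t \<le> ?V 1"
  proof (rule DERIV_nonpos_imp_nonincreasing[OF assms])
    fix x :: real assume x: "1 \<le> x"
    have "(W has_real_derivative a * Z \<phi> x) (at x)"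
      using W_deriv[of x] x at_within_interior[of x "{0..}"] by simp
    then have "(?V has_real_derivative a * Z \<phi> x * x powr (a - K) + (a - K) * x powr (a - K - 1) * W x) (at x)"
      using x by (intro DERIV_mult has_real_derivative_powr) auto
    moreover have "a * Z \<phi> x * x powr (a - K) + (a - K) * x powr (a - K - 1) * W x \<le> 0"
    proof -
      have "x powr (a - K) = x * x powr (a - K - 1)" using x by (simp add: powr_diff)
      then have "a * Z \<phi> x * x powr (a - K) + (a - K) * x powr (a - K - 1) * W x
          = x powr (a - K - 1) * (a * (W x + x * Z \<phi> x) - K * W x)"
        by (simp add: algebra_simps)
      also have "\<dots> \<le> 0"
        using W_bounds(2)[of x] \<phi>_W[of x] x by (intro mult_nonneg_nonpos) auto
      finally show ?thesis .
    qed
    ultimately show "\<exists>y. (?V has_real_derivative y) (at x) \<and> y \<le> 0" by blast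
  qed
  moreover have "t powr (a - K) = inverse (t powr (K - a))" 
    by (simp flip: powr_minus)
  ultimately show ?thesis using assms by (simp add: field_simps)
qed

text \<open>The contraction argument alone yields growth of order \<open>exp (\<mu> * t)\<close>,
  which would confine the Laplace transform to \<open>Re z > \<mu>\<close>. Polynomial growth makes
  it converge on the whole right half-plane.\<close>

lemma \<phi>_growth: "\<exists>C n. 0 < C \<and> (\<forall>t\<ge>0. \<phi> t \<le> C * (1 + t) ^ n)"
proof -
  obtain C where C: "\<And>t. t \<in> {0..1} \<Longrightarrow> \<phi> t \<le> C"
    using compact_continuous_image[OF continuous_on_subset[OF continuous_on_\<phi>, of "{0..1}"] compact_Icc]
    by (auto dest!: compact_imp_bounded simp: bounded_iff) (meson abs_le_D1 atLeastAtMost_iff)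
  have C0: "0 < C" using C[of 0] \<phi>_0 by simp
  define n where "n = nat \<lceil>K - a\<rceil>"
  let ?C = "C + K / a * W 1"
  have *: "0 \<le> K / a * W 1" using K_pos a_pos W_bounds[of 1] by simp
  have "\<phi> t \<le> ?C * (1 + t) ^ n" if "0 \<le> t" for t
  proof (cases "t \<le> 1")
    case True
    have "\<phi> t \<le> C * 1" using C True that by simp
    also have "\<dots> \<le> ?C * (1 + t) ^ n" using that C0 * by (intro mult_mono) auto
    finally show ?thesis .
  next
    case False
    have "\<phi> t \<le> K / a * W t" using W_bounds(2)[OF that] a_pos by (simp add: field_simps)
    also have "\<dots> \<le> K / a * (W 1 * t powr (K - a))"
      using False K_pos a_pos by (intro mult_left_mono W_growth) auto
    also have "t powr (K - a) \<le> (1 + t) powr real n"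
    proof -
      have "t powr (K - a) \<le> t powr real n" using False unfolding n_def
        by (intro powr_mono) (auto simp: le_nat_iff of_nat_ceiling)
      also have "\<dots> \<le> (1 + t) powr real n" using False by (intro powr_mono2) auto
      finally show ?thesis .
    qed
    also have "(1 + t) powr real n = (1 + t) ^ n" using that by (simp add: powr_realpow)
    finally have "\<phi> t \<le> K / a * W 1 * (1 + t) ^ n"
      using K_pos a_pos W_bounds(1)[of 1] by (simp add: mult_left_mono mult_right_mono mult_ac divide_right_mono)
    also have "\<dots> \<le> ?C * (1 + t) ^ n" using that C0 * by (intro mult_right_mono) auto
    finally show ?thesis .
  qed
  then show ?thesis using C0 * by (intro exI[of _ ?C] exI[of _ n]) auto
qed

end

subsection \<open>Laplace transforms\<close>

text \<open>Half of the exponential decay absorbs the factor \<open>t\<close>, at the price of the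
  constant \<open>2 / s\<close>.\<close>

lemma integrable_mult_t_exp:
  fixes h :: "real \<Rightarrow> real"
  assumes [measurable]: "h \<in> borel_measurable borel" and h0: "\<And>t. t \<le> 0 \<Longrightarrow> h t = 0"
    and int: "\<And>s. 0 < s \<Longrightarrow> integrable lborel (\<lambda>t. exp (- s * t) * h t)" and "0 < s"
  shows "integrable lborel (\<lambda>t. t * exp (- s * t) * h t)"
proof (rule Bochner_Integration.integrable_bound)
  show "integrable lborel (\<lambda>t. 2 / s * (exp (- (s / 2) * t) * h t))"
    using int[of "s / 2"] \<open>0 < s\<close> by (intro integrable_mult_right) auto
  show "AE t in lborel. norm (t * exp (- s * t) * h t) \<le> norm (2 / s * (exp (- (s / 2) * t) * h t))"
  proof (rule AE_I2)
    fix t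
    show "norm (t * exp (- s * t) * h t) \<le> norm (2 / s * (exp (- (s / 2) * t) * h t))"
    proof (cases "t \<le> 0")
      case False
      have "t * exp (- s * t) = (t * exp (- (s/2) * t)) * exp (- (s/2) * t)"
        by (simp add: flip: exp_add)
      also have "\<dots> \<le> 1 / (s / 2) * exp (- (s/2) * t)"
        using False \<open>0 < s\<close> by (intro mult_right_mono mult_exp_minus_le) auto
      finally have "t * exp (- s * t) * \<bar>h t\<bar> \<le> 1 / (s / 2) * exp (- (s/2) * t) * \<bar>h t\<bar>"
        by (rule mult_right_mono) auto
      then show ?thesis using False \<open>0 < s\<close> by (simp add: abs_mult)
    qed (simp add: h0)
  qed
qed simp

definition laplace :: "(real \<Rightarrow> real) \<Rightarrow> complex \<Rightarrow> complex" where
  "laplace h z = (LINT t|lborel. exp (- z * of_real t) * of_real (h t))"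

lemma integrable_laplace:
  assumes [measurable]: "h \<in> borel_measurable borel"
    and "integrable lborel (\<lambda>t. exp (- Re z * t) * h t)"
  shows "integrable lborel (\<lambda>t. exp (- z * of_real t) * of_real (h t))"
  by (rule Bochner_Integration.integrable_bound[OF assms(2)]) (auto simp: norm_mult)

text \<open>Differentiation under the integral by dominated convergence. The difference quotients of
  the exponential are bounded by the mean value inequality on a ball that keeps a positive distance
  from the imaginary axis.\<close>

lemma laplace_has_field_derivative:
  fixes h :: "real \<Rightarrow> real"
  assumes [measurable]: "h \<in> borel_measurable borel" and h0: "\<And>t. t \<le> 0 \<Longrightarrow> h t = 0"
    and int: "\<And>s. 0 < s \<Longrightarrow> integrable lborel (\<lambda>t. exp (- s * t) * h t)" and z: "0 < Re z"
  shows "(laplace h has_field_derivative (LINT t|lborel. - of_real t * exp (- z * of_real t) * of_real (h t))) (at z)"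
proof -
  define r where "r = Re z / 2"
  have r: "0 < r" "r < Re z" using z by (auto simp: r_def)
  have Re: "Re z - r < Re y" if "y \<in> ball z r" for y
    using abs_Re_le_cmod[of "z - y"] that by (auto simp: dist_norm)
  have L: "(laplace h has_field_derivative (LINT t|lborel. - of_real t * exp (- z * of_real t) * of_real (h t))) (at z within ball z r)"
    unfolding has_field_derivative_iff tendsto_at_iff_sequentially
  proof safe
    fix X :: "nat \<Rightarrow> complex" assume X: "\<forall>i. X i \<in> ball z r - {z}" and lim: "X \<longlonglongrightarrow> z"
    have intX: "integrable lborel (\<lambda>t. exp (- y * of_real t) * of_real (h t))" if "y \<in> ball z r" for y
      using Re[OF that] r by (intro integrable_laplace int) auto
    have "(\<lambda>i. LINT t|lborel. (exp (- X i * of_real t) - exp (- z * of_real t)) / (X i - z) * of_real (h t))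
          \<longlonglongrightarrow> (LINT t|lborel. - of_real t * exp (- z * of_real t) * of_real (h t))"
    proof (rule integral_dominated_convergence)
      show "integrable lborel (\<lambda>t. norm (t * exp (- (Re z - r) * t) * h t))"
        using r by (intro integrable_norm integrable_mult_t_exp int h0) auto
      show "AE t in lborel. (\<lambda>i. (exp (- X i * of_real t) - exp (- z * of_real t)) / (X i - z) * of_real (h t)) \<longlonglongrightarrow>
              - of_real t * exp (- z * of_real t) * of_real (h t)"
      proof (rule AE_I2)
        fix t :: real
        have "((\<lambda>y. exp (- y * of_real t)) has_field_derivative - of_real t * exp (- z * of_real t)) (at z within ball z r)"
          by (auto intro!: derivative_eq_intros)
        then have "(\<lambda>i. (exp (- X i * of_real t) - exp (- z * of_real t)) / (X i - z)) \<longlonglongrightarrow> - of_real t * exp (- z * of_real t)"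
          using X lim unfolding has_field_derivative_iff tendsto_at_iff_sequentially comp_def by blast
        then show "(\<lambda>i. (exp (- X i * of_real t) - exp (- z * of_real t)) / (X i - z) * of_real (h t)) \<longlonglongrightarrow>
              - of_real t * exp (- z * of_real t) * of_real (h t)"
          by (rule tendsto_mult_right)
      qed
      fix i
      show "AE t in lborel. norm ((exp (- X i * of_real t) - exp (- z * of_real t)) / (X i - z) * of_real (h t))
              \<le> norm (t * exp (- (Re z - r) * t) * h t)"
      proof (rule AE_I2)
        fix t :: real
        show "norm ((exp (- X i * of_real t) - exp (- z * of_real t)) / (X i - z) * of_real (h t))
              \<le> norm (t * exp (- (Re z - r) * t) * h t)"
        proof (cases "t \<le> 0")
          case False
          have "norm (exp (- X i * of_real t) - exp (- z * of_real t)) \<le> t * exp (- (Re z - r) * t) * norm (X i - z)"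
          proof (rule field_differentiable_bound[of "ball z r"])
            fix y assume y: "y \<in> ball z r"
            show "((\<lambda>y. exp (- y * of_real t)) has_field_derivative - of_real t * exp (- y * of_real t)) (at y within ball z r)"
              by (auto intro!: derivative_eq_intros)
            show "norm (- of_real t * exp (- y * of_real t)) \<le> t * exp (- (Re z - r) * t)"
              using False mult_right_mono[OF less_imp_le[OF Re[OF y]], of t] by (simp add: norm_mult algebra_simps)
          qed (use X r in auto)
          moreover have "X i - z \<noteq> 0" using X by auto
          ultimately have "norm (exp (- X i * of_real t) - exp (- z * of_real t)) / norm (X i - z) \<le> t * exp (- (Re z - r) * t)"
            by (simp add: field_simps)
          then have "norm (exp (- X i * of_real t) - exp (- z * of_real t)) / norm (X i - z) * \<bar>h t\<bar> \<le> t * exp (- (Re z - r) * t) * \<bar>h t\<bar>"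
            by (intro mult_right_mono) auto
          then show ?thesis using False by (simp add: norm_mult norm_divide abs_mult)
        qed (simp add: h0)
      qed
    qed auto
    also have "(\<lambda>i. LINT t|lborel. (exp (- X i * of_real t) - exp (- z * of_real t)) / (X i - z) * of_real (h t)) =
        (\<lambda>y. (laplace h y - laplace h z) / (y - z)) \<circ> X"
    proof
      fix i
      have "(LINT t|lborel. (exp (- X i * of_real t) - exp (- z * of_real t)) / (X i - z) * of_real (h t)) =
        (LINT t|lborel. (exp (- X i * of_real t) * of_real (h t) - exp (- z * of_real t) * of_real (h t)) / (X i - z))"
        by (simp add: algebra_simps)
      also have "\<dots> = (laplace h (X i) - laplace h z) / (X i - z)"
        unfolding laplace_def using X r intX[of "X i"] intX[of z] by (simp add: Bochner_Integration.integral_diff)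
      finally show "(LINT t|lborel. (exp (- X i * of_real t) - exp (- z * of_real t)) / (X i - z) * of_real (h t)) =
        ((\<lambda>y. (laplace h y - laplace h z) / (y - z)) \<circ> X) i" by simp
    qed
    finally show "((\<lambda>y. (laplace h y - laplace h z) / (y - z)) \<circ> X) \<longlonglongrightarrow> (LINT t|lborel. - of_real t * exp (- z * of_real t) * of_real (h t))" .
  qed
  have "at z within ball z r = at z" using r by (intro at_within_open) auto
  with L show ?thesis by simp
qed

section \<open>Laplace transform and local regularity of the solution\<close>

context volterra_kernel begin

definition h :: "real \<Rightarrow> real" where "h t = (if 0 < t then t powr (a - 1) * \<phi> t else 0)"

text \<open>The extension by zero, with which the convolution can be integrated over the whole
  line.\<close>

definition k\<^sub>0 :: "real \<Rightarrow> real" where "k\<^sub>0 t = (if 0 \<le> t then k t else 0)"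

lemma h_pos: "0 < t \<Longrightarrow> 0 < h t"
  by (simp add: h_def \<phi>_pos)

lemma h_nonneg: "0 \<le> h t"
  using h_pos[of t] by (cases "0 < t") (auto simp: h_def)

lemma k\<^sub>0_bounds: "0 \<le> k\<^sub>0 t" "k\<^sub>0 t \<le> K"
  using k_nonneg[of t] k_le[of t] K_pos by (auto simp: k\<^sub>0_def)

lemma continuous_on_h: "continuous_on {0<..} h"
proof -
  have "continuous_on {0<..} (\<lambda>t. t powr (a - 1) * \<phi> t)"
    by (intro continuous_intros continuous_on_subset[OF continuous_on_\<phi>]) auto
  then show ?thesis by (rule continuous_on_eq) (auto simp: h_def)
qed

lemma measurable_h [measurable]: "h \<in> borel_measurable borel"
proof -
  have "(\<lambda>t. indicator {0<..} t *\<^sub>R h t) \<in> borel_measurable borel"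
    by (intro borel_measurable_continuous_on_indicator continuous_on_h) auto
  also have "(\<lambda>t. indicator {0<..} t *\<^sub>R h t) = h"
    by (auto simp: h_def indicator_def)
  finally show ?thesis .
qed

lemma measurable_k\<^sub>0 [measurable]: "k\<^sub>0 \<in> borel_measurable borel"
proof -
  have "(\<lambda>t. indicator {0..} t *\<^sub>R k t) \<in> borel_measurable borel"
    by (intro borel_measurable_continuous_on_indicator continuous_on_k) auto
  also have "(\<lambda>t. indicator {0..} t *\<^sub>R k t) = k\<^sub>0"
    by (auto simp: k\<^sub>0_def indicator_def)
  finally show ?thesis .
qed

text \<open>The equation for \<phi> in the original variable: \<open>u = t * v w\<close> is
  substituted back, and \<open>t powr a * \<phi> t\<close> is \<open>t * h t\<close>.\<close>

lemma has_integral_convolution: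
  assumes "0 < t"
  shows "((\<lambda>u. k (t - u) * h u) has_integral t * h t) {0..t}"
proof -
  have "((\<lambda>u. u powr (a - 1) * (k (t - u) * \<phi> u)) has_integral
      t powr a / a * integral {0..1} (\<lambda>w. k (t - t * v w) * \<phi> (t * v w))) {0..t}"
    by (intro has_integral_substitution_v assms continuous_intros continuous_on_subset[OF continuous_on_\<phi>]
          continuous_on_compose2[OF continuous_on_k]) auto
  also have "integral {0..1} (\<lambda>w. k (t - t * v w) * \<phi> (t * v w)) = a * \<phi> t"
    using integral_unique[OF \<phi>_equation[of t]] assms by (simp add: right_diff_distrib)
  also have "t powr a / a * (a * \<phi> t) = t * h t"
    using assms a_pos by (simp add: h_def powr_diff)
  finally show ?thesis
    by (rule has_integral_eq[rotated]) (auto simp: h_def)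
qed

text \<open>Half of the exponent absorbs the polynomial growth of \<phi>; the other half leaves the
  Gamma integral of \<open>t powr (a - 1)\<close>, which converges at 0 because
  \<open>a > 0\<close>.\<close>

lemma integrable_h:
  assumes "0 < s"
  shows "integrable lborel (\<lambda>t. exp (- s * t) * h t)"
proof -
  obtain C n where C: "0 < C" "\<And>t. 0 \<le> t \<Longrightarrow> \<phi> t \<le> C * (1 + t) ^ n"
    using \<phi>_growth by blast
  obtain B where B: "\<And>t. 0 \<le> t \<Longrightarrow> (1 + t) ^ n * exp (- (s / 2) * t) \<le> B"
  proof -
    have "((\<lambda>t. (1 + t) ^ n * exp (- (s / 2) * t)) \<longlongrightarrow> 0) at_top"
      using assms by real_asymp
    then have "\<forall>\<^sub>F t in at_top. (1 + t) ^ n * exp (- (s / 2) * t) < 1"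
      by (rule order_tendstoD) simp
    then obtain T where T: "\<And>t. T \<le> t \<Longrightarrow> (1 + t) ^ n * exp (- (s / 2) * t) < 1"
      by (auto simp: eventually_at_top_linorder)
    have "bounded ((\<lambda>t. (1 + t) ^ n * exp (- (s / 2) * t)) ` {0..T})"
      by (intro compact_imp_bounded compact_continuous_image continuous_intros) auto
    then obtain B where B: "\<forall>x\<in>(\<lambda>t. (1 + t) ^ n * exp (- (s / 2) * t)) ` {0..T}. norm x \<le> B"
      unfolding bounded_iff by blast
    have "(1 + t) ^ n * exp (- (s / 2) * t) \<le> max 1 B" if "0 \<le> t" for t
    proof (cases "T \<le> t")
      case True
      then show ?thesis using T[of t] by simp
    next
      case False
      then have "norm ((1 + t) ^ n * exp (- (s / 2) * t)) \<le> B"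
        using B that by (intro B[rule_format] imageI) auto
      then show ?thesis by simp
    qed
    then show ?thesis by (rule that)
  qed
  have B0: "0 \<le> B" using B[of 0] by simp
  have "set_integrable lebesgue {0<..} (\<lambda>t. complex_of_real t powr (of_real a - 1) / of_real (exp (s / 2 * t)))"
    using assms a_pos by (intro absolutely_integrable_Gamma_integral) auto
  then have "integrable lebesgue (\<lambda>t. norm (indicator {0<..} t *\<^sub>R (complex_of_real t powr (of_real a - 1) / of_real (exp (s / 2 * t)))))"
    unfolding set_integrable_def by (rule integrable_norm)
  also have "(\<lambda>t. norm (indicator {0<..} t *\<^sub>R (complex_of_real t powr (of_real a - 1) / of_real (exp (s / 2 * t))))) =
     (\<lambda>t. indicator {0<..} t * (t powr (a - 1) * exp (- (s / 2) * t)))"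
    by (auto simp: indicator_def norm_divide norm_powr_real_powr exp_minus field_simps)
  finally have "integrable lborel (\<lambda>t. indicator {0<..} t * (t powr (a - 1) * exp (- (s / 2) * t)))"
    by (subst (asm) integrable_completion) auto
  then have "integrable lborel (\<lambda>t. C * B * (indicator {0<..} t * (t powr (a - 1) * exp (- (s / 2) * t))))"
    by (rule integrable_mult_right)
  then show ?thesis
  proof (rule Bochner_Integration.integrable_bound)
    show "AE t in lborel. norm (exp (- s * t) * h t) \<le> norm (C * B * (indicator {0<..} t * (t powr (a - 1) * exp (- (s / 2) * t))))"
    proof (rule AE_I2)
      fix t
      show "norm (exp (- s * t) * h t) \<le> norm (C * B * (indicator {0<..} t * (t powr (a - 1) * exp (- (s / 2) * t))))"
      proof (cases "0 < t")
        case True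
        have "exp (- s * t) * h t \<le> exp (- s * t) * (t powr (a - 1) * (C * (1 + t) ^ n))"
          using True C(2)[of t] by (auto simp: h_def intro!: mult_left_mono)
        also have "\<dots> = C * ((1 + t) ^ n * exp (- (s / 2) * t)) * (t powr (a - 1) * exp (- (s / 2) * t))"
          by (simp add: mult_ac flip: exp_add)
        also have "\<dots> \<le> C * B * (t powr (a - 1) * exp (- (s / 2) * t))"
          using True C(1) B[of t] by (intro mult_right_mono mult_left_mono) auto
        finally have "exp (- s * t) * h t \<le> \<dots>" .
        then show ?thesis using True h_nonneg[of t] B0 C(1) by (simp add: abs_mult)
      qed (simp add: h_def)
    qed
  qed simp
qed

lemma integrable_k\<^sub>0:
  assumes "0 < s"
  shows "integrable lborel (\<lambda>t. exp (- s * t) * k\<^sub>0 t)"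
proof -
  have "integrable lborel (\<lambda>t. K * (indicator {0..} t * exp (- s * t)))"
  proof (rule integrable_mult_right)
    have "(\<lambda>t. exp (- s * t)) absolutely_integrable_on {0..}"
      using integrable_on_exp_minus_to_infinity[OF assms, of 0] 
      by (intro nonnegative_absolutely_integrable_1) auto
    then show "integrable lborel (\<lambda>t. indicator {0..} t * exp (- s * t))"
      unfolding set_integrable_def by (subst (asm) integrable_completion) auto
  qed
  then show ?thesis
  proof (rule Bochner_Integration.integrable_bound)
    show "AE t in lborel. norm (exp (- s * t) * k\<^sub>0 t) \<le> norm (K * (indicator {0..} t * exp (- s * t)))"
    proof (rule AE_I2)
      fix t
      show "norm (exp (- s * t) * k\<^sub>0 t) \<le> norm (K * (indicator {0..} t * exp (- s * t)))"
        using k\<^sub>0_bounds[of t] K_pos by (cases "0 \<le> t") (auto simp: abs_mult k\<^sub>0_def)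
    qed
  qed simp
qed

text \<open>This is the differential equation for the Laplace transform of \<open>h\<close> at a
  real point: minus its derivative equals its product with the transform of \<open>k\<close>.
  Everything is nonnegative, so the order of integration is exchanged in \<open>nn_integral\<close>
  without any prior integrability.\<close>

lemma laplace_convolution:
  assumes "0 < s"
  shows "(LINT t|lborel. t * exp (- s * t) * h t) =
    (LINT t|lborel. exp (- s * t) * k\<^sub>0 t) * (LINT t|lborel. exp (- s * t) * h t)"
proof -
  have conv: "ennreal (t * h t) = (\<integral>\<^sup>+u. ennreal (k\<^sub>0 (t - u) * h u) \<partial>lborel)" for t
  proof (cases "0 < t")
    case True
    have "ennreal (t * h t) = (\<integral>\<^sup>+u. ennreal (k (t - u) * h u) * indicator {0..t} u \<partial>lborel)"
      by (rule nn_integral_has_integral_lebesgue'[symmetric, OF _ has_integral_convolution[OF True]])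
         (auto intro!: mult_nonneg_nonneg k_nonneg h_nonneg)
    also have "\<dots> = (\<integral>\<^sup>+u. ennreal (k\<^sub>0 (t - u) * h u) \<partial>lborel)"
      by (intro nn_integral_cong) (auto simp: indicator_def k\<^sub>0_def h_def)
    finally show ?thesis .
  next
    case False
    then have zero: "k\<^sub>0 (t - u) * h u = 0" for u by (auto simp: h_def k\<^sub>0_def)
    have "(\<integral>\<^sup>+u. ennreal (k\<^sub>0 (t - u) * h u) \<partial>lborel) = (\<integral>\<^sup>+(u::real). 0 \<partial>lborel)"
      by (intro nn_integral_cong) (simp only: zero ennreal_0)
    then show ?thesis using False by (simp add: h_def)
  qed
  have shift: "(\<integral>\<^sup>+t. ennreal (exp (- s * t) * k\<^sub>0 (t - u)) \<partial>lborel) =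
      ennreal (exp (- s * u)) * (\<integral>\<^sup>+r. ennreal (exp (- s * r) * k\<^sub>0 r) \<partial>lborel)" for u
  proof -
    have "(\<integral>\<^sup>+t. ennreal (exp (- s * t) * k\<^sub>0 (t - u)) \<partial>lborel) = (\<integral>\<^sup>+r. ennreal (exp (- s * (u + r)) * k\<^sub>0 r) \<partial>lborel)"
      by (subst nn_integral_real_affine[of _ 1 u]) auto
    also have "\<dots> = (\<integral>\<^sup>+r. ennreal (exp (- s * u)) * ennreal (exp (- s * r) * k\<^sub>0 r) \<partial>lborel)"
      by (intro nn_integral_cong) (simp add: k\<^sub>0_bounds distrib_left exp_add mult_ac exp_diff exp_minus divide_inverse flip: ennreal_mult)
    also have "\<dots> = ennreal (exp (- s * u)) * (\<integral>\<^sup>+r. ennreal (exp (- s * r) * k\<^sub>0 r) \<partial>lborel)"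
      by (rule nn_integral_cmult) simp
    finally show ?thesis .
  qed
  have "(\<integral>\<^sup>+t. ennreal (t * exp (- s * t) * h t) \<partial>lborel) =
        (\<integral>\<^sup>+t. ennreal (exp (- s * t)) * (\<integral>\<^sup>+u. ennreal (k\<^sub>0 (t - u) * h u) \<partial>lborel) \<partial>lborel)"
    unfolding conv[symmetric] by (intro nn_integral_cong) (simp add: mult_ac flip: ennreal_mult')
  also have "\<dots> = (\<integral>\<^sup>+t. (\<integral>\<^sup>+u. ennreal (h u) * ennreal (exp (- s * t) * k\<^sub>0 (t - u)) \<partial>lborel) \<partial>lborel)"
    by (intro nn_integral_cong)
       (simp add: k\<^sub>0_bounds h_nonneg mult_ac flip: nn_integral_cmult ennreal_mult ennreal_mult')
  also have "\<dots> = (\<integral>\<^sup>+u. (\<integral>\<^sup>+t. ennreal (h u) * ennreal (exp (- s * t) * k\<^sub>0 (t - u)) \<partial>lborel) \<partial>lborel)"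
    by (rule lborel_pair.Fubini') simp
  also have "\<dots> = (\<integral>\<^sup>+u. ennreal (exp (- s * u) * h u) * (\<integral>\<^sup>+r. ennreal (exp (- s * r) * k\<^sub>0 r) \<partial>lborel) \<partial>lborel)"
  proof (intro nn_integral_cong)
    fix u :: real
    have "(\<integral>\<^sup>+t. ennreal (h u) * ennreal (exp (- s * t) * k\<^sub>0 (t - u)) \<partial>lborel) =
        ennreal (h u) * (\<integral>\<^sup>+t. ennreal (exp (- s * t) * k\<^sub>0 (t - u)) \<partial>lborel)"
      by (rule nn_integral_cmult) simp
    also have "\<dots> = ennreal (h u) * ennreal (exp (- s * u)) * (\<integral>\<^sup>+r. ennreal (exp (- s * r) * k\<^sub>0 r) \<partial>lborel)"
      unfolding shift by (rule mult.assoc[symmetric])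
    also have "ennreal (h u) * ennreal (exp (- s * u)) = ennreal (exp (- s * u) * h u)"
      by (simp add: h_nonneg mult.commute flip: ennreal_mult)
    finally show "(\<integral>\<^sup>+t. ennreal (h u) * ennreal (exp (- s * t) * k\<^sub>0 (t - u)) \<partial>lborel) =
        ennreal (exp (- s * u) * h u) * (\<integral>\<^sup>+r. ennreal (exp (- s * r) * k\<^sub>0 r) \<partial>lborel)" .
  qed
  also have "\<dots> = (\<integral>\<^sup>+u. ennreal (exp (- s * u) * h u) \<partial>lborel) * (\<integral>\<^sup>+r. ennreal (exp (- s * r) * k\<^sub>0 r) \<partial>lborel)"
    by (rule nn_integral_multc) simp
  finally have eq: "(\<integral>\<^sup>+t. ennreal (t * exp (- s * t) * h t) \<partial>lborel) =
    (\<integral>\<^sup>+u. ennreal (exp (- s * u) * h u) \<partial>lborel) * (\<integral>\<^sup>+r. ennreal (exp (- s * r) * k\<^sub>0 r) \<partial>lborel)" .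
  have nonneg: "0 \<le> t * exp (- s * t) * h t" for t
    using h_nonneg[of t] by (cases "0 < t") (auto simp: h_def)
  have "(\<integral>\<^sup>+t. ennreal (t * exp (- s * t) * h t) \<partial>lborel) = ennreal (LINT t|lborel. t * exp (- s * t) * h t)"
    by (intro nn_integral_eq_integral integrable_mult_t_exp integrable_h assms measurable_h AE_I2 nonneg) (simp add: h_def)
  moreover have "(\<integral>\<^sup>+t. ennreal (exp (- s * t) * h t) \<partial>lborel) = ennreal (LINT t|lborel. exp (- s * t) * h t)"
    by (intro nn_integral_eq_integral integrable_h assms AE_I2 mult_nonneg_nonneg h_nonneg exp_ge_zero)
  moreover have "(\<integral>\<^sup>+t. ennreal (exp (- s * t) * k\<^sub>0 t) \<partial>lborel) = ennreal (LINT t|lborel. exp (- s * t) * k\<^sub>0 t)"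
    by (intro nn_integral_eq_integral integrable_k\<^sub>0 assms AE_I2 mult_nonneg_nonneg k\<^sub>0_bounds exp_ge_zero)
  moreover have "0 \<le> (LINT t|lborel. t * exp (- s * t) * h t)" 
    "0 \<le> (LINT t|lborel. exp (- s * t) * h t)" "0 \<le> (LINT t|lborel. exp (- s * t) * k\<^sub>0 t)"
    by (intro Bochner_Integration.integral_nonneg nonneg mult_nonneg_nonneg h_nonneg k\<^sub>0_bounds exp_ge_zero)+
  ultimately show ?thesis
    using eq by (simp add: mult.commute[of "integral\<^sup>L lborel (\<lambda>t. exp (- s * t) * k\<^sub>0 t)"] del: mult_minus_left flip: ennreal_mult)
qed


text \<open>The increment of \<open>t * h t\<close> between \<open>t1\<close> and \<open>t2\<close>
  has two parts. On [0,\<open>t1\<close>] only the kernel moves, which costs its Lipschitz constant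
  times the integral \<open>H\<close> of \<open>h\<close>; a singularity of \<open>h\<close> at 0 is
  harmless there. On [\<open>t1\<close>,\<open>t2\<close>] the integrand is at most
  \<open>K * M\<close>, as \<open>h\<close> is bounded away from 0. Division by \<open>t\<close>
  transfers the estimate to \<open>h\<close>.\<close>

lemma h_lipschitz:
  assumes u: "0 < u"
  shows "\<exists>B. \<forall>t. \<bar>t - u\<bar> < u / 2 \<longrightarrow> \<bar>h t - h u\<bar> \<le> B * \<bar>t - u\<bar>"
proof -
  let ?T = "2 * u" and ?g = "\<lambda>t. t * h t"
  obtain M where M: "\<And>t. t \<in> {u / 2..?T} \<Longrightarrow> h t \<le> M"
  proof -
    have "bounded (h ` {u / 2..?T})"
      using u by (intro compact_imp_bounded compact_continuous_image continuous_on_subset[OF continuous_on_h]) auto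
    then obtain M where "\<forall>x\<in>h ` {u / 2..?T}. norm x \<le> M" unfolding bounded_iff by blast
    then show ?thesis by (intro that[of M]) (auto dest: abs_le_D1)
  qed
  define H where "H = integral {0..?T} h"
  have hint: "h integrable_on {0..t}" if "0 < t" for t
  proof -
    have "(\<lambda>u. u powr (a - 1) * \<phi> u) integrable_on {0..t}"
      using has_integral_substitution_v[OF that continuous_on_subset[OF continuous_on_\<phi>]] by auto
    then show ?thesis by (rule integrable_eq) (auto simp: h_def)
  qed
  have M0: "0 \<le> M" using M[of u] h_nonneg[of u] u by auto
  have H0: "0 \<le> H" unfolding H_def by (intro Henstock_Kurzweil_Integration.integral_nonneg hint h_nonneg) (use u in auto)
  define L where "L = P * H + K * M"
  have g_le: "\<bar>?g t2 - ?g t1\<bar> \<le> L * (t2 - t1)" if t: "u / 2 \<le> t1" "t1 \<le> t2" "t2 \<le> ?T" for t1 t2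
  proof -
    have pos: "0 < t1" "0 < t2" using u t by auto
    have sub: "(\<lambda>x. k (t2 - x) * h x) integrable_on {0..t1}" "(\<lambda>x. k (t2 - x) * h x) integrable_on {t1..t2}"
      using has_integral_integrable[OF has_integral_convolution[OF pos(2)]] t pos
      by (auto intro: integrable_subinterval_real)
    have "?g t2 = integral {0..t1} (\<lambda>x. k (t2 - x) * h x) + integral {t1..t2} (\<lambda>x. k (t2 - x) * h x)"
      using has_integral_convolution[OF pos(2)] t pos
      by (subst Henstock_Kurzweil_Integration.integral_combine) (auto simp: has_integral_iff)
    moreover have "?g t1 = integral {0..t1} (\<lambda>x. k (t1 - x) * h x)"
      using has_integral_convolution[OF pos(1)] by (simp add: has_integral_iff)
    moreover have "integral {0..t1} (\<lambda>x. k (t2 - x) * h x) - integral {0..t1} (\<lambda>x. k (t1 - x) * h x) =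
        integral {0..t1} (\<lambda>x. k (t2 - x) * h x - k (t1 - x) * h x)"
      using has_integral_integrable[OF has_integral_convolution[OF pos(1)]] sub(1)
      by (intro Henstock_Kurzweil_Integration.integral_diff[symmetric])
    ultimately have split: "?g t2 - ?g t1 = integral {0..t1} (\<lambda>x. k (t2 - x) * h x - k (t1 - x) * h x) +
        integral {t1..t2} (\<lambda>x. k (t2 - x) * h x)" by simp
    have "norm (integral {0..t1} (\<lambda>x. k (t2 - x) * h x - k (t1 - x) * h x)) \<le> integral {0..t1} (\<lambda>x. P * (t2 - t1) * h x)"
    proof (rule integral_norm_bound_integral)
      show "(\<lambda>x. k (t2 - x) * h x - k (t1 - x) * h x) integrable_on {0..t1}"
        using has_integral_integrable[OF has_integral_convolution[OF pos(1)]] sub(1)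
        by (intro Henstock_Kurzweil_Integration.integrable_diff)
      show "(\<lambda>x. P * (t2 - t1) * h x) integrable_on {0..t1}"
        using hint[OF pos(1)] by (rule integrable_on_mult_right)
      fix x assume x: "x \<in> {0..t1}"
      have "\<bar>k (t2 - x) - k (t1 - x)\<bar> \<le> P * \<bar>(t2 - x) - (t1 - x)\<bar>"
        using x t by (intro k_lipschitz) auto
      then have "\<bar>k (t2 - x) - k (t1 - x)\<bar> * h x \<le> P * (t2 - t1) * h x"
        using t h_nonneg by (intro mult_right_mono) auto
      then show "norm (k (t2 - x) * h x - k (t1 - x) * h x) \<le> P * (t2 - t1) * h x"
        using h_nonneg[of x] by (simp add: abs_mult flip: left_diff_distrib)
    qed
    also have "\<dots> = P * (t2 - t1) * integral {0..t1} h" by simp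
    also have "\<dots> \<le> P * (t2 - t1) * H"
      unfolding H_def using t u P_nonneg
      by (intro mult_left_mono integral_subset_le hint) (auto simp: h_nonneg)
    finally have 1: "\<bar>integral {0..t1} (\<lambda>x. k (t2 - x) * h x - k (t1 - x) * h x)\<bar> \<le> P * (t2 - t1) * H" by simp
    have "norm (integral {t1..t2} (\<lambda>x. k (t2 - x) * h x)) \<le> integral {t1..t2} (\<lambda>x. K * M)"
    proof (rule integral_norm_bound_integral[OF sub(2)])
      fix x assume x: "x \<in> {t1..t2}"
      then show "norm (k (t2 - x) * h x) \<le> K * M"
        using t M[of x] h_nonneg[of x] k_nonneg[of "t2 - x"] k_le[of "t2 - x"] K_pos
        by (auto simp: abs_mult intro!: mult_mono)
    qed (rule integrable_const_ivl)
    then have 2: "\<bar>integral {t1..t2} (\<lambda>x. k (t2 - x) * h x)\<bar> \<le> K * M * (t2 - t1)"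
      using t by (simp add: mult_ac)
    show ?thesis unfolding split L_def using 1 2 abs_triangle_ineq by (fastforce simp: algebra_simps)
  qed
  have L0: "0 \<le> L" unfolding L_def using P_nonneg H0 K_pos M0 by simp
  show ?thesis
  proof (intro exI allI impI)
    fix t assume t: "\<bar>t - u\<bar> < u / 2"
    have t2: "u / 2 < t" "t < ?T" using t by (auto simp: abs_if split: if_splits)
    have gg: "\<bar>?g t - ?g u\<bar> \<le> L * \<bar>t - u\<bar>"
      using g_le[of t u] g_le[of u t] t2 u by (cases "t \<le> u") (auto simp: abs_minus_commute)
    have "h t - h u = ((?g t - ?g u) - h u * (t - u)) / t"
      using t2 u by (simp add: field_simps)
    also have "\<bar>\<dots>\<bar> \<le> (L * \<bar>t - u\<bar> + h u * \<bar>t - u\<bar>) / t"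
      using gg t2 u h_nonneg[of u] abs_triangle_ineq4[of "?g t - ?g u" "h u * (t - u)"]
      by (auto simp: abs_divide abs_mult intro!: divide_right_mono)
    also have "\<dots> \<le> (L * \<bar>t - u\<bar> + h u * \<bar>t - u\<bar>) / (u / 2)"
      using t2 u L0 h_nonneg[of u] by (intro divide_left_mono) auto
    finally show "\<bar>h t - h u\<bar> \<le> (2 * (L + h u) / u) * \<bar>t - u\<bar>"
      by (simp add: field_simps)
  qed
qed

end

subsection \<open>Fourier inversion\<close>

text \<open>Integrability is part of the predicate so that the class is closed under the operations
  of the inductions below.\<close>

definition riemann_lebesgue :: "(real \<Rightarrow> real) \<Rightarrow> bool" where
  "riemann_lebesgue f \<longleftrightarrow> integrable lborel f \<and> ((\<lambda>R. LINT t|lborel. f t * sin (R * t)) \<longlongrightarrow> 0) at_top"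

lemma integrable_mult_sin:
  fixes f :: "real \<Rightarrow> real"
  assumes "integrable lborel f" 
  shows "integrable lborel (\<lambda>t. f t * sin (R * t))"
proof (rule Bochner_Integration.integrable_bound[OF assms])
  have [measurable]: "f \<in> borel_measurable borel" using assms by auto
  show "(\<lambda>t. f t * sin (R * t)) \<in> borel_measurable lborel" by simp
  show "AE t in lborel. norm (f t * sin (R * t)) \<le> norm (f t)"
    by (auto simp: abs_mult intro!: mult_left_le)
qed

text \<open>Dominated convergence gives convergence in L1, and the L1 distance bounds the difference
  of the sine integrals uniformly in \<open>R\<close>.\<close>

lemma riemann_lebesgue_limit:
  assumes rl: "\<And>i. riemann_lebesgue (s i)" and lim: "\<And>t. (\<lambda>i. s i t) \<longlonglongrightarrow> f t"
    and bound: "\<And>i t. \<bar>s i t\<bar> \<le> w t" and w: "integrable lborel w" and f: "integrable lborel f"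
  shows "riemann_lebesgue f"
proof -
  have s: "integrable lborel (s i)" for i using rl by (simp add: riemann_lebesgue_def)
  have [measurable]: "f \<in> borel_measurable borel" "s i \<in> borel_measurable borel" for i
    using f s[of i] by auto
  have "(\<lambda>i. LINT t|lborel. \<bar>f t - s i t\<bar>) \<longlonglongrightarrow> (LINT t|lborel. \<bar>f t - f t\<bar>)"
  proof (rule integral_dominated_convergence)
    show "integrable lborel (\<lambda>t. \<bar>f t\<bar> + w t)"
      by (intro Bochner_Integration.integrable_add integrable_abs f w)
    show "AE t in lborel. norm \<bar>f t - s i t\<bar> \<le> \<bar>f t\<bar> + w t" for i
    proof (rule AE_I2)
      fix t show "norm \<bar>f t - s i t\<bar> \<le> \<bar>f t\<bar> + w t"
        using bound[of i t] abs_triangle_ineq4[of "f t" "s i t"] by simp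
    qed
    show "AE t in lborel. (\<lambda>i. \<bar>f t - s i t\<bar>) \<longlonglongrightarrow> \<bar>f t - f t\<bar>"
      by (intro AE_I2 tendsto_intros lim)
  qed auto
  then have L1: "(\<lambda>i. LINT t|lborel. \<bar>f t - s i t\<bar>) \<longlonglongrightarrow> 0" by simp
  have "((\<lambda>R. LINT t|lborel. f t * sin (R * t)) \<longlongrightarrow> 0) at_top"
  proof (rule tendstoI)
    fix e :: real assume "0 < e"
    then have "\<forall>\<^sub>F i in sequentially. (LINT t|lborel. \<bar>f t - s i t\<bar>) < e / 2"
      using L1 by (intro order_tendstoD) auto
    then obtain i where i: "(LINT t|lborel. \<bar>f t - s i t\<bar>) < e / 2"
      by (auto simp: eventually_sequentially)
    have "((\<lambda>R. LINT t|lborel. s i t * sin (R * t)) \<longlongrightarrow> 0) at_top"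
      using rl[of i] by (simp add: riemann_lebesgue_def)
    then have "\<forall>\<^sub>F R in at_top. dist (LINT t|lborel. s i t * sin (R * t)) 0 < e / 2"
      using \<open>0 < e\<close> by (intro tendstoD) auto
    then show "\<forall>\<^sub>F R in at_top. dist (LINT t|lborel. f t * sin (R * t)) 0 < e"
    proof eventually_elim
      case (elim R)
      have "(LINT t|lborel. f t * sin (R * t)) - (LINT t|lborel. s i t * sin (R * t)) =
          (LINT t|lborel. (f t - s i t) * sin (R * t))"
        by (subst Bochner_Integration.integral_diff[OF integrable_mult_sin[OF f] integrable_mult_sin[OF s], symmetric])
           (simp add: left_diff_distrib)
      also have "\<bar>\<dots>\<bar> \<le> (LINT t|lborel. \<bar>(f t - s i t) * sin (R * t)\<bar>)"
        by (rule integral_abs_bound)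
      also have "\<dots> \<le> (LINT t|lborel. \<bar>f t - s i t\<bar>)"
        by (intro integral_mono integrable_abs integrable_mult_sin Bochner_Integration.integrable_diff f s)
           (auto simp: abs_mult intro!: mult_left_le)
      finally show ?case using i elim by simp
    qed
  qed
  with f show ?thesis by (simp add: riemann_lebesgue_def)
qed

lemma riemann_lebesgue_add:
  assumes "riemann_lebesgue f" "riemann_lebesgue g"
  shows "riemann_lebesgue (\<lambda>t. f t + g t)"
proof -
  have "((\<lambda>R. (LINT t|lborel. f t * sin (R * t)) + (LINT t|lborel. g t * sin (R * t))) \<longlongrightarrow> 0 + 0) at_top"
    using assms by (intro tendsto_add) (auto simp: riemann_lebesgue_def)
  also have "(\<lambda>R. (LINT t|lborel. f t * sin (R * t)) + (LINT t|lborel. g t * sin (R * t))) =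
      (\<lambda>R. LINT t|lborel. (f t + g t) * sin (R * t))"
    using assms by (simp add: riemann_lebesgue_def distrib_right integrable_mult_sin)
  finally show ?thesis using assms by (simp add: riemann_lebesgue_def)
qed

lemma riemann_lebesgue_cmult:
  assumes "riemann_lebesgue f"
  shows "riemann_lebesgue (\<lambda>t. c * f t)"
proof -
  have "((\<lambda>R. c * (LINT t|lborel. f t * sin (R * t))) \<longlongrightarrow> c * 0) at_top"
    using assms by (intro tendsto_mult_left) (auto simp: riemann_lebesgue_def)
  then show ?thesis using assms by (simp add: riemann_lebesgue_def mult.assoc)
qed

lemma riemann_lebesgue_interval: "riemann_lebesgue (indicator {a..b})"
proof (cases "a \<le> b")
  case True
  have "((\<lambda>R. LINT t|lborel. indicator {a..b} t * sin (R * t)) \<longlongrightarrow> 0) at_top"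
  proof (rule Lim_transform_eventually)
    show "((\<lambda>R. (- cos (R * b)) / R - (- cos (R * a)) / R) \<longlongrightarrow> 0) at_top"
      by real_asymp
    show "\<forall>\<^sub>F R in at_top. (- cos (R * b)) / R - (- cos (R * a)) / R = (LINT t|lborel. indicator {a..b} t * sin (R * t))"
      using eventually_gt_at_top[of 0]
    proof eventually_elim
      case (elim R)
      have "(LINT t|lborel. sin (R * t) * indicator {a..b} t) = (- cos (R * b)) / R - (- cos (R * a)) / R"
        using elim by (intro integral_FTC_Icc_real True) (auto intro!: derivative_eq_intros)
      then show ?case by (simp add: mult.commute)
    qed
  qed
  moreover have "integrable lborel (indicator {a..b} :: real \<Rightarrow> real)"
    using True by (intro integrable_real_indicator) auto
  ultimately show ?thesis by (simp add: riemann_lebesgue_def)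
qed (simp add: riemann_lebesgue_def)

text \<open>A Dynkin argument from half-lines to Borel sets. Intersecting with a fixed bounded
  interval keeps complements and countable unions of finite measure.\<close>

lemma riemann_lebesgue_indicator_bounded:
  fixes n :: nat
  assumes "A \<in> sets borel"
  shows "riemann_lebesgue (indicator (A \<inter> {- real n..real n}))"
proof -
  let ?I = "{- real n..real n}"
  have int: "integrable lborel (indicator (A \<inter> ?I) :: real \<Rightarrow> real)" if "A \<in> sets borel" for A
  proof (rule integrable_real_indicator)
    have "emeasure lborel (A \<inter> ?I) \<le> emeasure lborel ?I" using that by (intro emeasure_mono) auto
    also have "\<dots> < \<infinity>" by simp
    finally show "emeasure lborel (A \<inter> ?I) < \<infinity>" .
  qed (use that in auto)
  have "Int_stable (range (\<lambda>a::real. {..a}))"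
    by (auto simp: Int_stable_def)
  moreover have "range (\<lambda>a::real. {..a}) \<subseteq> Pow UNIV" by simp
  moreover have "A \<in> sigma_sets UNIV (range (\<lambda>a::real. {..a}))"
    using assms by (simp add: borel_eq_atMost)
  ultimately show ?thesis
  proof (induction rule: sigma_sets_induct_disjoint)
    case (basic A)
    then obtain a where "A = {..a}" by auto
    then have "A \<inter> ?I = {- real n..min a (real n)}" by auto
    then show ?case by (simp add: riemann_lebesgue_interval)
  next
    case empty
    then show ?case by (simp add: riemann_lebesgue_def)
  next
    case (compl A)
    have *: "indicator ((UNIV - A) \<inter> ?I) = (\<lambda>t. indicator ?I t + (-1) * indicator (A \<inter> ?I) t :: real)"
      by (auto simp: indicator_def)
    show ?case unfolding *
      by (intro riemann_lebesgue_add riemann_lebesgue_cmult riemann_lebesgue_interval compl)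
  next
    case (union A)
    have A: "A i \<in> sets borel" for i
      using union(2) by (auto simp: borel_eq_atMost)
    show ?case
    proof (rule riemann_lebesgue_limit)
      fix N
      show "riemann_lebesgue (\<lambda>t. \<Sum>i<N. indicator (A i \<inter> ?I) t)"
        by (induction N) (auto intro!: riemann_lebesgue_add union simp: riemann_lebesgue_def[of "\<lambda>_. 0"])
      fix t
      have sum_eq: "(\<Sum>i<N. indicator (A i \<inter> ?I) t) = (indicator (\<Union>i<N. A i \<inter> ?I) t :: real)" for N
        using union(1) by (intro indicator_UN_disjoint[symmetric]) (auto simp: disjoint_family_on_def)
      show "\<bar>\<Sum>i<N. indicator (A i \<inter> ?I) t\<bar> \<le> (indicator ?I t :: real)"
        unfolding sum_eq by (auto simp: indicator_def)
      show "(\<lambda>N. \<Sum>i<N. indicator (A i \<inter> ?I) t) \<longlonglongrightarrow> (indicator (\<Union> (range A) \<inter> ?I) t :: real)"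
        using LIMSEQ_indicator_UN[of "\<lambda>i. A i \<inter> ?I" t] unfolding sum_eq by simp
    qed (use A in \<open>auto intro!: int\<close>)
  qed
qed

theorem riemann_lebesgue:
  fixes f :: "real \<Rightarrow> real"
  assumes "integrable lborel f"
  shows "((\<lambda>R. LINT t|lborel. f t * sin (R * t)) \<longlongrightarrow> 0) at_top"
proof -
  have "riemann_lebesgue f"
    using assms
  proof (induction rule: integrable_induct)
    case (base A c)
    have "riemann_lebesgue (indicator A)"
    proof (rule riemann_lebesgue_limit)
      show "riemann_lebesgue (indicator (A \<inter> {- real n..real n}))" for n
        using base by (intro riemann_lebesgue_indicator_bounded) auto
      show "(\<lambda>n. indicator (A \<inter> {- real n..real n}) t) \<longlonglongrightarrow> (indicator A t :: real)" for t
      proof (rule tendsto_eventually)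
        obtain N where N: "\<bar>t\<bar> \<le> real N" using real_arch_simple by blast
        show "\<forall>\<^sub>F n in sequentially. indicator (A \<inter> {- real n..real n}) t = (indicator A t :: real)"
          using eventually_ge_at_top[of N]
          by eventually_elim (use N in \<open>auto simp: indicator_def\<close>)
      qed
      show "\<bar>indicator (A \<inter> {- real n..real n}) t\<bar> \<le> (indicator A t :: real)" for n t
        by (auto simp: indicator_def)
    qed (use base in auto)
    from riemann_lebesgue_cmult[OF this, of c] show ?case by (simp add: mult.commute)
  next
    case (add f g)
    then show ?case by (intro riemann_lebesgue_add)
  next
    case (lim f s)
    show ?case
      by (rule riemann_lebesgue_limit[of s _ "\<lambda>t. 2 * norm (f t)"]) (use lim in auto)
  qed
  then show ?thesis by (simp add: riemann_lebesgue_def)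
qed

text \<open>Dini's argument. The value \<open>F u\<close> is subtracted on a window of radius 1
  around \<open>u\<close>; the Lipschitz bound makes the remainder divided by \<open>t - u\<close>
  integrable, so its sine integral tends to 0. The window itself contributes \<open>F u\<close>
  times \<open>2 * Si R\<close>, which tends to \<open>pi * F u\<close>.\<close>

lemma dirichlet_kernel_limit:
  fixes F :: "real \<Rightarrow> real"
  assumes F: "integrable lborel F" and \<delta>: "0 < \<delta>"
    and lip: "\<And>t. \<bar>t - u\<bar> < \<delta> \<Longrightarrow> \<bar>F t - F u\<bar> \<le> B * \<bar>t - u\<bar>"
  shows "((\<lambda>R. LINT t|lborel. F t * (sin (R * (t - u)) / (t - u))) \<longlongrightarrow> pi * F u) at_top"
proof -
  have [measurable]: "F \<in> borel_measurable borel" using F by auto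
  define \<Psi> where "\<Psi> t = (F (u + t) - F u * indicator {-1..1} t) / t" for t
  define d where "d = min \<delta> 1"
  have d: "0 < d" "d \<le> 1" "d \<le> \<delta>" using \<delta> by (auto simp: d_def)
  have Fu: "integrable lborel (\<lambda>t. F (u + t))"
    using lborel_integrable_real_affine[OF F, of 1 u] by simp
  have "\<bar>F (u + d / 2) - F u\<bar> \<le> B * (d / 2)" using lip[of "u + d / 2"] d by simp
  then have "0 \<le> B * (d / 2)" by (rule order.trans[OF abs_ge_zero])
  then have B0: "0 \<le> B" using d by (simp add: zero_le_mult_iff)
  have \<Psi>: "integrable lborel \<Psi>"
  proof (rule Bochner_Integration.integrable_bound)
    show "integrable lborel (\<lambda>t. B * indicator {-1..1} t + (\<bar>F (u + t)\<bar> + \<bar>F u\<bar> * indicator {-1..1} t) / d)"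
      by (intro Bochner_Integration.integrable_add integrable_mult_right integrable_divide integrable_abs Fu) auto
    show "AE t in lborel. norm (\<Psi> t) \<le> norm (B * indicator {-1..1} t + (\<bar>F (u + t)\<bar> + \<bar>F u\<bar> * indicator {-1..1} t) / d)"
    proof (rule AE_I2)
      fix t
      have nn: "0 \<le> B * indicator {-1..1} t" "0 \<le> (\<bar>F (u + t)\<bar> + \<bar>F u\<bar> * indicator {-1..1} t) / d"
        using B0 d by auto
      show "norm (\<Psi> t) \<le> norm (B * indicator {-1..1} t + (\<bar>F (u + t)\<bar> + \<bar>F u\<bar> * indicator {-1..1} t) / d)"
      proof (cases "\<bar>t\<bar> < d")
        case True
        then have "\<bar>F (u + t) - F u\<bar> \<le> B * \<bar>t\<bar>" "t \<in> {-1..1}" using lip[of "u + t"] d by auto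
        then have "norm (\<Psi> t) \<le> B" using B0 by (cases "t = 0") (auto simp: \<Psi>_def field_simps)
        then show ?thesis using nn \<open>t \<in> {-1..1}\<close> by simp
      next
        case False
        have "norm (\<Psi> t) \<le> (\<bar>F (u + t)\<bar> + \<bar>F u\<bar> * indicator {-1..1} t) / \<bar>t\<bar>"
          unfolding \<Psi>_def using abs_triangle_ineq4[of "F (u + t)" "F u * indicator {-1..1} t"]
          by (auto simp: abs_mult intro!: divide_right_mono)
        also have "\<dots> \<le> (\<bar>F (u + t)\<bar> + \<bar>F u\<bar> * indicator {-1..1} t) / d"
          using False d by (intro divide_left_mono) auto
        finally show ?thesis using nn by simp
      qed
    qed
  qed (simp add: \<Psi>_def[abs_def])
  have Si2: "(LINT t|lborel. indicator {-1..1} t * (sin (R * t) / t)) = 2 * Si R"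
    and int_sinc: "integrable lborel (\<lambda>t. indicator {-1..1} t * (sin (R * t) / t))" if "0 < R" for R
  proof -
    have pos: "integrable lborel (\<lambda>t. indicator {0<..<1} t * (sin (R * t) / t))"
      using integrable_sinc'[of 1 R] by (simp add: interval_lebesgue_integrable_def set_integrable_def mult_ac zero_ereal_def one_ereal_def)
    have val: "(LINT t|lborel. indicator {0<..<1} t * (sin (R * t) / t)) = Si R"
      using LBINT_I0c_sin_scale_divide[of 1 R] that
      by (simp add: interval_lebesgue_integral_def set_lebesgue_integral_def mult_ac zero_ereal_def one_ereal_def)
    have neg: "integrable lborel (\<lambda>t. indicator {0<..<1} (- t) * (sin (R * - t) / - t))"
      using lborel_integrable_real_affine[OF pos, of "-1" 0] by simp
    have valneg: "(LINT t|lborel. indicator {0<..<1} (- t) * (sin (R * - t) / - t)) = Si R"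
      using lborel_integral_real_affine[of "-1" "\<lambda>t. indicator {0<..<1} t * (sin (R * t) / t)" 0] val by simp
    \<comment> \<open>The open unit interval and its mirror image together miss only -1, 0 and
      1.\<close>
    have AE: "AE t in lborel. indicator {0<..<1} t * (sin (R * t) / t) + indicator {0<..<1} (- t) * (sin (R * - t) / - t)
        = indicator {-1..1} t * (sin (R * t) / t)"
    proof -
      have "AE t in lborel. t \<notin> {-1, 0, 1::real}"
        by (rule AE_not_in) (intro finite_imp_null_set_lborel, simp)
      then show ?thesis by eventually_elim (auto simp: indicator_def)
    qed
    show "integrable lborel (\<lambda>t. indicator {-1..1} t * (sin (R * t) / t))"
      using Bochner_Integration.integrable_add[OF pos neg]
      by (subst integrable_cong_AE[symmetric, OF _ _ AE]) simp_all
    have "(LINT t|lborel. indicator {-1..1} t * (sin (R * t) / t)) = 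
       (LINT t|lborel. indicator {0<..<1} t * (sin (R * t) / t) + indicator {0<..<1} (- t) * (sin (R * - t) / - t))"
      using AE by (intro integral_cong_AE) (auto elim: eventually_mono)
    also have "\<dots> = 2 * Si R"
      by (subst Bochner_Integration.integral_add[OF pos neg]) (simp only: val valneg)
    finally show "(LINT t|lborel. indicator {-1..1} t * (sin (R * t) / t)) = 2 * Si R" .
  qed
  have eq: "(LINT t|lborel. F t * (sin (R * (t - u)) / (t - u))) = F u * (2 * Si R) + (LINT t|lborel. \<Psi> t * sin (R * t))"
    if "0 < R" for R
  proof -
    have "(LINT t|lborel. F t * (sin (R * (t - u)) / (t - u))) = (LINT t|lborel. F (u + t) * (sin (R * t) / t))"
      by (subst lborel_integral_real_affine[of 1 _ u]) auto
    also have "\<dots> = (LINT t|lborel. F u * (indicator {-1..1} t * (sin (R * t) / t)) + \<Psi> t * sin (R * t))"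
      by (intro Bochner_Integration.integral_cong) (auto simp: \<Psi>_def diff_divide_distrib algebra_simps)
    also have "\<dots> = F u * (2 * Si R) + (LINT t|lborel. \<Psi> t * sin (R * t))"
      by (subst Bochner_Integration.integral_add[OF integrable_mult_right[OF int_sinc[OF that]] integrable_mult_sin[OF \<Psi>]],
          subst integral_mult_right_zero, subst Si2[OF that], rule refl)
    finally show ?thesis .
  qed
  have "((\<lambda>R. F u * (2 * Si R) + (LINT t|lborel. \<Psi> t * sin (R * t))) \<longlongrightarrow> F u * (2 * (pi / 2)) + 0) at_top"
    by (intro tendsto_intros Si_at_top riemann_lebesgue \<Psi>)
  moreover have "\<forall>\<^sub>F R in at_top. F u * (2 * Si R) + (LINT t|lborel. \<Psi> t * sin (R * t)) = (LINT t|lborel. F t * (sin (R * (t - u)) / (t - u)))"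
    using eventually_gt_at_top[of 0] by eventually_elim (rule eq[symmetric])
  ultimately show ?thesis by (auto simp: mult.commute dest: Lim_transform_eventually)
qed

lemma integral_exp_Icc:
  assumes "0 < R" "v \<noteq> 0"
  shows "(LINT y|lborel. indicator {-R..R} y *\<^sub>R exp (\<i> * of_real y * of_real v)) = 2 * of_real (sin (R * v) / v)"
proof -
  have "(LINT y|lborel. indicator {-R..R} y *\<^sub>R exp (\<i> * of_real y * of_real v)) =
      exp (\<i> * of_real R * of_real v) / (\<i> * of_real v) - exp (\<i> * of_real (- R) * of_real v) / (\<i> * of_real v)"
  proof (rule integral_FTC_Icc)
    fix y :: real
    have "((\<lambda>z. exp (\<i> * z * of_real v) / (\<i> * of_real v)) has_field_derivative exp (\<i> * of_real y * of_real v)) (at (of_real y))"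
      using assms by (auto intro!: derivative_eq_intros)
    from has_vector_derivative_real_field[OF this]
    show "((\<lambda>y. exp (\<i> * of_real y * of_real v) / (\<i> * of_real v)) has_vector_derivative exp (\<i> * of_real y * of_real v)) (at y within {-R..R})" .
  qed (use assms in \<open>auto intro!: continuous_intros\<close>)
  also have "\<dots> = 2 * of_real (sin (R * v) / v)"
  proof -
    have "exp (\<i> * of_real (R * v)) - exp (- (\<i> * of_real (R * v))) = 2 * \<i> * of_real (sin (R * v))"
      by (simp add: sin_of_real[symmetric] sin_exp_eq)
    then show ?thesis using assms by (simp add: field_simps)
  qed
  finally show ?thesis .
qed

text \<open>Truncation to [-\<open>R\<close>,\<open>R\<close>] makes the double integral absolutely
  convergent with dominating function \<open>\<bar>F t\<bar>\<close>, so Fubini applies without any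
  decay of the Fourier transform of \<open>F\<close>.\<close>

lemma integral_fourier:
  fixes F :: "real \<Rightarrow> real"
  assumes F: "integrable lborel F" and R: "0 < R"
  shows "integral {-R..R} (\<lambda>y. LINT t|lborel. exp (\<i> * of_real y * of_real (u - t)) * of_real (F t)) =
    2 * of_real (LINT t|lborel. F t * (sin (R * (t - u)) / (t - u)))"
proof -
  have [measurable]: "F \<in> borel_measurable borel" using F by auto
  define f where "f y t = indicator {-R..R} y *\<^sub>R (exp (\<i> * of_real y * of_real (u - t)) * complex_of_real (F t))" for y t :: real
  have meas: "case_prod f \<in> borel_measurable (lborel \<Otimes>\<^sub>M lborel)"
    unfolding f_def case_prod_unfold by measurable
  have norm_f: "norm (f y t) = indicator {-R..R} y * \<bar>F t\<bar>" for y t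
    by (simp add: f_def norm_mult indicator_def)
  have f: "integrable (lborel \<Otimes>\<^sub>M lborel) (case_prod f)"
  proof (rule lborel_pair.Fubini_integrable)
    show "integrable lborel (\<lambda>y. LINT t|lborel. norm (case_prod f (y, t)))"
      unfolding case_prod_conv norm_f integral_mult_right_zero
      using R by (intro integrable_mult_left integrable_real_indicator) auto
    show "AE y in lborel. integrable lborel (\<lambda>t. case_prod f (y, t))"
    proof (rule AE_I2)
      fix y
      show "integrable lborel (\<lambda>t. case_prod f (y, t))"
      proof (rule Bochner_Integration.integrable_bound[OF F])
        show "(\<lambda>t. case_prod f (y, t)) \<in> borel_measurable lborel" by (simp add: f_def)
        show "AE t in lborel. norm (case_prod f (y, t)) \<le> norm (F t)"
          by (rule AE_I2) (simp add: norm_f indicator_def)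
      qed
    qed
  qed (rule meas)
  have set_int: "set_integrable lborel {-R..R} (\<lambda>y. LINT t|lborel. exp (\<i> * of_real y * of_real (u - t)) * of_real (F t))"
    using lborel_pair.integrable_fst[OF f] unfolding f_def set_integrable_def by simp
  have "integral {-R..R} (\<lambda>y. LINT t|lborel. exp (\<i> * of_real y * of_real (u - t)) * of_real (F t)) =
      (LINT y|lborel. LINT t|lborel. f y t)"
    by (subst set_borel_integral_eq_integral(2)[OF set_int, symmetric]) (simp add: set_lebesgue_integral_def f_def[abs_def])
  also have "\<dots> = (LINT t|lborel. LINT y|lborel. f y t)"
    by (rule lborel_pair.Fubini_integral[OF f, symmetric])
  also have "\<dots> = (LINT t|lborel. 2 * of_real (F t * (sin (R * (t - u)) / (t - u))))"
  proof (rule integral_cong_AE)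
    \<comment> \<open>At \<open>t = u\<close> the inner integral involves the length
      \<open>2 * R\<close>, whereas the quotient on the right is 0 by the convention for division by
      0.\<close>
    have "AE t in lborel. t \<notin> {u}" by (rule AE_not_in) (intro finite_imp_null_set_lborel, simp)
    then show "AE t in lborel. (LINT y|lborel. f y t) = 2 * complex_of_real (F t * (sin (R * (t - u)) / (t - u)))"
    proof eventually_elim
      case (elim t)
      have "(LINT y|lborel. f y t) = (LINT y|lborel. (indicator {-R..R} y *\<^sub>R exp (\<i> * of_real y * of_real (u - t))) * complex_of_real (F t))"
        unfolding f_def by (simp add: mult.assoc scaleR_conv_of_real)
      also have "\<dots> = 2 * of_real (sin (R * (u - t)) / (u - t)) * of_real (F t)"
        using elim R by (subst integral_mult_left_zero, subst integral_exp_Icc) auto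
      also have "sin (R * (u - t)) / (u - t) = sin (R * (t - u)) / (t - u)"
        using elim sin_minus[of "R * (t - u)"] by (simp add: algebra_simps divide_simps)
      finally show ?case by (simp add: mult_ac)
    qed
    show "(\<lambda>t. LINT y|lborel. f y t) \<in> borel_measurable lborel"
      using lborel_pair.integrable_snd[OF f] by (auto dest: borel_measurable_integrable)
  qed simp
  also have "\<dots> = 2 * of_real (LINT t|lborel. F t * (sin (R * (t - u)) / (t - u)))"
    by (simp only: integral_mult_right_zero integral_complex_of_real)
  finally show ?thesis .
qed

theorem fourier_inversion:
  fixes F :: "real \<Rightarrow> real"
  assumes "integrable lborel F" "0 < \<delta>" "\<And>t. \<bar>t - u\<bar> < \<delta> \<Longrightarrow> \<bar>F t - F u\<bar> \<le> B * \<bar>t - u\<bar>"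
  shows "((\<lambda>R. 1 / (2 * of_real pi) *
      integral {-R..R} (\<lambda>y. LINT t|lborel. exp (\<i> * of_real y * of_real (u - t)) * of_real (F t))) \<longlongrightarrow> of_real (F u)) at_top"
proof (rule Lim_transform_eventually)
  have "((\<lambda>R. 1 / (2 * complex_of_real pi) * (2 * of_real (LINT t|lborel. F t * (sin (R * (t - u)) / (t - u)))))
      \<longlongrightarrow> 1 / (2 * complex_of_real pi) * (2 * of_real (pi * F u))) at_top"
    by (intro tendsto_mult tendsto_const tendsto_of_real dirichlet_kernel_limit[OF assms])
  then show "((\<lambda>R. 1 / (2 * complex_of_real pi) * (2 * of_real (LINT t|lborel. F t * (sin (R * (t - u)) / (t - u))))) \<longlongrightarrow> of_real (F u)) at_top"
    by simp
  show "\<forall>\<^sub>F R in at_top. 1 / (2 * complex_of_real pi) * (2 * of_real (LINT t|lborel. F t * (sin (R * (t - u)) / (t - u)))) =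
      1 / (2 * of_real pi) * integral {-R..R} (\<lambda>y. LINT t|lborel. exp (\<i> * of_real y * of_real (u - t)) * of_real (F t))"
    using eventually_gt_at_top[of 0] by eventually_elim (simp only: integral_fourier[OF assms(1)])
qed

subsection \<open>Quotients of Gamma functions\<close>

text \<open>The entire function \<open>(exp x - 1) / x\<close>; as a power series it needs no
  separate treatment of 0.\<close>

definition exp_quot :: "real \<Rightarrow> real" where "exp_quot x = (\<Sum>n. x ^ n / fact (Suc n))"

lemma summable_exp_quot: "summable (\<lambda>n. (1 / fact (Suc n)) * x ^ n)" for x :: real
proof (rule summable_comparison_test'[of "\<lambda>n. \<bar>x\<bar> ^ n / fact n" 0])
  show "summable (\<lambda>n. \<bar>x\<bar> ^ n / fact n)"
    using summable_exp[of "\<bar>x\<bar>"] by (simp add: divide_inverse mult.commute)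
  show "norm (1 / fact (Suc n) * x ^ n) \<le> \<bar>x\<bar> ^ n / fact n" for n
  proof -
    have "norm (1 / fact (Suc n) * x ^ n) = \<bar>x\<bar> ^ n / fact (Suc n)" by (simp add: power_abs abs_mult)
    also have "\<dots> \<le> \<bar>x\<bar> ^ n / fact n" by (intro divide_left_mono fact_mono) auto
    finally show ?thesis .
  qed
qed

lemma mult_exp_quot: "x * exp_quot x = exp x - 1"
proof -
  have "(\<lambda>n. x ^ n / fact n) sums exp x"
    using exp_converges[of x] by (simp add: divide_inverse mult.commute)
  then have "(\<lambda>n. x ^ Suc n / fact (Suc n)) sums (exp x - x ^ 0 / fact 0)"
    by (subst sums_Suc_iff) simp
  moreover have "(\<lambda>n. x * (x ^ n / fact (Suc n))) sums (x * exp_quot x)"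
    unfolding exp_quot_def using summable_exp_quot[of x] by (intro sums_mult summable_sums) simp
  ultimately show ?thesis by (simp add: sums_unique2)
qed

lemma exp_quot_0: "exp_quot 0 = 1"
  unfolding exp_quot_def by (subst suminf_finite[of "{0}"]) auto

lemma exp_quot_pos: "0 < exp_quot x"
proof (cases "x = 0")
  case False
  have "0 < x * exp_quot x * x"
    unfolding mult_exp_quot using False by (cases "0 < x") (auto intro!: mult_pos_pos mult_neg_neg)
  then show ?thesis using False by (auto simp: zero_less_mult_iff mult_less_0_iff)
qed (simp add: exp_quot_0)

lemma exp_quot_C1: "\<exists>E'. (\<forall>x. (exp_quot has_real_derivative E' x) (at x)) \<and> continuous_on UNIV E'"
proof -
  let ?c = "\<lambda>n. 1 / fact (Suc n) :: real"
  have d1: "((\<lambda>x. \<Sum>n. ?c n * x ^ n) has_field_derivative (\<Sum>n. diffs ?c n * x ^ n)) (at x)" for x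
    by (rule termdiffs_strong_converges_everywhere[OF summable_exp_quot])
  have "summable (\<lambda>n. diffs ?c n * x ^ n)" for x
    by (rule termdiff_converges_all[OF summable_exp_quot])
  then have d2: "((\<lambda>x. \<Sum>n. diffs ?c n * x ^ n) has_field_derivative (\<Sum>n. diffs (diffs ?c) n * x ^ n)) (at x)" for x
    by (rule termdiffs_strong_converges_everywhere)
  have exp_quot: "exp_quot = (\<lambda>x. \<Sum>n. ?c n * x ^ n)" by (simp add: exp_quot_def[abs_def])
  show ?thesis
  proof (intro exI conjI allI)
    show "(exp_quot has_real_derivative (\<Sum>n. diffs ?c n * x ^ n)) (at x)" for x
      unfolding exp_quot by (rule d1)
    show "continuous_on UNIV (\<lambda>x. \<Sum>n. diffs ?c n * x ^ n)"
      by (rule DERIV_continuous_on[OF has_field_derivative_at_within[OF d2]])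
  qed
qed

text \<open>The quotient \<open>(1 - exp (- c * t)) / (1 - exp (- t))\<close> with its removable
  singularity at 0 filled in, in a form that is visibly smooth there.\<close>

definition exp_ratio :: "real \<Rightarrow> real \<Rightarrow> real" where "exp_ratio c t = c * exp_quot (- c * t) / exp_quot (- t)"

lemma exp_ratio_0: "exp_ratio c 0 = c"
  by (simp add: exp_ratio_def exp_quot_0)

lemma exp_ratio_eq: "t \<noteq> 0 \<Longrightarrow> exp_ratio c t = (1 - exp (- c * t)) / (1 - exp (- t))"
proof -
  assume t: "t \<noteq> 0"
  have "exp_ratio c t = (- c * t * exp_quot (- c * t)) / (- t * exp_quot (- t))"
    using t by (simp add: exp_ratio_def)
  also have "\<dots> = (exp (- c * t) - 1) / (exp (- t) - 1)" by (simp only: mult_exp_quot)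
  also have "\<dots> = (1 - exp (- c * t)) / (1 - exp (- t))"
    by (metis minus_diff_eq minus_divide_divide)
  finally show ?thesis .
qed

text \<open>Compactness settles [0,1]. Beyond 1 the denominator stays above
  \<open>1 - exp (- 1)\<close>, and the explicit quotient and its derivative are bounded by
  elementary estimates.\<close>

lemma exp_ratio_properties:
  assumes c: "0 \<le> c"
  shows "\<exists>D. (exp_ratio c has_real_derivative D) (at 0)"
    and "\<exists>P. \<forall>t\<ge>0. \<forall>u\<ge>0. \<bar>exp_ratio c t - exp_ratio c u\<bar> \<le> P * \<bar>t - u\<bar>"
    and "\<exists>K. \<forall>t\<ge>0. \<bar>exp_ratio c t\<bar> \<le> K"
proof -
  obtain E' where E': "\<And>x. (exp_quot has_real_derivative E' x) (at x)" and cE': "continuous_on UNIV E'"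
    using exp_quot_C1 by blast
  have cE: "continuous_on UNIV exp_quot" by (rule DERIV_continuous_on[OF has_field_derivative_at_within[OF E']])
  define b' where "b' t = (c * (E' (- c * t) * (- c)) * exp_quot (- t) - c * exp_quot (- c * t) * (E' (- t) * (- 1))) / (exp_quot (- t) * exp_quot (- t))" for t
  have exp_quot_ne: "exp_quot x \<noteq> 0" for x using exp_quot_pos[of x] by simp
  have d: "(exp_ratio c has_real_derivative b' t) (at t)" for t
  proof -
    have 1: "((\<lambda>t. exp_quot (- c * t)) has_real_derivative E' (- c * t) * (- c)) (at t)"
      by (rule DERIV_chain2[OF E']) (auto intro!: derivative_eq_intros)
    have 2: "((\<lambda>t. exp_quot (- t)) has_real_derivative E' (- t) * (- 1)) (at t)"
      by (rule DERIV_chain2[OF E']) (auto intro!: derivative_eq_intros)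
    show ?thesis unfolding exp_ratio_def[abs_def] b'_def
      by (rule DERIV_divide[OF DERIV_cmult[OF 1] 2 exp_quot_ne])
  qed
  then show "\<exists>D. (exp_ratio c has_real_derivative D) (at 0)" by blast
  have cb: "continuous_on UNIV (exp_ratio c)" by (rule DERIV_continuous_on[OF has_field_derivative_at_within[OF d]])
  have cb': "continuous_on UNIV b'"
    unfolding b'_def using exp_quot_ne
    by (intro continuous_intros continuous_on_compose2[OF cE'] continuous_on_compose2[OF cE]) auto
  obtain B1 where B1: "\<And>t. t \<in> {0..1} \<Longrightarrow> \<bar>b' t\<bar> \<le> B1"
  proof -
    have "bounded (b' ` {0..1})"
      by (intro compact_imp_bounded compact_continuous_image continuous_on_subset[OF cb']) auto
    then show ?thesis using that unfolding bounded_iff by (metis image_eqI real_norm_def)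
  qed
  obtain B2 where B2: "\<And>t. t \<in> {0..1} \<Longrightarrow> \<bar>exp_ratio c t\<bar> \<le> B2"
  proof -
    have "bounded (exp_ratio c ` {0..1})"
      by (intro compact_imp_bounded compact_continuous_image continuous_on_subset[OF cb]) auto
    then show ?thesis using that unfolding bounded_iff by (metis image_eqI real_norm_def)
  qed
  define \<epsilon> :: real where "\<epsilon> = 1 - exp (- 1)"
  have \<epsilon>: "0 < \<epsilon>" by (simp add: \<epsilon>_def)
  have den: "\<epsilon> \<le> 1 - exp (- t)" if "1 \<le> t" for t :: real using that by (simp add: \<epsilon>_def)
  have b'_large: "\<bar>b' t\<bar> \<le> (c + 1) / (\<epsilon> * \<epsilon>)" if t: "1 < t" for t
  proof -
    have "((\<lambda>t. (1 - exp (- c * t)) / (1 - exp (- t))) has_real_derivative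
       ((0 - exp (- c * t) * (- c)) * (1 - exp (- t)) - (1 - exp (- c * t)) * (0 - exp (- t) * (- 1))) /
         ((1 - exp (- t)) * (1 - exp (- t)))) (at t)"
      using t by (intro DERIV_divide DERIV_diff DERIV_const DERIV_fun_exp) (auto intro!: derivative_eq_intros)
    then have "(exp_ratio c has_real_derivative
       ((0 - exp (- c * t) * (- c)) * (1 - exp (- t)) - (1 - exp (- c * t)) * (0 - exp (- t) * (- 1))) /
         ((1 - exp (- t)) * (1 - exp (- t)))) (at t)"
      by (rule has_field_derivative_transform_within_open[of _ _ _ "{0<..}"]) (use t in \<open>auto simp: exp_ratio_eq\<close>)
    then have "b' t = (exp (- c * t) * c * (1 - exp (- t)) - (1 - exp (- c * t)) * exp (- t)) /
         ((1 - exp (- t)) * (1 - exp (- t)))"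
      using DERIV_unique[OF d] by fastforce
    also have "\<bar>\<dots>\<bar> \<le> (c + 1) / ((1 - exp (- t)) * (1 - exp (- t)))"
    proof -
      have e: "0 \<le> exp (- c * t)" "exp (- c * t) \<le> 1" "0 \<le> exp (- t)" "exp (- t) \<le> 1"
        using t c by auto
      have "\<bar>exp (- c * t) * c * (1 - exp (- t))\<bar> \<le> 1 * c * 1"
        unfolding abs_mult using e c by (intro mult_mono mult_nonneg_nonneg) auto
      moreover have "\<bar>(1 - exp (- c * t)) * exp (- t)\<bar> \<le> 1 * 1"
        unfolding abs_mult using e c by (intro mult_mono mult_nonneg_nonneg) auto
      ultimately have "\<bar>exp (- c * t) * c * (1 - exp (- t)) - (1 - exp (- c * t)) * exp (- t)\<bar> \<le> c + 1"
        using abs_triangle_ineq4[of "exp (- c * t) * c * (1 - exp (- t))" "(1 - exp (- c * t)) * exp (- t)"] by linarith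
      then show ?thesis using t by (simp add: abs_divide divide_right_mono abs_mult)
    qed
    also have "\<dots> \<le> (c + 1) / (\<epsilon> * \<epsilon>)"
      using den[of t] \<epsilon> t c by (intro divide_left_mono mult_mono mult_pos_pos) auto
    finally show ?thesis .
  qed
  have "\<bar>exp_ratio c t - exp_ratio c u\<bar> \<le> max B1 ((c + 1) / (\<epsilon> * \<epsilon>)) * \<bar>t - u\<bar>" if "0 \<le> t" "0 \<le> u" for t u
  proof -
    have "norm (exp_ratio c t - exp_ratio c u) \<le> max B1 ((c + 1) / (\<epsilon> * \<epsilon>)) * norm (t - u)"
    proof (rule field_differentiable_bound[of "{0..}"])
      show "(exp_ratio c has_field_derivative b' z) (at z within {0..})" for z
        by (rule has_field_derivative_at_within[OF d])
      show "norm (b' z) \<le> max B1 ((c + 1) / (\<epsilon> * \<epsilon>))" if "z \<in> {0..}" for z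
        using B1[of z] b'_large[of z] that by (cases "z \<le> 1") (auto simp: le_max_iff_disj)
    qed (use that in auto)
    then show ?thesis by simp
  qed
  then show "\<exists>P. \<forall>t\<ge>0. \<forall>u\<ge>0. \<bar>exp_ratio c t - exp_ratio c u\<bar> \<le> P * \<bar>t - u\<bar>" by blast
  have "\<bar>exp_ratio c t\<bar> \<le> max B2 (1 / \<epsilon>)" if "0 \<le> t" for t
  proof (cases "t \<le> 1")
    case False
    have "\<bar>exp_ratio c t\<bar> \<le> 1 / (1 - exp (- t))"
      using False c by (subst exp_ratio_eq) (auto simp: abs_divide intro!: divide_right_mono)
    also have "\<dots> \<le> 1 / \<epsilon>" using den[of t] \<epsilon> False by (intro divide_left_mono) auto
    finally show ?thesis by simp
  qed (use B2[of t] that in \<open>auto simp: le_max_iff_disj\<close>)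
  then show "\<exists>K. \<forall>t\<ge>0. \<bar>exp_ratio c t\<bar> \<le> K" by blast
qed

text \<open>\<open>exp_le\<close> says that the kernel is nonnegative for positive arguments; the
  sum in \<open>excess_pos\<close> is its value at 0.\<close>

locale gamma_quotient =
  fixes n :: nat and c d :: "nat \<Rightarrow> real"
  assumes c_nonneg: "\<And>i. i < n \<Longrightarrow> 0 \<le> c i" and d_nonneg: "\<And>i. i < n \<Longrightarrow> 0 \<le> d i"
    and excess_pos: "0 < (\<Sum>i<n. d i - c i)"
    and exp_le: "\<And>t. 0 < t \<Longrightarrow> (\<Sum>i<n. exp (- d i * t)) \<le> (\<Sum>i<n. exp (- c i * t))"
begin

text \<open>In each difference the ones in the numerators cancel and
  \<open>exp (- c i * t) - exp (- d i * t)\<close> over \<open>1 - exp (- t)\<close> remains.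
  Differences of \<open>exp_ratio\<close> are used because each of them is regular at 0 by
  itself.\<close>

definition k :: "real \<Rightarrow> real" where "k t = (\<Sum>i<n. exp_ratio (d i) t - exp_ratio (c i) t)"

lemma k_eq: "t \<noteq> 0 \<Longrightarrow> k t = (\<Sum>i<n. exp (- c i * t) - exp (- d i * t)) / (1 - exp (- t))"
  unfolding k_def sum_divide_distrib
  by (intro sum.cong refl) (simp add: exp_ratio_eq diff_divide_distrib)

lemma volterra: "\<exists>K P D. volterra_kernel k (\<Sum>i<n. d i - c i) K P D"
proof -
  have "\<exists>D. \<forall>i<n. (exp_ratio (c i) has_real_derivative D i) (at 0)"
    using exp_ratio_properties(1)[OF c_nonneg] by metis
  then obtain D1 where D1: "\<And>i. i < n \<Longrightarrow> (exp_ratio (c i) has_real_derivative D1 i) (at 0)" by blast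
  have "\<exists>D. \<forall>i<n. (exp_ratio (d i) has_real_derivative D i) (at 0)"
    using exp_ratio_properties(1)[OF d_nonneg] by metis
  then obtain D2 where D2: "\<And>i. i < n \<Longrightarrow> (exp_ratio (d i) has_real_derivative D2 i) (at 0)" by blast
  have "\<exists>P. \<forall>i<n. \<forall>t\<ge>0. \<forall>u\<ge>0. \<bar>exp_ratio (c i) t - exp_ratio (c i) u\<bar> \<le> P i * \<bar>t - u\<bar>"
    using exp_ratio_properties(2)[OF c_nonneg] by metis
  then obtain P1 where P1: "\<And>i t u. i < n \<Longrightarrow> 0 \<le> t \<Longrightarrow> 0 \<le> u \<Longrightarrow> \<bar>exp_ratio (c i) t - exp_ratio (c i) u\<bar> \<le> P1 i * \<bar>t - u\<bar>" by blast
  have "\<exists>P. \<forall>i<n. \<forall>t\<ge>0. \<forall>u\<ge>0. \<bar>exp_ratio (d i) t - exp_ratio (d i) u\<bar> \<le> P i * \<bar>t - u\<bar>"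
    using exp_ratio_properties(2)[OF d_nonneg] by metis
  then obtain P2 where P2: "\<And>i t u. i < n \<Longrightarrow> 0 \<le> t \<Longrightarrow> 0 \<le> u \<Longrightarrow> \<bar>exp_ratio (d i) t - exp_ratio (d i) u\<bar> \<le> P2 i * \<bar>t - u\<bar>" by blast
  have "\<exists>K. \<forall>i<n. \<forall>t\<ge>0. \<bar>exp_ratio (c i) t\<bar> \<le> K i"
    using exp_ratio_properties(3)[OF c_nonneg] by metis
  then obtain K1 where K1: "\<And>i t. i < n \<Longrightarrow> 0 \<le> t \<Longrightarrow> \<bar>exp_ratio (c i) t\<bar> \<le> K1 i" by blast
  have "\<exists>K. \<forall>i<n. \<forall>t\<ge>0. \<bar>exp_ratio (d i) t\<bar> \<le> K i"
    using exp_ratio_properties(3)[OF d_nonneg] by metis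
  then obtain K2 where K2: "\<And>i t. i < n \<Longrightarrow> 0 \<le> t \<Longrightarrow> \<bar>exp_ratio (d i) t\<bar> \<le> K2 i" by blast
  have "volterra_kernel k (\<Sum>i<n. d i - c i) (\<Sum>i<n. K1 i + K2 i) (\<Sum>i<n. P1 i + P2 i) (\<Sum>i<n. D2 i - D1 i)"
  proof
    show "k 0 = (\<Sum>i<n. d i - c i)" by (simp add: k_def exp_ratio_0)
    show "0 < (\<Sum>i<n. d i - c i)" by (rule excess_pos)
    show "0 \<le> k t" if "0 \<le> t" for t
    proof (cases "t = 0")
      case True
      then show ?thesis using excess_pos by (simp add: k_def exp_ratio_0)
    next
      case False
      then show ?thesis using that exp_le[of t] by (simp add: k_eq sum_subtractf)
    qed
    show "k t \<le> (\<Sum>i<n. K1 i + K2 i)" if "0 \<le> t" for t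
      unfolding k_def
    proof (rule sum_mono)
      fix i assume "i \<in> {..<n}"
      then show "exp_ratio (d i) t - exp_ratio (c i) t \<le> K1 i + K2 i" using K1[of i t] K2[of i t] that by auto
    qed
    show "\<bar>k t - k u\<bar> \<le> (\<Sum>i<n. P1 i + P2 i) * \<bar>t - u\<bar>" if "0 \<le> t" "0 \<le> u" for t u
    proof -
      have "\<bar>k t - k u\<bar> = \<bar>\<Sum>i<n. (exp_ratio (d i) t - exp_ratio (c i) t) - (exp_ratio (d i) u - exp_ratio (c i) u)\<bar>"
        by (simp add: k_def sum_subtractf)
      also have "\<dots> \<le> (\<Sum>i<n. \<bar>(exp_ratio (d i) t - exp_ratio (c i) t) - (exp_ratio (d i) u - exp_ratio (c i) u)\<bar>)" by (rule sum_abs)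
      also have "\<dots> \<le> (\<Sum>i<n. (P1 i + P2 i) * \<bar>t - u\<bar>)"
      proof (rule sum_mono)
        fix i assume "i \<in> {..<n}"
        then show "\<bar>(exp_ratio (d i) t - exp_ratio (c i) t) - (exp_ratio (d i) u - exp_ratio (c i) u)\<bar> \<le> (P1 i + P2 i) * \<bar>t - u\<bar>"
          using P1[of i t u] P2[of i t u] that by (simp add: distrib_right)
      qed
      finally show ?thesis by (simp add: sum_distrib_right)
    qed
    have "(k has_real_derivative (\<Sum>i<n. D2 i - D1 i)) (at 0)"
      unfolding k_def[abs_def] by (intro DERIV_sum DERIV_diff D1 D2) auto
    then show "(k has_real_derivative (\<Sum>i<n. D2 i - D1 i)) (at 0 within {0..})"
      by (rule has_field_derivative_at_within)
  qed
  then show ?thesis by blast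
qed

end

section \<open>The Gamma quotient as a Laplace transform\<close>

lemma has_bochner_integral_exp_minus:
  fixes x :: real
  assumes "0 < x"
  shows "has_bochner_integral lborel (\<lambda>t. indicator {0..} t * exp (- x * t)) (1 / x)"
proof -
  have "((\<lambda>t. exp (- x * t)) has_integral exp (- x * 0) / x) {0..}"
    by (rule has_integral_exp_minus_to_infinity[OF assms])
  then have "((\<lambda>t. exp (- x * t)) has_integral 1 / x) {0..}" by simp
  from nn_integral_has_integral_lebesgue'[OF _ this]
  have "(\<integral>\<^sup>+t. ennreal (exp (- x * t)) * indicator {0..} t \<partial>lborel) = ennreal (1 / x)" by simp
  then show ?thesis
    using assms by (intro has_bochner_integral_nn_integral) (auto simp: mult.commute ennreal_mult' ennreal_indicator)
qed

text \<open>The logarithms in the two limit formulas cancel.\<close>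

lemma Digamma_diff_LIMSEQ:
  fixes x y :: "'a :: {banach,real_normed_field}"
  assumes "x \<noteq> 0" "y \<noteq> 0"
  shows "(\<lambda>N. \<Sum>m<N. inverse (x + of_nat m) - inverse (y + of_nat m)) \<longlonglongrightarrow> Digamma y - Digamma x"
  using tendsto_diff[OF Digamma_LIMSEQ[OF assms(2)] Digamma_LIMSEQ[OF assms(1)]]
  by (simp add: sum_subtractf)

context gamma_quotient begin

lemma integral_k_eq_Digamma:
  assumes vk: "volterra_kernel k a K P D" and s: "0 < s"
  shows "complex_of_real (LINT t|lborel. exp (- s * t) * volterra_kernel.k\<^sub>0 k t) =
    (\<Sum>i<n. Digamma (of_real (d i + s)) - Digamma (of_real (c i + s)))"
proof -
  interpret V: volterra_kernel k a K P D by (rule vk)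
  \<comment> \<open>Summing a geometric series, the remainder after \<open>N\<close> terms is the Laplace transform of \<open>k\<close> at \<open>s + N\<close>.\<close>
  define partial where "partial N = (\<Sum>i<n. \<Sum>m<N. inverse (c i + s + real m) - inverse (d i + s + real m))" for N
  define I where "I = (LINT t|lborel. exp (- s * t) * V.k\<^sub>0 t)"
  have rem: "I - partial N = (LINT t|lborel. exp (- (s + real N) * t) * V.k\<^sub>0 t)" for N
  proof -
    have ptw: "exp (- s * t) * V.k\<^sub>0 t - exp (- (s + real N) * t) * V.k\<^sub>0 t =
      (\<Sum>i<n. \<Sum>m<N. indicator {0..} t * exp (- (c i + s + real m) * t) - indicator {0..} t * exp (- (d i + s + real m) * t))" for t
    proof (cases "0 < t")
      case True
      have e1: "exp (- t) \<noteq> 1" using True by simp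
      have geom: "(\<Sum>m<N. exp (- real m * t)) = (1 - exp (- real N * t)) / (1 - exp (- t))"
      proof -
        have "(\<Sum>m<N. exp (- real m * t)) = (\<Sum>m<N. exp (- t) ^ m)"
          by (intro sum.cong refl) (simp flip: exp_of_nat_mult)
        also have "\<dots> = (1 - exp (- t) ^ N) / (1 - exp (- t))"
          using e1 by (simp add: sum_gp_strict)
        finally show ?thesis by (simp flip: exp_of_nat_mult)
      qed
      have "(\<Sum>i<n. \<Sum>m<N. indicator {0..} t * exp (- (c i + s + real m) * t) - indicator {0..} t * exp (- (d i + s + real m) * t))
         = (\<Sum>i<n. \<Sum>m<N. exp (- s * t) * (exp (- c i * t) - exp (- d i * t)) * exp (- real m * t))"
        using True by (intro sum.cong refl) (simp add: algebra_simps flip: exp_add)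
      also have "\<dots> = exp (- s * t) * (\<Sum>i<n. exp (- c i * t) - exp (- d i * t)) * (\<Sum>m<N. exp (- real m * t))"
        by (simp only: sum_distrib_left[symmetric] sum_distrib_right[symmetric] mult.assoc)
      also have "\<dots> = exp (- s * t) * k t * (1 - exp (- real N * t))"
        using True e1 unfolding geom by (simp add: k_eq)
      also have "\<dots> = exp (- s * t) * V.k\<^sub>0 t - exp (- (s + real N) * t) * V.k\<^sub>0 t"
        using True by (simp add: V.k\<^sub>0_def algebra_simps exp_add exp_diff exp_minus divide_inverse)
      finally show ?thesis by simp
    next
      case False
      then show ?thesis by (cases "t = 0") (auto simp: V.k\<^sub>0_def)
    qed
    have pos: "0 < c i + s + real m" "0 < d i + s + real m" if "i < n" for i m
      using c_nonneg[OF that] d_nonneg[OF that] s by (auto intro: add_nonneg_pos add_pos_nonneg)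
    have e: "has_bochner_integral lborel (\<lambda>t. indicator {0..} t * exp (- (c i + s + real m) * t) - indicator {0..} t * exp (- (d i + s + real m) * t))
        (inverse (c i + s + real m) - inverse (d i + s + real m))" if "i < n" for i m
      using has_bochner_integral_diff[OF has_bochner_integral_exp_minus[OF pos(1)[OF that, of m]] has_bochner_integral_exp_minus[OF pos(2)[OF that, of m]]]
      by (simp add: inverse_eq_divide)
    have "I - (LINT t|lborel. exp (- (s + real N) * t) * V.k\<^sub>0 t) = 
      (LINT t|lborel. exp (- s * t) * V.k\<^sub>0 t - exp (- (s + real N) * t) * V.k\<^sub>0 t)"
      unfolding I_def using s by (intro Bochner_Integration.integral_diff[symmetric] V.integrable_k\<^sub>0) auto
    also have "\<dots> = partial N"
      unfolding ptw partial_def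
      by (rule has_bochner_integral_integral_eq) (intro has_bochner_integral_sum e, simp)
    finally show ?thesis by simp
  qed
  \<comment> \<open>As the kernel lies between 0 and \<open>K\<close>, the remainder is at most
    \<open>K / (s + N)\<close>.\<close>
  have lim0: "(\<lambda>N. I - partial N) \<longlonglongrightarrow> 0"
  proof (rule Lim_null_comparison)
    show "\<forall>\<^sub>F N in sequentially. norm (I - partial N) \<le> K * (1 / (s + real N))"
    proof (rule always_eventually, rule allI)
      fix N
      have pos: "0 < s + real N" using s by simp
      have "norm (I - partial N) \<le> (LINT t|lborel. K * (indicator {0..} t * exp (- (s + real N) * t)))"
        unfolding rem
      proof (rule Bochner_Integration.integral_norm_bound_integral)
        show "integrable lborel (\<lambda>t. exp (- (s + real N) * t) * V.k\<^sub>0 t)" by (rule V.integrable_k\<^sub>0[OF pos])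
        show "integrable lborel (\<lambda>t. K * (indicator {0..} t * exp (- (s + real N) * t)))"
          using has_bochner_integral_exp_minus[OF pos] by (intro integrable_mult_right) (auto simp: has_bochner_integral_iff)
        fix t
        show "norm (exp (- (s + real N) * t) * V.k\<^sub>0 t) \<le> K * (indicator {0..} t * exp (- (s + real N) * t))"
          using V.k\<^sub>0_bounds[of t] by (cases "0 \<le> t") (auto simp: abs_mult V.k\<^sub>0_def)
      qed
      also have "\<dots> = K * (1 / (s + real N))"
        using has_bochner_integral_exp_minus[OF pos] by (simp add: has_bochner_integral_iff)
      finally show "norm (I - partial N) \<le> K * (1 / (s + real N))" .
    qed
    show "(\<lambda>N. K * (1 / (s + real N))) \<longlonglongrightarrow> 0" by real_asymp
  qed
  have "partial \<longlonglongrightarrow> I"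
    using tendsto_diff[OF tendsto_const[of I] lim0] by simp
  then have l1: "(\<lambda>N. complex_of_real (partial N)) \<longlonglongrightarrow> of_real I" by (rule tendsto_of_real)
  have "(\<lambda>N. \<Sum>i<n. \<Sum>m<N. inverse (of_real (c i + s) + of_nat m) - inverse (of_real (d i + s) + of_nat m))
      \<longlonglongrightarrow> (\<Sum>i<n. Digamma (of_real (d i + s)) - Digamma (complex_of_real (c i + s)))"
  proof (intro tendsto_sum Digamma_diff_LIMSEQ)
    fix i assume "i \<in> {..<n}"
    then show "complex_of_real (c i + s) \<noteq> 0" "complex_of_real (d i + s) \<noteq> 0"
      using c_nonneg[of i] d_nonneg[of i] s by (auto simp flip: of_real_add)
  qed
  also have "(\<lambda>N. \<Sum>i<n. \<Sum>m<N. inverse (of_real (c i + s) + of_nat m) - inverse (of_real (d i + s) + of_nat m)) =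
      (\<lambda>N. complex_of_real (partial N))"
    unfolding partial_def by (rule ext) simp
  finally show ?thesis
    using LIMSEQ_unique[OF l1] unfolding I_def by blast
qed

lemma not_nonpos_Ints: "0 \<le> x \<Longrightarrow> 0 < Re z \<Longrightarrow> of_real x + z \<notin> \<int>\<^sub>\<le>\<^sub>0"
  by (auto elim!: nonpos_Ints_cases simp: complex_eq_iff)

text \<open>The quotient is taken upside down because its product with the Laplace transform of
  \<open>h\<close> is to be shown constant.\<close>

lemma gamma_ratio_derivative:
  assumes z: "0 < Re z" and m: "m \<le> n"
  shows "((\<lambda>z. \<Prod>i<m. Gamma (of_real (d i) + z) / Gamma (of_real (c i) + z)) has_field_derivative
    (\<Prod>i<m. Gamma (of_real (d i) + z) / Gamma (of_real (c i) + z)) *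
    (\<Sum>i<m. Digamma (of_real (d i) + z) - Digamma (of_real (c i) + z))) (at z)"
  using m
proof (induction m)
  case (Suc m)
  have "of_real (d m) + z \<notin> \<int>\<^sub>\<le>\<^sub>0" "of_real (c m) + z \<notin> \<int>\<^sub>\<le>\<^sub>0"
    using Suc.prems not_nonpos_Ints[OF c_nonneg z, of m] not_nonpos_Ints[OF d_nonneg z, of m] by simp_all
  then have "((\<lambda>z. Gamma (of_real (d m) + z) / Gamma (of_real (c m) + z)) has_field_derivative
      Gamma (of_real (d m) + z) / Gamma (of_real (c m) + z) * (Digamma (of_real (d m) + z) - Digamma (of_real (c m) + z))) (at z)"
    by (auto intro!: derivative_eq_intros simp: Gamma_eq_zero_iff field_simps)
  note deriv = DERIV_mult[OF Suc.IH this]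
  show ?case
    unfolding prod.lessThan_Suc sum.lessThan_Suc
    by (rule DERIV_cong[OF deriv]) (use Suc.prems in \<open>simp_all add: distrib_left mult_ac\<close>)
qed simp

text \<open>The product \<open>N\<close> of the inverted quotient and the Laplace transform has
  derivative 0 at positive reals by the convolution equation, hence on the half-plane by the
  identity theorem. Its constant value is computed at \<open>z = 1\<close>, where it is real and
  positive; dividing \<open>h\<close> by it preserves all other properties.\<close>

theorem exists_laplace_density:
  obtains h :: "real \<Rightarrow> real" where
    "h \<in> borel_measurable borel" and "\<And>t. t \<le> 0 \<Longrightarrow> h t = 0" and "\<And>t. 0 < t \<Longrightarrow> 0 < h t"
    and "continuous_on {0<..} h"
    and "\<And>s. 0 < s \<Longrightarrow> integrable lborel (\<lambda>t. exp (- s * t) * h t)"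
    and "\<And>u. 0 < u \<Longrightarrow> \<exists>B. \<forall>t. \<bar>t - u\<bar> < u / 2 \<longrightarrow> \<bar>h t - h u\<bar> \<le> B * \<bar>t - u\<bar>"
    and "\<And>z. 0 < Re z \<Longrightarrow> laplace h z = (\<Prod>i<n. Gamma (of_real (c i) + z) / Gamma (of_real (d i) + z))"
proof -
  obtain K P D where vk: "volterra_kernel k (\<Sum>i<n. d i - c i) K P D" using volterra by blast
  interpret V: volterra_kernel k "\<Sum>i<n. d i - c i" K P D by (rule vk)
  define R where "R z = (\<Prod>i<n. Gamma (complex_of_real (d i) + z) / Gamma (of_real (c i) + z))" for z
  define S where "S z = (\<Sum>i<n. Digamma (complex_of_real (d i) + z) - Digamma (of_real (c i) + z))" for z
  define N where "N z = R z * laplace V.h z" for z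
  let ?H = "{z. 0 < Re z}"
  have V0: "V.h t = 0" if "t \<le> 0" for t using that by (simp add: V.h_def)
  define L' where "L' z = (LINT t|lborel. - of_real t * exp (- z * of_real t) * complex_of_real (V.h t))" for z
  have dL: "(laplace V.h has_field_derivative L' z) (at z)" if "0 < Re z" for z
    unfolding L'_def by (rule laplace_has_field_derivative[OF V.measurable_h V0 V.integrable_h that])
  have dN: "(N has_field_derivative R z * S z * laplace V.h z + L' z * R z) (at z)" if "0 < Re z" for z
    unfolding N_def[abs_def] R_def S_def
    by (rule DERIV_mult[OF gamma_ratio_derivative[OF that order.refl] dL[OF that]])
  have H: "open ?H" "convex ?H" by (auto simp: open_halfspace_Re_gt convex_halfspace_Re_gt)
  \<comment> \<open>The convolution equation is used for real arguments only, where Tonelli's theorem applies.\<close>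
  have real0: "deriv N (of_real s) = 0" if s: "0 < s" for s
  proof -
    have "L' (of_real s) = (LINT t|lborel. complex_of_real (- (t * exp (- s * t) * V.h t)))"
      unfolding L'_def by (intro Bochner_Integration.integral_cong) (auto simp flip: exp_of_real)
    also have "\<dots> = - of_real (LINT t|lborel. t * exp (- s * t) * V.h t)"
      by (subst integral_complex_of_real) simp
    also have "\<dots> = - (of_real (LINT t|lborel. exp (- s * t) * V.k\<^sub>0 t) * of_real (LINT t|lborel. exp (- s * t) * V.h t))"
      by (simp only: V.laplace_convolution[OF s] of_real_mult)
    also have "of_real (LINT t|lborel. exp (- s * t) * V.k\<^sub>0 t) = S (of_real s)"
      unfolding S_def using integral_k_eq_Digamma[OF vk s] by simp
    also have "complex_of_real (LINT t|lborel. exp (- s * t) * V.h t) = laplace V.h (of_real s)"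
      unfolding laplace_def by (subst integral_complex_of_real[symmetric]) (simp flip: exp_of_real)
    finally have "L' (of_real s) = - (S (of_real s) * laplace V.h (of_real s))" .
    then show ?thesis
      using DERIV_imp_deriv[OF dN[of "of_real s"]] s by simp
  qed
  have hol: "deriv N holomorphic_on ?H"
    using dN by (intro holomorphic_deriv H) (auto simp: holomorphic_on_open[OF H(1)])
  have "deriv N z = 0" if "z \<in> ?H" for z
  proof (rule analytic_continuation[OF hol H(1) convex_connected[OF H(2)], of "of_real ` {0<..}" 1])
    show "1 islimpt complex_of_real ` {0<..}"
      unfolding islimpt_approachable
    proof (intro allI impI)
      fix e :: real assume "0 < e"
      then show "\<exists>x'\<in>complex_of_real ` {0<..}. x' \<noteq> 1 \<and> dist x' 1 < e"
        by (intro bexI[of _ "of_real (1 + e / 2)"] imageI) (auto simp: dist_norm)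
    qed
  qed (use that real0 in auto)
  then have "(N has_field_derivative 0) (at z within ?H)" if "z \<in> ?H" for z
    using dN[of z] that DERIV_imp_deriv[OF dN[of z]] by (auto intro: has_field_derivative_at_within)
  from has_field_derivative_zero_constant[OF H(2) this]
  obtain C where C: "\<And>z. 0 < Re z \<Longrightarrow> N z = C" by auto
  define I where "I = (LINT t|lborel. exp (- 1 * t) * V.h t)"
  have "0 < I"
  proof -
    have "0 \<le> I" unfolding I_def by (intro Bochner_Integration.integral_nonneg) (simp add: V.h_nonneg)
    moreover have "I \<noteq> 0"
    proof
      assume "I = 0"
      then have "AE t in lborel. exp (- 1 * t) * V.h t = 0"
        unfolding I_def using integral_nonneg_eq_0_iff_AE[OF V.integrable_h[of 1]] by (simp add: V.h_nonneg)
      then have "AE t in lborel. t \<notin> {0<..<1::real}"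
        by eventually_elim (use V.h_pos in force)
      then have "emeasure lborel {0<..<1::real} = 0"
        by (subst (asm) AE_iff_measurable[of "{0<..<1}"]) auto
      then show False by simp
    qed
    ultimately show ?thesis by simp
  qed
  have pos: "0 < c i + 1" "0 < d i + 1" if "i < n" for i
    using c_nonneg[OF that] d_nonneg[OF that] by auto
  have "C = of_real ((\<Prod>i<n. Gamma (d i + 1) / Gamma (c i + 1)) * I)"
  proof -
    have "laplace V.h 1 = of_real I"
      unfolding laplace_def I_def by (subst integral_complex_of_real[symmetric]) (simp flip: exp_of_real)
    moreover have "R 1 = of_real (\<Prod>i<n. Gamma (d i + 1) / Gamma (c i + 1))"
      unfolding R_def by (simp add: Gamma_complex_of_real[symmetric])
    ultimately show ?thesis using C[of 1] by (simp add: N_def)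
  qed
  moreover define C' where "C' = (\<Prod>i<n. Gamma (d i + 1) / Gamma (c i + 1)) * I"
  ultimately have CC': "C = of_real C'" by simp
  have C'_pos: "0 < C'"
    unfolding C'_def using pos by (intro mult_pos_pos \<open>0 < I\<close> prod_pos) (auto intro!: divide_pos_pos Gamma_real_pos)
  show ?thesis
  proof (rule that[of "\<lambda>t. V.h t / C'"])
    show "\<exists>B. \<forall>t. \<bar>t - u\<bar> < u / 2 \<longrightarrow> \<bar>V.h t / C' - V.h u / C'\<bar> \<le> B * \<bar>t - u\<bar>" if u: "0 < u" for u
    proof -
      obtain B where "\<And>t. \<bar>t - u\<bar> < u / 2 \<Longrightarrow> \<bar>V.h t - V.h u\<bar> \<le> B * \<bar>t - u\<bar>"
        using V.h_lipschitz[OF u] by blast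
      then have "\<bar>V.h t / C' - V.h u / C'\<bar> \<le> B / C' * \<bar>t - u\<bar>" if "\<bar>t - u\<bar> < u / 2" for t
        using that C'_pos by (simp add: divide_right_mono flip: diff_divide_distrib)
      then show ?thesis by blast
    qed
    show "laplace (\<lambda>t. V.h t / C') z = (\<Prod>i<n. Gamma (of_real (c i) + z) / Gamma (of_real (d i) + z))" if z: "0 < Re z" for z
    proof -
      have eq: "laplace (\<lambda>t. V.h t / C') z = laplace V.h z / of_real C'"
        unfolding laplace_def by simp
      have "laplace V.h z * R z = of_real C'" using C[OF z] by (simp add: N_def CC' mult.commute)
      moreover have "R z * (\<Prod>i<n. Gamma (of_real (c i) + z) / Gamma (of_real (d i) + z)) = 1"
        unfolding R_def prod.distrib[symmetric] 
        using not_nonpos_Ints[OF c_nonneg z] not_nonpos_Ints[OF d_nonneg z]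
        by (intro prod.neutral) (auto simp: Gamma_eq_zero_iff)
      ultimately have "laplace V.h z * 1 = of_real C' * (\<Prod>i<n. Gamma (of_real (c i) + z) / Gamma (of_real (d i) + z))"
        by (metis mult.assoc)
      then show ?thesis using C'_pos by (simp add: eq)
    qed
    show "(\<lambda>t. V.h t / C') \<in> borel_measurable borel" by simp
    show "V.h t / C' = 0" if "t \<le> 0" for t using V0[OF that] by simp
    show "0 < V.h t / C'" if "0 < t" for t using V.h_pos[OF that] C'_pos by simp
    show "continuous_on {0<..} (\<lambda>t. V.h t / C')"
      using C'_pos by (intro continuous_on_divide V.continuous_on_h continuous_on_const) simp
    show "integrable lborel (\<lambda>t. exp (- s * t) * (V.h t / C'))" if "0 < s" for s
      using integrable_divide[OF V.integrable_h[OF that], of C'] by simp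
  qed
qed

end

subsection \<open>Majorization and Meijer's function\<close>

text \<open>Summation by parts. The boundary term \<open>w m * (\<Sum>i<m. x i)\<close> is kept on
  the left, since it is what makes the induction go through.\<close>

lemma abel_sum_ge:
  fixes w x :: "nat \<Rightarrow> real"
  assumes w: "\<And>i. w (Suc i) \<le> w i" and x: "\<And>m. m \<le> n \<Longrightarrow> 0 \<le> (\<Sum>i<m. x i)"
  shows "m \<le> n \<Longrightarrow> w m * (\<Sum>i<m. x i) \<le> (\<Sum>i<m. w i * x i)"
proof (induction m)
  case (Suc m)
  have "w (Suc m) * (\<Sum>i<Suc m. x i) \<le> w m * (\<Sum>i<Suc m. x i)"
    using w x[of "Suc m"] Suc.prems by (intro mult_right_mono) auto
  also have "\<dots> = w m * (\<Sum>i<m. x i) + w m * x m" by (simp add: distrib_left)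
  finally show ?case using Suc by simp
qed simp

text \<open>Convexity bounds \<open>exp (- a * t) - exp (- b * t)\<close> from below by the tangent
  at \<open>b\<close>, which is \<open>t * exp (- b * t) * (b - a)\<close>. These weights decrease
  because \<open>B\<close> is sorted, and the partial sums of \<open>b - a\<close> are nonnegative
  by majorization, so Abel summation applies.\<close>

lemma weak_supermajorized_exp_le:
  assumes "B \<prec>\<^sup>W A" and t: "0 \<le> t"
  shows "(\<Sum>i<length A. exp (- (B ! i) * t)) \<le> (\<Sum>i<length A. exp (- (A ! i) * t))"
proof -
  let ?q = "length A"
  have len: "length B = ?q" and srt: "sorted B"
    and sums: "\<And>m. m \<in> {1..?q} \<Longrightarrow> sum_list (take m A) \<le> sum_list (take m B)"
    using assms by (auto simp: weak_supermajorized_def)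
  \<comment> \<open>Setting the weights to 0 from index \<open>q\<close> on keeps them decreasing
    and kills the boundary term of the Abel summation.\<close>
  define w where "w i = (if i < ?q then t * exp (- (B ! i) * t) else 0)" for i
  define x where "x i = B ! i - A ! i" for i
  have w: "w (Suc i) \<le> w i" for i
    using t sorted_nth_mono[OF srt, of i "Suc i"] len
    by (auto simp: w_def intro!: mult_left_mono mult_right_mono)
  have take: "sum_list (take m xs) = (\<Sum>i<m. xs ! i)" if "m \<le> length xs" for m and xs :: "real list"
    using that by (simp add: sum_list_sum_nth atLeast0LessThan)
  have x: "0 \<le> (\<Sum>i<m. x i)" if "m \<le> ?q" for m
  proof (cases "m = 0")
    case False
    then show ?thesis using sums[of m] that len by (simp add: x_def sum_subtractf take)
  qed simp
  have "0 \<le> (\<Sum>i<?q. w i * x i)"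
    using abel_sum_ge[of w ?q x ?q, OF w x] by (simp add: w_def[of ?q])
  also have "\<dots> \<le> (\<Sum>i<?q. exp (- (A ! i) * t) - exp (- (B ! i) * t))"
  proof (rule sum_mono)
    fix i assume i: "i \<in> {..<?q}"
    have "exp (- (B ! i) * t) * (1 + x i * t) \<le> exp (- (B ! i) * t) * exp (x i * t)"
      by (intro mult_left_mono exp_ge_add_one_self) auto
    also have "\<dots> = exp (- (A ! i) * t)" by (simp add: x_def algebra_simps flip: exp_add)
    finally show "w i * x i \<le> exp (- (A ! i) * t) - exp (- (B ! i) * t)"
      using i by (simp add: w_def algebra_simps)
  qed
  finally show ?thesis by (simp add: sum_subtractf)
qed

lemma prod_list_map_nth: "(\<Prod>x\<leftarrow>xs. g x) = (\<Prod>i<length xs. g (xs ! i))"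
  by (induction xs) (simp_all add: prod.lessThan_Suc_shift del: prod.lessThan_Suc)

lemma abs_exp_minus_1_le: "\<bar>exp y - 1\<bar> \<le> \<bar>y\<bar> * exp \<bar>y\<bar>" for y :: real
proof -
  have "1 - y \<le> exp (- y)" using exp_ge_add_one_self[of "- y"] by simp
  then have "(1 - y) * exp y \<le> exp (- y) * exp y" by (intro mult_right_mono) auto
  then have "exp y - 1 \<le> y * exp y" by (simp add: exp_minus algebra_simps)
  also have "\<dots> \<le> \<bar>y\<bar> * exp \<bar>y\<bar>" by (intro mult_mono) auto
  finally have "exp y - 1 \<le> \<bar>y\<bar> * exp \<bar>y\<bar>" .
  moreover have "- (\<bar>y\<bar> * exp \<bar>y\<bar>) \<le> exp y - 1"
  proof -
    have "\<bar>y\<bar> * 1 \<le> \<bar>y\<bar> * exp \<bar>y\<bar>" by (intro mult_left_mono) auto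
    then show ?thesis using exp_ge_add_one_self[of y] by linarith
  qed
  ultimately show ?thesis by linarith
qed

text \<open>The factor \<open>exp (s * (u - u))\<close> is left unsimplified so that both terms are
  values of one function, at \<open>t\<close> and at \<open>u\<close>.\<close>

lemma lipschitz_at_exp_mult:
  fixes h :: "real \<Rightarrow> real"
  assumes lip: "\<And>t. \<bar>t - u\<bar> < \<delta> \<Longrightarrow> \<bar>h t - h u\<bar> \<le> B * \<bar>t - u\<bar>" and s: "0 < s" and \<delta>: "\<delta> \<le> 1" "0 < \<delta>"
    and t: "\<bar>t - u\<bar> < \<delta>"
  shows "\<bar>exp (s * (u - t)) * h t - exp (s * (u - u)) * h u\<bar> \<le> (exp s * B + \<bar>h u\<bar> * s * exp s) * \<bar>t - u\<bar>"
proof -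
  have ab: "\<bar>s * (u - t)\<bar> = s * \<bar>t - u\<bar>" using s by (simp add: abs_mult abs_minus_commute)
  also have "\<dots> \<le> s * 1" using s t \<delta> by (intro mult_left_mono) auto
  finally have le: "\<bar>s * (u - t)\<bar> \<le> s" by simp
  have "exp (s * (u - t)) * \<bar>h t - h u\<bar> \<le> exp s * (B * \<bar>t - u\<bar>)"
    using le by (intro mult_mono lip t) auto
  moreover have "\<bar>exp (s * (u - t)) - 1\<bar> \<le> s * \<bar>t - u\<bar> * exp s"
  proof -
    have "\<bar>exp (s * (u - t)) - 1\<bar> \<le> \<bar>s * (u - t)\<bar> * exp \<bar>s * (u - t)\<bar>" by (rule abs_exp_minus_1_le)
    also have "\<dots> \<le> s * \<bar>t - u\<bar> * exp s" unfolding ab[symmetric] using le by (intro mult_left_mono) auto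
    finally show ?thesis .
  qed
  then have "\<bar>h u\<bar> * \<bar>exp (s * (u - t)) - 1\<bar> \<le> \<bar>h u\<bar> * (s * \<bar>t - u\<bar> * exp s)" by (intro mult_left_mono) auto
  moreover have "exp (s * (u - t)) * h t - exp (s * (u - u)) * h u = exp (s * (u - t)) * (h t - h u) + h u * (exp (s * (u - t)) - 1)"
    by (simp add: algebra_simps)
  then have "\<bar>exp (s * (u - t)) * h t - exp (s * (u - u)) * h u\<bar> \<le> exp (s * (u - t)) * \<bar>h t - h u\<bar> + \<bar>h u\<bar> * \<bar>exp (s * (u - t)) - 1\<bar>"
    using abs_triangle_ineq[of "exp (s * (u - t)) * (h t - h u)" "h u * (exp (s * (u - t)) - 1)"] by (simp add: abs_mult)
  ultimately show ?thesis by (simp add: algebra_simps)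
qed

text \<open>With \<open>x = exp (- t)\<close>, power moments on (0,1) become values of a Laplace
  transform. The substitution rule asks for a nonnegative derivative, so \<open>x = exp t\<close> is
  used on the negative half-line and \<open>t\<close> is reflected afterwards.\<close>

lemma exp_substitution:
  fixes h :: "real \<Rightarrow> real"
  assumes h: "h \<in> borel_measurable borel" "\<And>t. t \<le> 0 \<Longrightarrow> h t = 0" "\<And>t. 0 < t \<Longrightarrow> 0 < h t" "continuous_on {0<..} h"
    and int: "integrable lborel (\<lambda>t. exp (- s * t) * h t)"
  shows "set_integrable lborel {0<..<1} (\<lambda>x. x powr (s - 1) * h (- ln x))"
    and "(LINT x:{0<..<1}|lborel. x powr (s - 1) * h (- ln x)) = (LINT t|lborel. exp (- s * t) * h t)"
proof -
  let ?f = "\<lambda>x. x powr (s - 1) * h (- ln x)"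
  have ein: "einterval 0 1 = {0<..<1}" "einterval (-\<infinity>) 0 = {..<0}"
    by (auto simp: einterval_def)
  have eq: "indicator {..<0} t *\<^sub>R (?f (exp t) * exp t) = exp (- s * (- t)) * h (- t)" for t
  proof (cases "t < 0")
    case True
    have "?f (exp t) * exp t = exp ((s - 1) * t) * exp t * h (- t)"
      by (simp add: powr_def mult_ac)
    also have "exp ((s - 1) * t) * exp t = exp (s * t)" by (simp add: algebra_simps flip: exp_add)
    finally show ?thesis using True by simp
  qed (simp add: h)
  have int': "integrable lborel (\<lambda>t. exp (- s * (- t)) * h (- t))"
    using lborel_integrable_real_affine[OF int, of "-1" 0] by simp
  have sint: "set_integrable lborel (einterval (-\<infinity>) 0) (\<lambda>t. ?f (exp t) * exp t)"
    using int' by (simp only: ein set_integrable_def eq)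
  have cont: "isCont ?f (exp t)" if "t < 0" for t
  proof -
    have "isCont h (- ln (exp t))" using h(4) that by (simp add: continuous_on_eq_continuous_at)
    moreover have "isCont (\<lambda>x. - ln x) (exp t)" by (intro isCont_minus isCont_ln) simp
    ultimately have "isCont (\<lambda>x. h (- ln x)) (exp t)" by (intro isCont_o2[of "exp t" "\<lambda>x. - ln x" h])
    moreover have "isCont (\<lambda>x. x powr (s - 1)) (exp t)" by (rule DERIV_isCont[OF has_real_derivative_powr]) simp
    ultimately show ?thesis by (intro isCont_mult)
  qed
  have A: "((ereal \<circ> exp \<circ> real_of_ereal) \<longlongrightarrow> 0) (at_right (-\<infinity>))"
    unfolding zero_ereal_def ereal_tendsto_simps1 ereal_tendsto_simps2 by (rule exp_at_bot)
  have B: "((ereal \<circ> exp \<circ> real_of_ereal) \<longlongrightarrow> 1) (at_left 0)"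
    unfolding zero_ereal_def one_ereal_def ereal_tendsto_simps1 ereal_tendsto_simps2
    using tendsto_within_subset[OF isCont_exp[of "0::real", unfolded isCont_def], of "{..<0}"] by simp
  have nn: "0 \<le> ?f (exp t)" if "t < 0" for t using h(3)[of "- t"] that by simp
  note subst = interval_integral_substitution_nonneg[where f = ?f, OF _ DERIV_exp _ isCont_exp _ _ A B sint]
  have *: "set_integrable lborel (einterval 0 1) ?f"
    by (rule subst(1)) (use cont nn in auto)
  have **: "(LBINT x=0..1. ?f x) = (LBINT t=-\<infinity>..0. ?f (exp t) * exp t)"
    by (rule subst(2)) (use cont nn in auto)
  show "set_integrable lborel {0<..<1} ?f" using * by (simp add: ein)
  have "(LINT x:{0<..<1}|lborel. ?f x) = (LINT t|lborel. indicator {..<0} t *\<^sub>R (?f (exp t) * exp t))"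
    using ** by (simp add: interval_lebesgue_integral_def ein set_lebesgue_integral_def)
  also have "\<dots> = (LINT t|lborel. exp (- s * (- t)) * h (- t))" by (simp only: eq)
  also have "\<dots> = (LINT t|lborel. exp (- s * t) * h t)"
    using lborel_integral_real_affine[of "-1" "\<lambda>t. exp (- s * t) * h t" 0] by simp
  finally show "(LINT x:{0<..<1}|lborel. ?f x) = (LINT t|lborel. exp (- s * t) * h t)" .
qed

text \<open>On the line through \<gamma> the Gamma quotient is the Laplace transform of
  \<open>h\<close> at \<open>s + \<i> y\<close> with \<open>s = \<gamma> + \<kappa>\<close>, that
  is, the Fourier transform of \<open>exp (- s * t) * h t\<close>. With \<open>u = - ln x\<close>
  the power of \<open>x\<close> splits into \<open>x powr \<kappa>\<close> and the exponential of
  \<open>(s + \<i> y) * u\<close>. The truncated integral is thus a truncated Fourier inversion at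
  \<open>u\<close>.\<close>

lemma has_meijer_G_laplace:
  fixes h :: "real \<Rightarrow> real"
  assumes len: "length C = n" "length D = n"
    and int: "\<And>s. 0 < s \<Longrightarrow> integrable lborel (\<lambda>t. exp (- s * t) * h t)"
    and lip: "\<And>u. 0 < u \<Longrightarrow> \<exists>B. \<forall>t. \<bar>t - u\<bar> < u / 2 \<longrightarrow> \<bar>h t - h u\<bar> \<le> B * \<bar>t - u\<bar>"
    and lap: "\<And>z. 0 < Re z \<Longrightarrow> laplace h z =
      (\<Prod>i<n. Gamma (of_real (C ! i - Min (set C)) + z) / Gamma (of_real (D ! i - Min (set C)) + z))"
    and x: "x \<in> {0<..<1}"
  shows "has_meijer_G D C x (of_real (x powr Min (set C) * h (- ln x)))"
  unfolding has_meijer_G_def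
proof (intro allI impI)
  fix \<gamma> assume \<gamma>: "- Min (set C) < \<gamma>"
  define \<kappa> where "\<kappa> = Min (set C)"
  define s where "s = \<gamma> + \<kappa>"
  define u where "u = - ln x"
  have s: "0 < s" using \<gamma> by (simp add: s_def \<kappa>_def)
  have u: "0 < u" using x by (simp add: u_def)
  \<comment> \<open>Normalized so that \<open>F u = h u\<close> for every \<open>s\<close>; this
    makes the limit independent of \<gamma>.\<close>
  define F where "F t = exp (s * (u - t)) * h t" for t
  obtain B where B: "\<And>t. \<bar>t - u\<bar> < u / 2 \<Longrightarrow> \<bar>h t - h u\<bar> \<le> B * \<bar>t - u\<bar>" using lip[OF u] by blast
  define \<delta> where "\<delta> = min (u / 2) 1"
  have \<delta>: "\<delta> \<le> 1" "0 < \<delta>" "\<delta> \<le> u / 2" using u by (auto simp: \<delta>_def)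
  have F_lip: "\<bar>F t - F u\<bar> \<le> (exp s * B + \<bar>h u\<bar> * s * exp s) * \<bar>t - u\<bar>" if "\<bar>t - u\<bar> < \<delta>" for t
    unfolding F_def by (rule lipschitz_at_exp_mult[OF B s \<delta>(1,2) that]) (use \<delta> in auto)
  have "integrable lborel (\<lambda>t. exp (s * u) * (exp (- s * t) * h t))"
    by (intro integrable_mult_right int s)
  then have F_int: "integrable lborel F"
    unfolding F_def by (simp add: right_diff_distrib exp_diff exp_minus divide_inverse mult_ac)
  have lim: "((\<lambda>R. of_real (x powr \<kappa>) * (1 / (2 * of_real pi) *
      integral {-R..R} (\<lambda>y. LINT t|lborel. exp (\<i> * of_real y * of_real (u - t)) * of_real (F t)))) \<longlongrightarrow>
      of_real (x powr \<kappa>) * of_real (F u)) at_top"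
    by (intro tendsto_mult_left fourier_inversion[OF F_int \<delta>(2) F_lip])
  have "meijer_G_truncated D C x \<gamma> R = of_real (x powr \<kappa>) * (1 / (2 * of_real pi) *
      integral {-R..R} (\<lambda>y. LINT t|lborel. exp (\<i> * of_real y * of_real (u - t)) * of_real (F t)))" if R: "0 < R" for R
  proof -
    let ?g = "\<lambda>s. (\<Prod>c\<leftarrow>C. Gamma (of_real c + s)) / (\<Prod>d\<leftarrow>D. Gamma (of_real d + s)) * of_real x powr (- s)"
    have g: "?g (Complex \<gamma> y) = of_real (x powr \<kappa>) * (LINT t|lborel. exp (\<i> * of_real y * of_real (u - t)) * of_real (F t))" for y
    proof -
      let ?z = "Complex s y"
      have shift: "complex_of_real (e - \<kappa>) + ?z = of_real e + Complex \<gamma> y" for e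
        by (simp add: complex_eq_iff s_def)
      have "(\<Prod>c\<leftarrow>C. Gamma (of_real c + Complex \<gamma> y)) / (\<Prod>d\<leftarrow>D. Gamma (of_real d + Complex \<gamma> y)) = laplace h ?z"
        using s by (simp only: prod_list_map_nth len prod_dividef[symmetric] lap[of ?z] complex.sel \<kappa>_def[symmetric] shift)
      moreover have "of_real x powr (- Complex \<gamma> y) = exp (Complex \<gamma> y * of_real u)"
        using x by (simp add: powr_def u_def Ln_of_real algebra_simps)
      moreover have "exp (Complex \<gamma> y * of_real u) = of_real (x powr \<kappa>) * exp (?z * of_real u)"
      proof -
        have "x powr \<kappa> = exp (- \<kappa> * u)" using x by (simp add: powr_def u_def)
        then have "of_real (x powr \<kappa>) * exp (?z * of_real u) = exp (of_real (- \<kappa> * u) + ?z * of_real u)"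
          by (simp only: exp_of_real[symmetric] exp_add)
        also have "of_real (- \<kappa> * u) + ?z * of_real u = Complex \<gamma> y * of_real u"
          by (simp add: complex_eq_iff s_def algebra_simps)
        finally show ?thesis by simp
      qed
      moreover have "laplace h ?z * exp (?z * of_real u) = (LINT t|lborel. exp (\<i> * of_real y * of_real (u - t)) * of_real (F t))"
      proof -
        have "laplace h ?z * exp (?z * of_real u) = (LINT t|lborel. exp (- ?z * of_real t) * of_real (h t) * exp (?z * of_real u))"
          unfolding laplace_def by (rule integral_mult_left_zero[symmetric])
        also have "\<dots> = (LINT t|lborel. exp (\<i> * of_real y * of_real (u - t)) * of_real (F t))"
        proof (intro Bochner_Integration.integral_cong refl)
          fix t
          have "exp (- ?z * of_real t) * exp (?z * of_real u) = exp (\<i> * of_real y * of_real (u - t) + of_real (s * (u - t)))"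
            unfolding exp_add[symmetric] by (intro arg_cong[of _ _ exp]) (simp add: complex_eq_iff algebra_simps)
          also have "\<dots> = exp (\<i> * of_real y * of_real (u - t)) * of_real (exp (s * (u - t)))"
            by (simp only: exp_add exp_of_real)
          finally have e: "exp (- ?z * of_real t) * exp (?z * of_real u) = exp (\<i> * of_real y * of_real (u - t)) * of_real (exp (s * (u - t)))" .
          show "exp (- ?z * of_real t) * of_real (h t) * exp (?z * of_real u) = exp (\<i> * of_real y * of_real (u - t)) * of_real (F t)"
            unfolding F_def of_real_mult mult.assoc[symmetric] e[symmetric] by (simp only: mult_ac)
        qed
        finally show ?thesis .
      qed
      ultimately show ?thesis by (simp only: mult_ac)
    qed
    have "contour_integral (linepath (Complex \<gamma> (- R)) (Complex \<gamma> R)) ?g = \<i> * integral {-R..R} (\<lambda>y. ?g (Complex \<gamma> y))"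
      using R by (intro contour_integral_linepath_same_Re) auto
    then show ?thesis unfolding meijer_G_truncated_def g by simp
  qed
  then have "\<forall>\<^sub>F R in at_top. of_real (x powr \<kappa>) * (1 / (2 * of_real pi) *
      integral {-R..R} (\<lambda>y. LINT t|lborel. exp (\<i> * of_real y * of_real (u - t)) * of_real (F t))) = meijer_G_truncated D C x \<gamma> R"
    by (intro eventually_mono[OF eventually_gt_at_top[of 0]]) simp
  from Lim_transform_eventually[OF lim this]
  show "(meijer_G_truncated D C x \<gamma> \<longlongrightarrow> of_real (x powr Min (set C) * h (- ln x))) at_top"
    by (simp add: \<kappa>_def F_def u_def)
qed

text \<open>At least one abscissa is admissible, so uniqueness of limits determines the
  value.\<close>

lemma meijer_G_eqI:
  assumes "has_meijer_G D C x v"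
  shows "meijer_G D C x = v"
  unfolding meijer_G_def
proof (rule the_equality[of "has_meijer_G D C x", OF assms])
  fix v' assume "has_meijer_G D C x v'"
  moreover have "- Min (set C) < - Min (set C) + 1" by simp
  ultimately show "v' = v"
    using assms tendsto_unique[of at_top] unfolding has_meijer_G_def by (metis trivial_limit_at_top_linorder)
qed

subsection \<open>Pade approximants and orthogonal polynomials\<close>

text \<open>Induction on the order: a nonzero constant coefficient is a nonzero limit at 0, and a
  zero one allows division by \<open>z\<close>.\<close>

lemma poly_in_bigo_power_iff:
  fixes p :: "complex poly"
  shows "poly p \<in> O[at 0](\<lambda>z. z ^ N) \<longleftrightarrow> (\<forall>i<N. coeff p i = 0)"
proof (induction N arbitrary: p)
  case 0
  have "((\<lambda>z. poly p z / z ^ 0) \<longlongrightarrow> poly p 0) (at 0)"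
    using poly_isCont[of 0 p] by (simp add: isCont_def)
  then have "poly p \<in> O[at 0](\<lambda>z. z ^ 0)" by (rule bigoI_tendsto) simp
  then show ?case by simp
next
  case (Suc N)
  obtain c r where p: "p = pCons c r" by (cases p)
  have ev: "\<forall>\<^sub>F z::complex in at 0. z \<noteq> 0" by (simp add: eventually_at_filter)
  show ?case
  proof (cases "c = 0")
    case True
    have "poly p \<in> O[at 0](\<lambda>z. z ^ Suc N) \<longleftrightarrow> poly r \<in> O[at 0](\<lambda>z. z ^ N)"
    proof -
      have "poly p = (\<lambda>z. z * poly r z)" by (auto simp: p True)
      then show ?thesis using landau_o.big.mult_cancel_left[of "\<lambda>z. z" "at 0" "\<lambda>z. z" "poly r" "\<lambda>z. z ^ N"] ev by simp
    qed
    also have "\<dots> \<longleftrightarrow> (\<forall>i<Suc N. coeff p i = 0)"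
      unfolding Suc.IH by (auto simp: p True coeff_pCons less_Suc_eq_0_disj split: nat.splits)
    finally show ?thesis .
  next
    case False
    have "poly p \<notin> O[at 0](\<lambda>z. z ^ Suc N)"
    proof
      assume "poly p \<in> O[at 0](\<lambda>z. z ^ Suc N)"
      then obtain K where K: "\<forall>\<^sub>F z in at 0. norm (poly p z) \<le> K * norm (z ^ Suc N)"
        by (auto elim: landau_o.bigE)
      have "((\<lambda>z::complex. K * norm (z ^ Suc N)) \<longlongrightarrow> K * norm ((0::complex) ^ Suc N)) (at 0)"
        by (intro tendsto_mult tendsto_const tendsto_norm tendsto_power tendsto_ident_at)
      moreover have "((\<lambda>z. norm (poly p z)) \<longlongrightarrow> norm (poly p 0)) (at 0)"
        using poly_isCont[of 0 p] by (intro tendsto_norm) (simp add: isCont_def)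
      ultimately have "norm (poly p 0) \<le> K * norm ((0::complex) ^ Suc N)"
        using K by (intro tendsto_le[of "at 0"]) auto
      then show False using False by (simp add: p)
    qed
    moreover have "coeff p 0 \<noteq> 0" using False by (simp add: p)
    ultimately show ?thesis by blast
  qed
qed

lemma coeff_mult_eq_0_low:
  assumes "\<forall>i<N. coeff p i = 0" "i < N"
  shows "coeff (p * q) i = 0"
  unfolding coeff_mult using assms by (intro sum.neutral) auto

definition truncation :: "(nat \<Rightarrow> complex) \<Rightarrow> nat \<Rightarrow> complex poly" where
  "truncation a N = (\<Sum>i<N. monom (a i) i)"

lemma coeff_truncation: "coeff (truncation a N) i = (if i < N then a i else 0)"
  by (simp add: truncation_def coeff_sum coeff_monom sum.delta)

lemma power_series_truncation:
  fixes f :: "complex \<Rightarrow> complex"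
  assumes r: "0 < r" and f: "\<And>z. norm z < r \<Longrightarrow> f z = (\<Sum>n. a n * z ^ n)"
    and sm: "\<And>z. norm z < r \<Longrightarrow> summable (\<lambda>n. a n * z ^ n)"
  shows "(\<lambda>z. f z - poly (truncation a N) z) \<in> O[at 0](\<lambda>z. z ^ N)"
proof (rule bigoI_tendsto)
  define g where "g z = (\<Sum>n. a (n + N) * z ^ n)" for z
  define \<rho> where "\<rho> = complex_of_real (r / 2)"
  have \<rho>: "norm \<rho> < r" "0 < norm \<rho>" using r by (auto simp: \<rho>_def)
  have shift: "summable (\<lambda>n. a (n + N) * z ^ n)" if z: "norm z < r" "z \<noteq> 0" for z
  proof (rule summable_mult_D)
    have "summable (\<lambda>n. a (n + N) * z ^ (n + N))"
      by (subst summable_iff_shift) (rule sm[OF z(1)])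
    then show "summable (\<lambda>n. z ^ N * (a (n + N) * z ^ n))" by (simp add: power_add mult_ac)
  qed (use z in simp)
  have "summable (\<lambda>n. a (n + N) * \<rho> ^ n)" using shift[of \<rho>] \<rho> by auto
  then have "isCont g 0"
    unfolding g_def by (rule isCont_powser) (use \<rho> in simp)
  then have "(g \<longlongrightarrow> g 0) (at 0)" by (simp add: isCont_def)
  then show "((\<lambda>z. (f z - poly (truncation a N) z) / z ^ N) \<longlongrightarrow> g 0) (at 0)"
  proof (rule Lim_transform_eventually)
    have "\<forall>\<^sub>F z in at 0. norm z < r \<and> z \<noteq> (0::complex)"
      unfolding eventually_at using r by (intro exI[of _ r]) auto
    then show "\<forall>\<^sub>F z in at 0. g z = (f z - poly (truncation a N) z) / z ^ N"
    proof eventually_elim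
      case (elim z)
      have s: "summable (\<lambda>n. a (n + N) * z ^ n)" using shift[of z] elim by simp
      have "f z = (\<Sum>n. a (n + N) * z ^ (n + N)) + (\<Sum>n<N. a n * z ^ n)"
        using elim by (simp add: f suminf_split_initial_segment[OF sm[of z], of N])
      also have "(\<Sum>n. a (n + N) * z ^ (n + N)) = g z * z ^ N"
        unfolding g_def by (subst suminf_mult2[OF s]) (simp add: power_add mult.assoc)
      also have "(\<Sum>n<N. a n * z ^ n) = poly (truncation a N) z"
        by (simp add: truncation_def poly_sum poly_monom)
      finally show ?case using elim by simp
    qed
  qed
qed (rule eventually_mono[OF eventually_neq_at_within[of 0]], simp)

locale power_series_at_0 =
  fixes f :: "complex \<Rightarrow> complex" and a :: "nat \<Rightarrow> complex" and r :: real
  assumes r_pos: "0 < r" and f_eq: "\<And>z. norm z < r \<Longrightarrow> f z = (\<Sum>n. a n * z ^ n)"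
    and summable_f: "\<And>z. norm z < r \<Longrightarrow> summable (\<lambda>n. a n * z ^ n)"
begin

text \<open>The analytic order condition becomes a finite set of linear equations between
  coefficients; the tail of the series beyond order \<open>N\<close> cannot affect them.\<close>

lemma pade_pair_iff:
  fixes k :: int and n :: nat
  defines "N \<equiv> nat (k + int n + 1)"
  shows "pade_pair f k n P Q \<longleftrightarrow>
    Q \<noteq> 0 \<and> (P = 0 \<or> int (degree P) \<le> k) \<and> degree Q \<le> n \<and> (\<forall>i<N. coeff (truncation a N * Q - P) i = 0)"
proof -
  let ?T = "truncation a N"
  have "poly Q \<in> O[at 0](\<lambda>_. 1)" using poly_in_bigo_power_iff[of Q 0] by simp
  with power_series_truncation[OF r_pos f_eq summable_f, of N]
  have "(\<lambda>z. (f z - poly ?T z) * poly Q z) \<in> O[at 0](\<lambda>z. z ^ N * 1)"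
    by (rule landau_o.big.mult)
  then have rem: "(\<lambda>z. (f z - poly ?T z) * poly Q z) \<in> O[at 0](\<lambda>z. z ^ N)" by simp
  have "(\<lambda>z. f z * poly Q z - poly P z) \<in> O[at 0](\<lambda>z. z ^ N) \<longleftrightarrow> poly (?T * Q - P) \<in> O[at 0](\<lambda>z. z ^ N)"
  proof
    assume "(\<lambda>z. f z * poly Q z - poly P z) \<in> O[at 0](\<lambda>z. z ^ N)"
    from sum_in_bigo(2)[OF this rem] have "(\<lambda>z. f z * poly Q z - poly P z - (f z - poly ?T z) * poly Q z) \<in> O[at 0](\<lambda>z. z ^ N)" .
    also have "(\<lambda>z. f z * poly Q z - poly P z - (f z - poly ?T z) * poly Q z) = poly (?T * Q - P)"
      by (rule ext) (simp add: algebra_simps)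
    finally show "poly (?T * Q - P) \<in> O[at 0](\<lambda>z. z ^ N)" .
  next
    assume "poly (?T * Q - P) \<in> O[at 0](\<lambda>z. z ^ N)"
    from sum_in_bigo(1)[OF this rem] show "(\<lambda>z. f z * poly Q z - poly P z) \<in> O[at 0](\<lambda>z. z ^ N)"
      by (simp add: algebra_simps)
  qed
  then show ?thesis unfolding pade_pair_def N_def[symmetric] by (simp only: poly_in_bigo_power_iff)
qed

text \<open>Coefficients of the difference below \<open>N\<close> vanish by the two order
  conditions, those from \<open>N = k + n + 1\<close> on because both products have degree at most
  \<open>k + n\<close>.\<close>

lemma pade_pair_cross:
  assumes 1: "pade_pair f k n P1 Q1" and 2: "pade_pair f k n P2 Q2" and k: "-1 \<le> k"
  shows "P1 * Q2 = P2 * Q1"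
proof -
  define N where "N = nat (k + int n + 1)"
  let ?T = "truncation a N"
  have low1: "\<forall>i<N. coeff (?T * Q1 - P1) i = 0" and low2: "\<forall>i<N. coeff (?T * Q2 - P2) i = 0"
    using 1 2 by (auto simp: pade_pair_iff N_def)
  have high: "coeff (P * Q) i = 0" if "pade_pair f k n P Q'" "pade_pair f k n P' Q" "N \<le> i" for P Q P' Q' i
  proof (cases "P = 0")
    case False
    then have "int (degree P) \<le> k" "degree Q \<le> n" using that by (auto simp: pade_pair_def)
    then have "degree (P * Q) < i" using degree_mult_le[of P Q] that(3) unfolding N_def by linarith
    then show ?thesis by (rule coeff_eq_0)
  qed simp
  have "coeff (P1 * Q2 - P2 * Q1) i = 0" for i
  proof (cases "i < N")
    case True
    have "P1 * Q2 - P2 * Q1 = (?T * Q2 - P2) * Q1 - (?T * Q1 - P1) * Q2"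
      by (simp add: algebra_simps)
    then show ?thesis
      using coeff_mult_eq_0_low[OF low1 True] coeff_mult_eq_0_low[OF low2 True] by simp
  next
    case False
    then show ?thesis using high[OF 1 2] high[OF 2 1] by simp
  qed
  then have "P1 * Q2 - P2 * Q1 = 0" by (simp add: poly_eq_iff)
  then show ?thesis by simp
qed

lemma pade_approximant_unique:
  assumes "-1 \<le> k" "pade_pair f k n P Q"
  shows "is_pade_approximant f k n R \<longleftrightarrow> R = Fract P Q"
proof
  assume "is_pade_approximant f k n R"
  then obtain P' Q' where "pade_pair f k n P' Q'" "R = Fract P' Q'"
    by (auto simp: is_pade_approximant_def)
  then show "R = Fract P Q"
    using pade_pair_cross[of k n P' Q' P Q] assms by (simp add: eq_fract pade_pair_def)
qed (use assms in \<open>auto simp: is_pade_approximant_def\<close>)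

text \<open>The coefficients of the series times \<open>Q\<close> up to index \<open>k\<close> form
  the numerator; the order condition asks for nothing more than zeros at the next \<open>n\<close>
  indices. For \<open>k = -1\<close> the cutoff yields the numerator 0.\<close>

lemma pade_denominator:
  assumes k: "-1 \<le> k" and Q: "Q \<noteq> 0" "degree Q \<le> n"
    and gap: "\<And>i. k < int i \<Longrightarrow> int i \<le> k + int n \<Longrightarrow> coeff (truncation a (nat (k + int n + 1)) * Q) i = 0"
  shows "\<exists>!P. pade_pair f k n P Q"
proof (rule ex_ex1I)
  define N where "N = nat (k + int n + 1)"
  let ?P = "poly_cutoff (nat (k + 1)) (truncation a N * Q)"
  have "?P = 0 \<or> int (degree ?P) \<le> k"
  proof (cases "?P = 0")
    case False
    then have "coeff ?P (degree ?P) \<noteq> 0" by simp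
    then have "degree ?P < nat (k + 1)" by (auto simp: coeff_poly_cutoff split: if_splits)
    then show ?thesis by linarith
  qed simp
  moreover have "coeff (truncation a N * Q - ?P) i = 0" if "i < N" for i
    using gap[of i] that k by (auto simp: coeff_poly_cutoff N_def)
  ultimately show "\<exists>P. pade_pair f k n P Q"
    using Q by (intro exI[of _ ?P]) (simp add: pade_pair_iff N_def)
  show "P1 = P2" if "pade_pair f k n P1 Q" "pade_pair f k n P2 Q" for P1 P2
    using pade_pair_cross[OF that k] Q by simp
qed

end

section \<open>Orthogonality with respect to a positive functional\<close>

locale positive_functional =
  fixes \<Lambda> :: "real poly \<Rightarrow> real"
  assumes add: "\<Lambda> (p + r) = \<Lambda> p + \<Lambda> r" and smult: "\<Lambda> (smult c p) = c * \<Lambda> p"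
    and pos: "p \<noteq> 0 \<Longrightarrow> 0 < \<Lambda> (p * p)"
begin

lemma zero: "\<Lambda> 0 = 0"
  using smult[of 0 0] by simp

lemma diff: "\<Lambda> (p - r) = \<Lambda> p - \<Lambda> r"
  using add[of p "smult (-1) r"] smult[of "-1" r] by simp

lemma sum: "\<Lambda> (\<Sum>i\<in>A. g i) = (\<Sum>i\<in>A. \<Lambda> (g i))"
  by (induction A rule: infinite_finite_induct) (auto simp: zero add)

fun gram_schmidt :: "nat \<Rightarrow> real poly" where
  "gram_schmidt m = monom 1 m -
     (\<Sum>i<m. smult (\<Lambda> (monom 1 m * gram_schmidt i) / \<Lambda> (gram_schmidt i * gram_schmidt i)) (gram_schmidt i))"

declare gram_schmidt.simps [simp del]

lemma degree_gram_schmidt: "gram_schmidt m \<noteq> 0 \<and> degree (gram_schmidt m) = m"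
proof (induction m rule: less_induct)
  case (less m)
  let ?s = "\<Sum>i<m. smult (\<Lambda> (monom 1 m * gram_schmidt i) / \<Lambda> (gram_schmidt i * gram_schmidt i)) (gram_schmidt i)"
  have "coeff ?s i = 0" if "m \<le> i" for i
    unfolding coeff_sum using less that by (intro sum.neutral) (auto intro!: coeff_eq_0)
  then have c: "coeff (gram_schmidt m) i = (if i = m then 1 else 0)" if "m \<le> i" for i
    using that by (subst gram_schmidt.simps) auto
  have "degree (gram_schmidt m) \<le> m" using c by (intro degree_le) auto
  moreover have "m \<le> degree (gram_schmidt m)" using c[of m] by (intro le_degree) auto
  moreover have "gram_schmidt m \<noteq> 0" using c[of m] by auto
  ultimately show ?case by simp
qed

lemma gram_schmidt_orthogonal_less:
  "n < m \<Longrightarrow> \<Lambda> (gram_schmidt m * gram_schmidt n) = 0"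
proof (induction m arbitrary: n rule: less_induct)
  case (less m)
  let ?g = "gram_schmidt"
  let ?c = "\<lambda>i. \<Lambda> (monom 1 m * ?g i) / \<Lambda> (?g i * ?g i)"
  have ortho: "\<Lambda> (?g i * ?g n) = 0" if "i < m" "i \<noteq> n" for i
    using less.IH[of i n] less.IH[of n i] less.prems that by (cases "i < n") (auto simp: mult.commute)
  have "\<Lambda> (?g m * ?g n) = \<Lambda> (monom 1 m * ?g n) - (\<Sum>i<m. ?c i * \<Lambda> (?g i * ?g n))"
    by (subst gram_schmidt.simps) (simp add: left_diff_distrib sum_distrib_right diff sum smult)
  also have "(\<Sum>i<m. ?c i * \<Lambda> (?g i * ?g n)) = (\<Sum>i<m. if i = n then ?c n * \<Lambda> (?g n * ?g n) else 0)"
    using ortho by (intro sum.cong) auto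
  also have "\<dots> = \<Lambda> (monom 1 m * ?g n)"
    using less.prems pos[of "?g n"] degree_gram_schmidt[of n] by simp
  finally show ?case by simp
qed

lemma gram_schmidt_orthogonal: "m \<noteq> n \<Longrightarrow> \<Lambda> (gram_schmidt m * gram_schmidt n) = 0"
  using gram_schmidt_orthogonal_less[of n m] gram_schmidt_orthogonal_less[of m n]
  by (cases "n < m") (auto simp: mult.commute)

text \<open>Strong induction on the degree: a multiple of the family member of the same degree
  removes the leading term. The family is arbitrary because the final statement concerns every
  orthogonal family.\<close>

lemma orthogonal_lower_degree:
  assumes \<pi>: "\<And>m. \<pi> m \<noteq> 0 \<and> degree (\<pi> m) = m" and ortho: "\<And>m n. m \<noteq> n \<Longrightarrow> \<Lambda> (\<pi> m * \<pi> n) = 0"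
  shows "degree p < m \<Longrightarrow> \<Lambda> (\<pi> m * p) = 0"
proof (induction "degree p" arbitrary: p rule: less_induct)
  case less
  let ?d = "degree p"
  define p' where "p' = p - smult (lead_coeff p / lead_coeff (\<pi> ?d)) (\<pi> ?d)"
  have p: "p = p' + smult (lead_coeff p / lead_coeff (\<pi> ?d)) (\<pi> ?d)" by (simp add: p'_def)
  have "\<Lambda> (\<pi> m * p') = 0"
  proof (cases "p' = 0")
    case False
    have "coeff p' ?d = 0" using \<pi>[of ?d] leading_coeff_0_iff[of "\<pi> ?d"] by (simp add: p'_def)
    moreover have "degree p' \<le> ?d" unfolding p'_def
      using \<pi>[of ?d] by (intro degree_diff_le) (auto intro: order.trans[OF degree_smult_le])
    ultimately have "degree p' < ?d" using False by (metis le_neq_implies_less leading_coeff_0_iff)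
    then show ?thesis using less by simp
  qed (simp add: zero)
  moreover have "\<Lambda> (\<pi> m * \<pi> ?d) = 0" using less.prems by (intro ortho) auto
  ultimately show ?case by (subst p) (simp add: distrib_left add smult)
qed

end

text \<open>\<open>g\<close> is the real representative of the complex weight \<open>w\<close>. They
  are compared on (0,1) only, the set over which all the integrals run.\<close>

locale unit_interval_weight =
  fixes g :: "real \<Rightarrow> real" and w :: "real \<Rightarrow> complex"
  assumes g_pos: "\<And>x. x \<in> {0<..<1} \<Longrightarrow> 0 < g x"
    and g_int: "\<And>i. set_integrable lborel {0<..<1} (\<lambda>x. x ^ i * g x)"
    and w_eq: "\<And>x. x \<in> {0<..<1} \<Longrightarrow> w x = of_real (g x)"
begin

definition \<Lambda> :: "real poly \<Rightarrow> real" where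
  "\<Lambda> p = (LINT x:{0<..<1}|lborel. poly p x * g x)"

lemma integrable_poly: "set_integrable lborel {0<..<1} (\<lambda>x. poly p x * g x)"
proof -
  have "set_integrable lborel {0<..<1} (\<lambda>x. \<Sum>i\<le>degree p. coeff p i * (x ^ i * g x))"
    using g_int unfolding set_integrable_def scaleR_sum_right
    by (intro Bochner_Integration.integrable_sum) (simp add: mult.left_commute)
  then show ?thesis by (simp add: poly_altdef sum_distrib_right mult.assoc)
qed

text \<open>If the integral were 0, the integrand would vanish almost everywhere; but on (0,1) it
  vanishes at the finitely many roots of \<open>p\<close> only.\<close>

lemma \<Lambda>_pos:
  assumes "p \<noteq> 0"
  shows "0 < \<Lambda> (p * p)"
proof -
  let ?f = "\<lambda>x. indicator {0<..<1} x *\<^sub>R (poly (p * p) x * g x)"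
  have int: "integrable lborel ?f" using integrable_poly[of "p * p"] by (simp add: set_integrable_def)
  have nonneg: "0 \<le> ?f x" for x
  proof (cases "x \<in> {0<..<1}")
    case True
    then show ?thesis using mult_nonneg_nonneg[OF zero_le_square less_imp_le[OF g_pos[OF True]]] by simp
  qed simp
  have "0 \<le> \<Lambda> (p * p)"
    unfolding \<Lambda>_def set_lebesgue_integral_def by (intro Bochner_Integration.integral_nonneg nonneg)
  moreover have "\<Lambda> (p * p) \<noteq> 0"
  proof
    assume "\<Lambda> (p * p) = 0"
    then have "AE x in lborel. ?f x = 0"
      unfolding \<Lambda>_def set_lebesgue_integral_def
      using integral_nonneg_eq_0_iff_AE[OF int] nonneg by simp
    moreover have "AE x in lborel. x \<notin> {x. poly p x = 0}"
      by (intro AE_not_in finite_imp_null_set_lborel poly_roots_finite assms)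
    ultimately have "AE x in lborel. x \<notin> {0<..<1::real}"
    proof eventually_elim
      case (elim x)
      then show ?case using g_pos[of x] by (auto simp: indicator_def)
    qed
    then have "emeasure lborel {0<..<1::real} = 0"
      by (subst (asm) AE_iff_measurable[of "{0<..<1}"]) auto
    then show False by simp
  qed
  ultimately show ?thesis by simp
qed

sublocale positive_functional \<Lambda>
proof
  show "\<Lambda> (p + r) = \<Lambda> p + \<Lambda> r" for p r
    unfolding \<Lambda>_def using set_integral_add(2)[OF integrable_poly[of p] integrable_poly[of r]]
    by (simp add: distrib_right)
  show "\<Lambda> (smult c p) = c * \<Lambda> p" for c p
    unfolding \<Lambda>_def by (simp add: mult.assoc)
qed (rule \<Lambda>_pos)

lemma weighted_product_eq: "weighted_product w p r = of_real (\<Lambda> (p * r))"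
proof -
  have "weighted_product w p r = (LINT x|lborel. of_real (indicator {0<..<1} x *\<^sub>R (poly (p * r) x * g x)))"
    unfolding weighted_product_def set_lebesgue_integral_def
    by (intro Bochner_Integration.integral_cong) (auto simp: indicator_def w_eq)
  also have "\<dots> = of_real (\<Lambda> (p * r))"
    unfolding \<Lambda>_def set_lebesgue_integral_def by (rule integral_complex_of_real)
  finally show ?thesis .
qed

lemma is_inner_product_weight: "is_inner_product_weight w"
  unfolding is_inner_product_weight_def weighted_product_eq
proof (intro conjI allI impI)
  fix p
  have "integrable lborel (\<lambda>x. complex_of_real (indicator {0<..<1} x *\<^sub>R (poly p x * g x)))"
    using integrable_poly[of p] unfolding set_integrable_def by (rule integrable_of_real)
  also have "(\<lambda>x. complex_of_real (indicator {0<..<1} x *\<^sub>R (poly p x * g x))) =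
      (\<lambda>x. indicator {0<..<1} x *\<^sub>R (of_real (poly p x) * w x))"
    by (auto simp: indicator_def w_eq)
  finally show "set_integrable lborel {0<..<1} (\<lambda>x. of_real (poly p x) * w x)"
    by (simp only: set_integrable_def)
qed (auto simp: \<Lambda>_pos)

lemma orthogonal_polys_gram_schmidt: "orthogonal_polys w gram_schmidt"
  unfolding orthogonal_polys_def weighted_product_eq
  using degree_gram_schmidt gram_schmidt_orthogonal
  by (auto intro!: exI[of _ "\<lambda>m. of_real (\<Lambda> (gram_schmidt m * gram_schmidt m))"])

lemma orthogonal_polys_lower_degree:
  assumes "orthogonal_polys w \<pi>" "degree p < m"
  shows "\<Lambda> (\<pi> m * p) = 0"
proof (rule orthogonal_lower_degree[OF _ _ assms(2)])
  show "\<pi> m \<noteq> 0 \<and> degree (\<pi> m) = m" for m using assms by (auto simp: orthogonal_polys_def)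
  show "\<Lambda> (\<pi> m * \<pi> n) = 0" if "m \<noteq> n" for m n
  proof -
    obtain h where "\<And>m n. weighted_product w (\<pi> m) (\<pi> n) = (if m = n then h m else 0)"
      using assms(1) by (auto simp: orthogonal_polys_def)
    then have "weighted_product w (\<pi> m) (\<pi> n) = 0" using that by simp
    then show ?thesis by (simp add: weighted_product_eq)
  qed
qed

lemma \<Lambda>_mult_monom: 
  assumes "degree p = m"
  shows "\<Lambda> (p * monom 1 l) = (\<Sum>i\<le>m. coeff p i * \<Lambda> (monom 1 (i + l)))"
proof -
  have "p * monom 1 l = (\<Sum>i\<le>m. smult (coeff p i) (monom 1 (i + l)))"
    by (subst (1) poly_as_sum_of_monoms[symmetric])
       (simp add: assms sum_distrib_right mult_monom smult_monom)
  then show ?thesis by (simp only: sum smult)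
qed

end

text \<open>The polynomial \<open>(- z) ^ m * p (- 1 / z)\<close> with \<open>m = degree p\<close>:
  coefficients in reverse order with alternating signs. Its constant term is the leading coefficient
  of \<open>p\<close>.\<close>

definition reversed_denominator :: "real poly \<Rightarrow> complex poly" where
  "reversed_denominator p = (\<Sum>e\<le>degree p. monom (of_real (coeff p (degree p - e)) * (-1) ^ e) e)"

lemma coeff_reversed_denominator:
  "coeff (reversed_denominator p) e = (if e \<le> degree p then of_real (coeff p (degree p - e)) * (-1) ^ e else 0)"
  by (simp add: reversed_denominator_def coeff_sum coeff_monom sum.delta)

lemma poly_reversed_denominator:
  assumes "z \<noteq> 0"
  shows "poly (reversed_denominator p) z = (- z) ^ degree p * poly (map_poly complex_of_real p) (- 1 / z)"
proof -
  let ?m = "degree p"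
  have "(- z) ^ ?m * poly (map_poly complex_of_real p) (- 1 / z) = (\<Sum>i\<le>?m. of_real (coeff p i) * ((- z) ^ ?m * (- 1 / z) ^ i))"
    by (simp add: poly_altdef degree_map_poly coeff_map_poly sum_distrib_left mult_ac)
  also have "\<dots> = (\<Sum>i\<le>?m. of_real (coeff p i) * (- z) ^ (?m - i))"
  proof (intro sum.cong refl arg_cong2[of _ _ _ _ "(*)"])
    fix i assume i: "i \<in> {..?m}"
    have "(- 1 / z) = inverse (- z)" by (simp add: field_simps)
    moreover have "(- z) ^ ?m = (- z) ^ (?m - i) * (- z) ^ i" using i by (simp flip: power_add)
    ultimately show "(- z) ^ ?m * (- 1 / z) ^ i = (- z) ^ (?m - i)"
      using assms by (simp add: mult.assoc flip: power_mult_distrib)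
  qed
  also have "\<dots> = (\<Sum>e\<le>?m. of_real (coeff p (?m - e)) * (- z) ^ e)"
    by (rule sum.reindex_bij_witness[of _ "\<lambda>i. ?m - i" "\<lambda>i. ?m - i"]) auto
  also have "\<dots> = poly (reversed_denominator p) z"
    unfolding reversed_denominator_def poly_sum poly_monom
    by (intro sum.cong refl) (simp add: power_minus[of z])
  finally show ?thesis by simp
qed

text \<open>The signs of the denominator and of a series in \<open>- z\<close> combine to the common
  factor \<open>(-1) ^ i\<close>. What remains is the moment functional of \<open>M\<close> applied
  to \<open>p\<close> times a power with exponent \<open>i - degree p\<close>.\<close>

lemma coeff_truncation_mult_reversed:
  fixes M :: "nat \<Rightarrow> real"
  assumes a: "\<And>n. a n = (-1) ^ n * of_real (c * M n)" and i: "degree p \<le> i" "i < N"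
  shows "coeff (truncation a N * reversed_denominator p) i =
    (-1) ^ i * of_real (c * (\<Sum>e\<le>degree p. coeff p e * M (e + (i - degree p))))"
proof -
  let ?m = "degree p"
  have "coeff (truncation a N * reversed_denominator p) i =
      (\<Sum>e\<le>i. coeff (reversed_denominator p) e * coeff (truncation a N) (i - e))"
    by (simp add: mult.commute[of "truncation a N"] coeff_mult)
  also have "\<dots> = (\<Sum>e\<le>?m. coeff (reversed_denominator p) e * coeff (truncation a N) (i - e))"
    using i by (intro sum.mono_neutral_right) (auto simp: coeff_reversed_denominator)
  also have "\<dots> = (\<Sum>e\<le>?m. (-1) ^ i * of_real (c * (coeff p (?m - e) * M (i - e))))"
  proof (intro sum.cong refl)
    fix e assume e: "e \<in> {..?m}"
    have "(-1) ^ e * (-1) ^ (i - e) = ((-1) ^ i :: complex)"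
      using e i by (simp flip: power_add)
    then show "coeff (reversed_denominator p) e * coeff (truncation a N) (i - e) = (-1) ^ i * of_real (c * (coeff p (?m - e) * M (i - e)))"
      using e i by (simp add: coeff_reversed_denominator coeff_truncation a mult_ac)
  qed
  also have "\<dots> = (-1) ^ i * of_real (c * (\<Sum>e\<le>?m. coeff p (?m - e) * M (i - e)))"
    by (simp only: sum_distrib_left of_real_sum of_real_mult)
  also have "(\<Sum>e\<le>?m. coeff p (?m - e) * M (i - e)) = (\<Sum>e\<le>?m. coeff p e * M (e + (i - ?m)))"
    using i by (intro sum.reindex_bij_witness[of _ "\<lambda>i. ?m - i" "\<lambda>i. ?m - i"]) auto
  finally show ?thesis .
qed

text \<open>The factorial is the Pochhammer symbol of 1, which accounts for the extra parameter 1 in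
  front of \<open>B\<close>.\<close>

lemma hypergeometric_coeff_Gamma:
  assumes "length B = length A" and pos: "\<And>x. x \<in> set (\<sigma> # A) \<union> set B \<Longrightarrow> 0 < x"
  shows "hypergeometric_coeff (\<sigma> # A) B n =
    (\<Prod>i\<le>length A. Gamma ((1 # B) ! i) / Gamma ((\<sigma> # A) ! i)) *
    (\<Prod>i\<le>length A. Gamma ((\<sigma> # A) ! i + real n) / Gamma ((1 # B) ! i + real n))"
proof -
  let ?C = "\<sigma> # A" and ?D = "1 # B"
  have g: "pochhammer x n = Gamma (x + real n) / Gamma x" "Gamma x \<noteq> 0" if "0 < x" for x :: real
  proof -
    have "x \<notin> \<int>\<^sub>\<le>\<^sub>0" using that by (auto elim!: nonpos_Ints_cases)
    then show "pochhammer x n = Gamma (x + real n) / Gamma x" "Gamma x \<noteq> 0"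
      by (auto simp: pochhammer_Gamma Gamma_eq_zero_iff)
  qed
  have posi: "0 < ?C ! i" "0 < ?D ! i" if "i \<le> length A" for i
    using that assms nth_mem[of i ?C] nth_mem[of "i - 1" B] by (cases i; force)+
  have "hypergeometric_coeff ?C B n = (\<Prod>c\<leftarrow>?C. pochhammer c n) / (\<Prod>d\<leftarrow>?D. pochhammer d n)"
    by (simp add: hypergeometric_coeff_def pochhammer_fact mult.commute)
  also have "\<dots> = (\<Prod>i\<le>length A. pochhammer (?C ! i) n / pochhammer (?D ! i) n)"
    using assms(1) by (simp only: prod_list_map_nth list.size add_Suc_right add_0_right lessThan_Suc_atMost prod_dividef)
  also have "\<dots> = (\<Prod>i\<le>length A. (Gamma (?D ! i) / Gamma (?C ! i)) * (Gamma (?C ! i + real n) / Gamma (?D ! i + real n)))"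
    using posi by (intro prod.cong refl) (simp add: g field_simps)
  finally show ?thesis by (simp only: prod.distrib)
qed

section \<open>The weight belonging to the given parameters\<close>

locale meijer_setting =
  fixes A B :: "real list" and \<sigma> :: real
  assumes weak: "B \<prec>\<^sup>W A" and excess: "0 < (\<Sum>i<length A. B ! i - A ! i)"
    and \<sigma>_pos: "0 < \<sigma>" and \<sigma>_le: "\<sigma> \<le> 1"
begin

text \<open>Shifting all parameters by the smallest one makes them nonnegative and the line \<open>Re z = 0\<close> critical.\<close>

definition \<kappa> :: real where "\<kappa> = Min (set (\<sigma> # A))"

lemma length_eq: "length B = length A"
  using weak by (simp add: weak_supermajorized_def)

lemma A_nonempty: "A \<noteq> []"
  using excess by auto

lemma pos: "x \<in> set (\<sigma> # A) \<union> set B \<Longrightarrow> 0 < x"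
  using weak \<sigma>_pos by (auto simp: weak_supermajorized_def)

lemma \<kappa>_pos: "0 < \<kappa>"
  unfolding \<kappa>_def using pos by (subst Min_gr_iff) auto

lemma \<kappa>_le_C: "i \<le> length A \<Longrightarrow> \<kappa> \<le> (\<sigma> # A) ! i"
  unfolding \<kappa>_def by (intro Min_le nth_mem) auto

text \<open>The first majorization inequality says that the smallest entry of \<open>A\<close> is at
  most that of \<open>B\<close>; the entry 1 is covered by \<sigma>.\<close>

lemma \<kappa>_le_D:
  assumes "i \<le> length A"
  shows "\<kappa> \<le> (1 # B) ! i"
proof (cases i)
  case 0
  then show ?thesis using \<kappa>_le_C[of 0] \<sigma>_le by simp
next
  case (Suc m)
  have "sum_list (take 1 A) \<le> sum_list (take 1 B)"
    using weak A_nonempty by (auto simp: weak_supermajorized_def Suc_le_eq simp del: take_Suc)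
  then have "A ! 0 \<le> B ! 0" using A_nonempty length_eq by (cases A; cases B) auto
  also have "B ! 0 \<le> B ! m"
    using weak assms Suc by (intro sorted_nth_mono) (auto simp: weak_supermajorized_def)
  finally show ?thesis using \<kappa>_le_C[of 1] A_nonempty Suc by (simp add: Suc_le_eq)
qed

text \<open>The pair \<sigma>, 1 adds \<open>1 - \<sigma>\<close> to the excess and a nonnegative
  difference to the exponential sums, both by \<open>\<sigma> \<le> 1\<close>. The shift by \<kappa>
  only contributes the common factor \<open>exp (\<kappa> * t)\<close>.\<close>

sublocale gamma_quotient "Suc (length A)" "\<lambda>i. (\<sigma> # A) ! i - \<kappa>" "\<lambda>i. (1 # B) ! i - \<kappa>"
proof
  show "0 \<le> (\<sigma> # A) ! i - \<kappa>" "0 \<le> (1 # B) ! i - \<kappa>" if "i < Suc (length A)" for i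
    using \<kappa>_le_C[of i] \<kappa>_le_D[of i] that by auto
  show "0 < (\<Sum>i<Suc (length A). (1 # B) ! i - \<kappa> - ((\<sigma> # A) ! i - \<kappa>))"
    using excess \<sigma>_le by (simp add: sum.lessThan_Suc_shift del: sum.lessThan_Suc)
  fix t :: real assume t: "0 < t"
  have shift: "exp (- (x - \<kappa>) * t) = exp (\<kappa> * t) * exp (- x * t)" for x
    by (simp add: algebra_simps flip: exp_add)
  have "(\<Sum>i<Suc (length A). exp (- ((1 # B) ! i) * t)) \<le> (\<Sum>i<Suc (length A). exp (- ((\<sigma> # A) ! i) * t))"
  proof -
    have "exp (- 1 * t) \<le> exp (- \<sigma> * t)" using t \<sigma>_le by simp
    from add_mono[OF this weak_supermajorized_exp_le[OF weak less_imp_le[OF t]]] show ?thesis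
      by (simp only: sum.lessThan_Suc_shift nth_Cons_0 nth_Cons_Suc)
  qed
  then show "(\<Sum>i<Suc (length A). exp (- ((1 # B) ! i - \<kappa>) * t)) \<le> (\<Sum>i<Suc (length A). exp (- ((\<sigma> # A) ! i - \<kappa>) * t))"
    unfolding shift sum_distrib_left[symmetric] by (intro mult_left_mono) auto
qed

text \<open>\<open>M n\<close> is the \<open>n\<close>-th moment of \<open>g x / x\<close> and also
  the Gamma quotient at \<open>n\<close>; \<open>c\<close> is the reciprocal of that quotient at 0.
  The bound by \<open>M 0\<close> serves for convergence of the series in the unit disc.\<close>

theorem exists_weight:
  obtains g M c where
    "\<And>x. x \<in> {0<..<1} \<Longrightarrow> has_meijer_G (1 # B) (\<sigma> # A) x (of_real (g x))"
    and "\<And>x. x \<in> {0<..<1} \<Longrightarrow> 0 < g x"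
    and "\<And>s. - 1 \<le> s \<Longrightarrow> set_integrable lborel {0<..<1} (\<lambda>x. x powr s * g x)"
    and "\<And>n. (LINT x:{0<..<1}|lborel. x powr (real n - 1) * g x) = M n"
    and "\<And>n. \<bar>M n\<bar> \<le> M 0"
    and "\<And>n. hypergeometric_coeff (\<sigma> # A) B n = c * M n"
proof -
  obtain h :: "real \<Rightarrow> real" where
    h_meas [measurable]: "h \<in> borel_measurable borel" and h0: "\<And>t. t \<le> 0 \<Longrightarrow> h t = 0" and h_pos: "\<And>t. 0 < t \<Longrightarrow> 0 < h t"
    and h_cont: "continuous_on {0<..} h"
    and h_int: "\<And>s. 0 < s \<Longrightarrow> integrable lborel (\<lambda>t. exp (- s * t) * h t)"
    and h_lip: "\<And>u. 0 < u \<Longrightarrow> \<exists>B. \<forall>t. \<bar>t - u\<bar> < u / 2 \<longrightarrow> \<bar>h t - h u\<bar> \<le> B * \<bar>t - u\<bar>"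
    and h_lap: "\<And>z. 0 < Re z \<Longrightarrow> laplace h z = (\<Prod>i<Suc (length A).
      Gamma (of_real ((\<sigma> # A) ! i - \<kappa>) + z) / Gamma (of_real ((1 # B) ! i - \<kappa>) + z))"
    by (rule exists_laplace_density) blast
  define g where "g x = x powr \<kappa> * h (- ln x)" for x
  define M where "M n = (LINT t|lborel. exp (- (real n + \<kappa>) * t) * h t)" for n
  have h_nonneg: "0 \<le> h t" for t using h0[of t] h_pos[of t] by (cases "0 < t") auto
  \<comment> \<open>The exponent is written so that the Laplace variable is
    \<open>s + 1 + \<kappa>\<close>, which is positive down to \<open>s = -1\<close>.\<close>
  have g_eq: "x powr s * g x = x powr (s + 1 + \<kappa> - 1) * h (- ln x)" for x s
    by (simp add: g_def powr_add flip: mult.assoc)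
  have M_pos: "0 < real n + \<kappa>" for n using \<kappa>_pos by (simp add: add_nonneg_pos)
  have M_Gamma: "M n = (\<Prod>i\<le>length A. Gamma ((\<sigma> # A) ! i + real n) / Gamma ((1 # B) ! i + real n))" for n
  proof -
    have "complex_of_real (M n) = laplace h (of_real (real n + \<kappa>))"
      unfolding M_def laplace_def by (subst integral_complex_of_real[symmetric]) (simp flip: exp_of_real)
    also have "\<dots> = (\<Prod>i<Suc (length A). Gamma (of_real ((\<sigma> # A) ! i + real n)) / Gamma (of_real ((1 # B) ! i + real n)))"
    proof -
      have "complex_of_real (x - \<kappa>) + of_real (real n + \<kappa>) = of_real (x + real n)" for x by simp
      then show ?thesis using M_pos[of n] by (simp only: h_lap Re_complex_of_real)
    qed
    also have "\<dots> = of_real (\<Prod>i\<le>length A. Gamma ((\<sigma> # A) ! i + real n) / Gamma ((1 # B) ! i + real n))"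
      unfolding Gamma_complex_of_real lessThan_Suc_atMost by simp
    finally show ?thesis by (simp only: of_real_eq_iff)
  qed
  show ?thesis
  proof (rule that[of g M "\<Prod>i\<le>length A. Gamma ((1 # B) ! i) / Gamma ((\<sigma> # A) ! i)"])
    show "has_meijer_G (1 # B) (\<sigma> # A) x (of_real (g x))" if "x \<in> {0<..<1}" for x
      unfolding g_def \<kappa>_def
      by (rule has_meijer_G_laplace[OF _ _ h_int h_lip _ that, where n = "Suc (length A)"])
         (use h_lap length_eq in \<open>simp_all add: \<kappa>_def\<close>)
    show "0 < g x" if "x \<in> {0<..<1}" for x
      using that h_pos[of "- ln x"] by (simp add: g_def)
    show "set_integrable lborel {0<..<1} (\<lambda>x. x powr s * g x)" if "- 1 \<le> s" for s
      unfolding g_eq using that \<kappa>_pos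
      by (intro exp_substitution(1)[OF h_meas h0 h_pos h_cont h_int]) auto
    show "(LINT x:{0<..<1}|lborel. x powr (real n - 1) * g x) = M n" for n
      unfolding g_eq M_def
      using exp_substitution(2)[OF h_meas h0 h_pos h_cont h_int[OF M_pos]] by simp
    show "\<bar>M n\<bar> \<le> M 0" for n
    proof -
      have "0 \<le> M n" unfolding M_def by (intro Bochner_Integration.integral_nonneg) (simp add: h_nonneg)
      moreover have "M n \<le> M 0"
        unfolding M_def
      proof (intro integral_mono h_int M_pos)
        fix t
        show "exp (- (real n + \<kappa>) * t) * h t \<le> exp (- (real 0 + \<kappa>) * t) * h t"
          using h0[of t] h_nonneg[of t] by (cases "0 < t") (auto intro!: mult_right_mono simp: left_diff_distrib)
      qed
      ultimately show ?thesis by simp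
    qed
    show "hypergeometric_coeff (\<sigma> # A) B n = (\<Prod>i\<le>length A. Gamma ((1 # B) ! i) / Gamma ((\<sigma> # A) ! i)) * M n" for n
      unfolding M_Gamma by (rule hypergeometric_coeff_Gamma[OF length_eq pos])
  qed
qed

end

text \<open>The first conjunct certifies that the definite description in \<open>meijer_G\<close>
  denotes the actual limit on (0,1); the next two ensure that the statement about orthogonal
  families is not vacuous. The denominator is specified by its values at nonzero \<open>z\<close>,
  which determine it as a polynomial.\<close>

theorem theorem11:
  fixes q :: nat and A B :: "real list" and \<sigma> :: real and j :: int
    and G w :: "real \<Rightarrow> complex" and f :: "complex \<Rightarrow> complex"
  assumes "q \<ge> 1" and "length A = q" and "length B = q"
    and "B \<prec>\<^sup>W A"
    and "(\<Sum>i<q. B ! i - A ! i) > 0"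
    and "0 < \<sigma>" and "\<sigma> \<le> 1"
    and "j \<ge> -1"
    and f_eq: "f = (\<lambda>z. hypergeometric (\<sigma> # A) B (- z))"
    and G_eq: "G = meijer_G (1 # B) (\<sigma> # A)"
    and w_eq: "w = (\<lambda>s. of_real (s powi j) * G s)"
  shows "(\<forall>s\<in>{0<..<1}. has_meijer_G (1 # B) (\<sigma> # A) s (G s))
    \<and> is_inner_product_weight w
    \<and> (\<exists>\<pi>. orthogonal_polys w \<pi>)
    \<and> (\<forall>\<pi> m. orthogonal_polys w \<pi> \<longrightarrow>
         (\<exists>Q. (\<forall>z. z \<noteq> 0 \<longrightarrow>
                  poly Q z = (- z) ^ m * poly (map_poly complex_of_real (\<pi> m)) (- 1 / z))
            \<and> (\<exists>!P. pade_pair f (int m + j) m P Q)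
            \<and> (\<forall>P. pade_pair f (int m + j) m P Q \<longrightarrow>
                 (\<forall>R. is_pade_approximant f (int m + j) m R \<longleftrightarrow> R = Fract P Q))))"
proof -
  interpret meijer_setting A B \<sigma> by unfold_locales (use assms in auto)
  obtain g M c where
    G: "\<And>x. x \<in> {0<..<1} \<Longrightarrow> has_meijer_G (1 # B) (\<sigma> # A) x (of_real (g x))"
    and g_pos: "\<And>x. x \<in> {0<..<1} \<Longrightarrow> 0 < g x"
    and g_int: "\<And>s. - 1 \<le> s \<Longrightarrow> set_integrable lborel {0<..<1} (\<lambda>x. x powr s * g x)"
    and M: "\<And>n. (LINT x:{0<..<1}|lborel. x powr (real n - 1) * g x) = M n"
    and M_le: "\<And>n. \<bar>M n\<bar> \<le> M 0"
    and coeff: "\<And>n. hypergeometric_coeff (\<sigma> # A) B n = c * M n"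
    by (rule exists_weight) blast
  have G_val: "G x = of_real (g x)" if "x \<in> {0<..<1}" for x
    unfolding G_eq by (rule meijer_G_eqI[OF G[OF that]])
  have powr: "x ^ i * (x powi j * g x) = x powr (real i + real_of_int j) * g x" if "x \<in> {0<..<1}" for x i
    using that by (simp add: powr_add powr_realpow powr_real_of_int')
  interpret W: unit_interval_weight "\<lambda>x. x powi j * g x" w
  proof
    show "0 < x powi j * g x" if "x \<in> {0<..<1}" for x using that g_pos by simp
    show "w x = of_real (x powi j * g x)" if "x \<in> {0<..<1}" for x
      by (simp add: w_eq G_val[OF that])
    fix i :: nat
    show "set_integrable lborel {0<..<1} (\<lambda>x. x ^ i * (x powi j * g x))"
    proof -
      have "set_integrable lborel {0<..<1} (\<lambda>x. x powr (real i + real_of_int j) * g x)"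
        using \<open>j \<ge> -1\<close> by (intro g_int) linarith
      then show ?thesis by (subst set_integrable_cong[OF refl refl powr]) auto
    qed
  qed
  \<comment> \<open>\<open>W.\<Lambda>\<close> carries the weight \<open>x powi j * g x\<close>
    while \<open>M\<close> belongs to \<open>g x / x\<close>; hence the shift by
    \<open>j + 1\<close>, nonnegative as \<open>j \<ge> -1\<close>.\<close>
  have moment: "W.\<Lambda> (monom 1 i) = M (nat (int i + j + 1))" for i
  proof -
    have n: "real (nat (int i + j + 1)) - 1 = real i + real_of_int j" using \<open>j \<ge> -1\<close> by simp
    have "W.\<Lambda> (monom 1 i) = (LINT x:{0<..<1}|lborel. x powr (real i + real_of_int j) * g x)"
      unfolding W.\<Lambda>_def poly_monom by (intro set_lebesgue_integral_cong) (auto simp: powr)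
    then show ?thesis using M[of "nat (int i + j + 1)"] unfolding n by simp
  qed
  define a where "a n = (-1) ^ n * complex_of_real (c * M n)" for n
  \<comment> \<open>Only the germ at 0 matters, so the defining series in the unit disc is enough
    and the continuation is never consulted.\<close>
  interpret F: power_series_at_0 f a 1
  proof
    fix z :: complex assume z: "norm z < 1"
    show "f z = (\<Sum>n. a n * z ^ n)"
      using z by (simp add: f_eq hypergeometric_def hypergeometric_series_def coeff a_def power_minus[of z] mult_ac)
    show "summable (\<lambda>n. a n * z ^ n)"
    proof (rule summable_comparison_test')
      show "summable (\<lambda>n. \<bar>c\<bar> * M 0 * norm z ^ n)"
        using z by (intro summable_mult summable_geometric) simp
      show "norm (a n * z ^ n) \<le> \<bar>c\<bar> * M 0 * norm z ^ n" for n
        using mult_left_mono[OF M_le[of n], of "\<bar>c\<bar>"]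
        by (simp add: a_def norm_mult norm_power abs_mult mult_right_mono)
    qed
  qed simp
  have denominator: "\<exists>Q. (\<forall>z. z \<noteq> 0 \<longrightarrow>
        poly Q z = (- z) ^ m * poly (map_poly complex_of_real (\<pi> m)) (- 1 / z))
      \<and> (\<exists>!P. pade_pair f (int m + j) m P Q)
      \<and> (\<forall>P. pade_pair f (int m + j) m P Q \<longrightarrow>
           (\<forall>R. is_pade_approximant f (int m + j) m R \<longleftrightarrow> R = Fract P Q))"
    if \<pi>: "orthogonal_polys w \<pi>" for \<pi> m
  proof -
    have deg: "degree (\<pi> m) = m" and nz: "\<pi> m \<noteq> 0" using \<pi> by (auto simp: orthogonal_polys_def)
    define Q where "Q = reversed_denominator (\<pi> m)"
    have coeff_Q: "coeff Q e = (if e \<le> m then of_real (coeff (\<pi> m) (m - e)) * (-1) ^ e else 0)" for e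
      unfolding Q_def coeff_reversed_denominator deg ..
    have "coeff Q 0 \<noteq> 0" using nz deg leading_coeff_0_iff[of "\<pi> m"] by (simp add: coeff_Q)
    then have Q: "Q \<noteq> 0" by (metis coeff_0)
    have deg_Q: "degree Q \<le> m" by (rule degree_le) (simp add: coeff_Q)
    have k: "- 1 \<le> int m + j" using \<open>j \<ge> -1\<close> by simp
    have "\<exists>!P. pade_pair f (int m + j) m P Q"
    proof (rule F.pade_denominator[OF k Q deg_Q])
      fix i assume i: "int m + j < int i" "int i \<le> int m + j + int m"
      \<comment> \<open>As \<open>i\<close> runs through the gap from \<open>m + j + 1\<close> to
        \<open>2 * m + j\<close>, \<open>l\<close> runs from 0 to \<open>m - 1\<close>; so each
        equation of the gap is orthogonality of \<open>\<pi> m\<close> to one power of degree below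
        \<open>m\<close>.\<close>
      define l where "l = nat (int i - int m - j - 1)"
      have l: "l < m" "m \<le> i" using i \<open>j \<ge> -1\<close> by (auto simp: l_def)
      have M_eq: "M (e + (i - m)) = W.\<Lambda> (monom 1 (e + l))" for e
        unfolding moment using i l \<open>j \<ge> -1\<close> by (intro arg_cong[of _ _ M]) (auto simp: l_def)
      have "coeff (truncation a (nat (int m + j + int m + 1)) * Q) i =
          (-1) ^ i * of_real (c * (\<Sum>e\<le>degree (\<pi> m). coeff (\<pi> m) e * M (e + (i - degree (\<pi> m)))))"
        unfolding Q_def using i l by (intro coeff_truncation_mult_reversed) (auto simp: a_def deg)
      also have "(\<Sum>e\<le>degree (\<pi> m). coeff (\<pi> m) e * M (e + (i - degree (\<pi> m)))) = W.\<Lambda> (\<pi> m * monom 1 l)"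
        unfolding deg M_eq by (rule W.\<Lambda>_mult_monom[OF deg, symmetric])
      also have "W.\<Lambda> (\<pi> m * monom 1 l) = 0"
        using l by (intro W.orthogonal_polys_lower_degree[OF \<pi>]) (simp add: degree_monom_eq)
      finally show "coeff (truncation a (nat (int m + j + int m + 1)) * Q) i = 0" by simp
    qed
    moreover have "poly Q z = (- z) ^ m * poly (map_poly complex_of_real (\<pi> m)) (- 1 / z)" if "z \<noteq> 0" for z
      unfolding Q_def using poly_reversed_denominator[OF that, of "\<pi> m"] by (simp only: deg)
    ultimately show ?thesis
      using F.pade_approximant_unique[OF k] by (intro exI[of _ Q] conjI allI impI) blast+
  qed
  have "\<forall>s\<in>{0<..<1}. has_meijer_G (1 # B) (\<sigma> # A) s (G s)"
    using G by (simp add: G_val)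
  with denominator W.is_inner_product_weight W.orthogonal_polys_gram_schmidt show ?thesis by blast
qed

end
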